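(* Let $\{T(t)\}_{t\ge0}$ be a $\mathcal{C}_0$-semigroup on a real Banach space $X$ admitting a trichotomy decomposition $X=X_-\oplus X_0\oplus X_+$ with exponents $a<0<b$, and such that $[X^{\odot\times}]_0\subseteq jX$ and $[X^{\odot\times}]_+\subseteq jX$. Let $\eta\in(0,\min\{-a,b\})$ and define, for $f\in\mathrm{BC}^\eta(\mathbb{R},X^{\odot\times})$ and $t\in\mathbb{R}$, $$(\mathcal{K}_\eta f)(t):=j^{-1}\int_0^tT^{\odot\star}(t-\tau)P_0^{\odot\times}f(\tau)\,d\tau+j^{-1}\int_\infty^tT^{\odot\star}(t-\tau)P_+^{\odot\times}f(\tau)\,d\tau+j^{-1}\int_{-\infty}^tT^{\odot\star}(t-\tau)P_-^{\odot\times}f(\tau)\,d\tau.$$ Then: (i) $\mathcal{K}_\eta:\mathrm{BC}^\eta(\mathbb{R},X^{\odot\times})\to\mathrm{BC}^\eta(\mathbb{R},X)$ is a well-defined bounded linear operator. (ii) For every $f\in\mathrm{BC}^\eta(\mathbb{R},X^{\odot\times})$, $\mathcal{K}_\eta f$ is the unique solution $u\in\mathrm{BC}^\eta(\mathbb{R},X)$ of $$u(t)=T(t-s)u(s)+j^{-1}\int_s^tT^{\odot\star}(t-\tau)f(\tau)\,d\tau\qquad\text{for all }-\infty<s\le t<\infty$$ with zero $X_0$-component at $t=0$, i.e. with $P_0u(0)=0$.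
   Context: For a Banach space $E$, $\langle x,x^\star\rangle:=x^\star(x)$. $A$ is the generator of $\{T(t)\}$. $X^\odot:=\{x^\star\in X^\star:\lim_{t\downarrow0}\|T(t)^\star x^\star-x^\star\|=0\}$ (closed subspace), $T^\odot(t):=T(t)^\star|_{X^\odot}$ with generator $A^\odot$, $X^{\odot\star}:=(X^\odot)^\star$, $T^{\odot\star}(t):=(T^\odot(t))^\star$, $A^{\odot\star}:=(A^\odot)^\star$. $j:X\to X^{\odot\star}$, $\langle x^\odot,jx\rangle:=\langle x,x^\odot\rangle$, is injective with closed range $jX$, $j^{-1}:jX\to X$. Sun-reflexivity is not assumed. $X^{\odot\times}:=\{x^{\odot\star}\in X^{\odot\star}:(\lambda I-A^{\odot\star})^{-1}x^{\odot\star}\in jX\}$ for $\lambda\in\rho(A)$, a closed subspace independent of $\lambda$; for continuous $f$ with values in $X^{\odot\times}$ and $s\le t$ one has $\int_s^tT^{\odot\star}(t-\tau)f(\tau)d\tau\in jX$. Integrals of $X^{\odot\star}$-valued functions over an interval $J$ (possibly unbounded) are weak$^\star$ integrals: $\langle x^\odot,\int_Jq\,d\tau\rangle:=\int_J\langle x^\odot,q(\tau)\rangle d\tau$, defined when all scalar integrands are in $L^1(J)$; $\int_\infty^t:=-\int_t^\infty$ and $\int_0^t:=-\int_t^0$ for $t<0$. Trichotomy decomposition with exponents $a<0<b$: a direct sum $X=X_-\oplus X_0\oplus X_+$ into closed subspaces, each positively $T$-invariant, such that $\{T(t)\}$ extends to a $\mathcal{C}_0$-group on $X_0$ and on $X_+$,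 and for every $\varepsilon>0$ there is $K_\varepsilon>0$ with $\|T(t)\phi\|\le K_\varepsilon e^{at}\|\phi\|$ ($t\ge0$, $\phi\in X_-$), $\|T(t)\phi\|\le K_\varepsilon e^{\varepsilon|t|}\|\phi\|$ ($t\in\mathbb{R}$, $\phi\in X_0$), $\|T(t)\phi\|\le K_\varepsilon e^{bt}\|\phi\|$ ($t\le0$, $\phi\in X_+$). For $\mu\in\{-,0,+\}$, $P_\mu$ is the projector onto $X_\mu$ along the other summands; $P_\mu^\star$ leaves $X^\odot$ invariant, $P_\mu^\odot:=P_\mu^\star|_{X^\odot}$, $P_\mu^{\odot\star}:=(P_\mu^\odot)^\star$ leaves $X^{\odot\times}$ invariant, $P_\mu^{\odot\times}:=P_\mu^{\odot\star}|_{X^{\odot\times}}$, with range $[X^{\odot\times}]_\mu$. The semigroup $\{T^{\odot\star}(t)\}_{t\ge0}$ leaves each $[X^{\odot\times}]_\mu$ invariant and extends to a group on $[X^{\odot\times}]_0$ and on $[X^{\odot\times}]_+$; $T^{\odot\star}(t)$ for $t<0$ refers to these groups. For a Banach space $E$, $\mathrm{BC}^\eta(\mathbb{R},E):=\{f\in C(\mathbb{R},E):\sup_{t\in\mathbb{R}}e^{-\eta|t|}\|f(t)\|<\infty\}$ with that supremum as norm. *)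

theory Defs
  imports "HOL-Analysis.Analysis"
begin

text \<open>
  The dual of a linear subspace S of a normed space. A functional on S is represented by its
  extension by 0 to the ambient type, so that equality of functionals on S is equality of functions.
\<close>

definition dual_on :: "'v::real_normed_vector set \<Rightarrow> ('v \<Rightarrow> real) set" where
  "dual_on S = {\<phi>. (\<forall>x. x \<notin> S \<longrightarrow> \<phi> x = 0)
      \<and> (\<forall>x\<in>S. \<forall>y\<in>S. \<phi> (x + y) = \<phi> x + \<phi> y)
      \<and> (\<forall>c. \<forall>x\<in>S. \<phi> (c *\<^sub>R x) = c * \<phi> x)
      \<and> (\<exists>C. \<forall>x\<in>S. \<bar>\<phi> x\<bar> \<le> C * norm x)}"

definition dual_norm :: "'v::real_normed_vector set \<Rightarrow> ('v \<Rightarrow> real) \<Rightarrow> real" where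
  "dual_norm S \<phi> = (SUP x\<in>{x\<in>S. norm x \<le> 1}. \<bar>\<phi> x\<bar>)"

definition dual_map :: "'v set \<Rightarrow> ('v \<Rightarrow> 'v) \<Rightarrow> ('v \<Rightarrow> real) \<Rightarrow> ('v \<Rightarrow> real)" where
  "dual_map S B \<phi> = (\<lambda>x. if x \<in> S then \<phi> (B x) else 0)"

text \<open>
  Weak-star integral from \<open>a\<close> to \<open>b\<close> of a function with values in \<open>dual_on S\<close>. The endpoints are
  extended reals, and the integral changes sign when the endpoints are exchanged.
\<close>

definition wstar_integrable ::
    "'v set \<Rightarrow> ereal \<Rightarrow> ereal \<Rightarrow> (real \<Rightarrow> 'v \<Rightarrow> real) \<Rightarrow> bool" where
  "wstar_integrable S a b q \<longleftrightarrow>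
     (\<forall>x\<in>S. interval_lebesgue_integrable lebesgue a b (\<lambda>\<tau>. q \<tau> x))"

definition wstar_integral ::
    "'v set \<Rightarrow> ereal \<Rightarrow> ereal \<Rightarrow> (real \<Rightarrow> 'v \<Rightarrow> real) \<Rightarrow> ('v \<Rightarrow> real)" where
  "wstar_integral S a b q =
     (\<lambda>x. if x \<in> S then interval_lebesgue_integral lebesgue a b (\<lambda>\<tau>. q \<tau> x) else 0)"

text \<open>
  Semigroups and unbounded operators. A semigroup is indexed by all reals, but only its values at
  nonnegative times are ever used. Unbounded operators are represented by their graphs.
\<close>

definition C0_semigroup :: "(real \<Rightarrow> 'a::real_normed_vector \<Rightarrow>\<^sub>L 'a) \<Rightarrow> bool" where
  "C0_semigroup T \<longleftrightarrow> T 0 = id_blinfun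
     \<and> (\<forall>s\<ge>0. \<forall>t\<ge>0. T (s + t) = T s o\<^sub>L T t)
     \<and> (\<forall>x. ((\<lambda>t. blinfun_apply (T t) x) \<longlongrightarrow> x) (at_right 0))"

definition generator ::
    "'v::real_normed_vector set \<Rightarrow> (real \<Rightarrow> 'v \<Rightarrow> 'v) \<Rightarrow> ('v \<times> 'v) set" where
  "generator E S = {(x, y). x \<in> E \<and> y \<in> E
      \<and> ((\<lambda>h. (S h x - x) /\<^sub>R h) \<longlongrightarrow> y) (at_right 0)}"

definition resolvent_set :: "('v::real_normed_vector \<times> 'v) set \<Rightarrow> real set" where
  "resolvent_set A = {l. (\<forall>y. \<exists>!x. \<exists>z. (x, z) \<in> A \<and> l *\<^sub>R x - z = y)
      \<and> (\<exists>M. \<forall>(x, z)\<in>A. norm x \<le> M * norm (l *\<^sub>R x - z))}"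

text \<open>The adjoint of a densely defined operator A in S, as an operator in \<open>dual_on S\<close>.\<close>

definition adjoint_graph ::
    "'v::real_normed_vector set \<Rightarrow> ('v \<times> 'v) set \<Rightarrow> (('v \<Rightarrow> real) \<times> ('v \<Rightarrow> real)) set" where
  "adjoint_graph S A = {(\<phi>, \<psi>). \<phi> \<in> dual_on S \<and> \<psi> \<in> dual_on S
      \<and> (\<forall>(x, y)\<in>A. \<phi> y = \<psi> x)}"

definition dual_resolvent ::
    "(('v \<Rightarrow> real) \<times> ('v \<Rightarrow> real)) set \<Rightarrow> real \<Rightarrow> ('v \<Rightarrow> real) \<Rightarrow> ('v \<Rightarrow> real)" where
  "dual_resolvent B l \<phi> = (THE \<psi>. \<exists>\<omega>. (\<psi>, \<omega>) \<in> B \<and> (\<lambda>x. l * \<psi> x - \<omega> x) = \<phi>)"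

text \<open>The sun dual and the spaces and operators built on it\<close>

definition adj :: "('a::real_normed_vector \<Rightarrow>\<^sub>L 'a) \<Rightarrow> ('a \<Rightarrow>\<^sub>L real) \<Rightarrow> ('a \<Rightarrow>\<^sub>L real)" where
  "adj B x' = x' o\<^sub>L B"

definition sun :: "(real \<Rightarrow> 'a::banach \<Rightarrow>\<^sub>L 'a) \<Rightarrow> ('a \<Rightarrow>\<^sub>L real) set" where
  "sun T = {x'. ((\<lambda>t. norm (adj (T t) x' - x')) \<longlongrightarrow> 0) (at_right 0)}"

definition sun_star :: "(real \<Rightarrow> 'a::banach \<Rightarrow>\<^sub>L 'a) \<Rightarrow> (('a \<Rightarrow>\<^sub>L real) \<Rightarrow> real) set" where
  "sun_star T = dual_on (sun T)"

definition sun_star_norm :: "(real \<Rightarrow> 'a::banach \<Rightarrow>\<^sub>L 'a) \<Rightarrow> (('a \<Rightarrow>\<^sub>L real) \<Rightarrow> real) \<Rightarrow> real" where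
  "sun_star_norm T = dual_norm (sun T)"

definition T_sun_star ::
    "(real \<Rightarrow> 'a::banach \<Rightarrow>\<^sub>L 'a) \<Rightarrow> real
      \<Rightarrow> (('a \<Rightarrow>\<^sub>L real) \<Rightarrow> real) \<Rightarrow> (('a \<Rightarrow>\<^sub>L real) \<Rightarrow> real)" where
  "T_sun_star T t = dual_map (sun T) (adj (T t))"

definition A_sun_star ::
    "(real \<Rightarrow> 'a::banach \<Rightarrow>\<^sub>L 'a)
      \<Rightarrow> ((('a \<Rightarrow>\<^sub>L real) \<Rightarrow> real) \<times> (('a \<Rightarrow>\<^sub>L real) \<Rightarrow> real)) set" where
  "A_sun_star T = adjoint_graph (sun T) (generator (sun T) (\<lambda>t. adj (T t)))"

definition sun_j :: "(real \<Rightarrow> 'a::banach \<Rightarrow>\<^sub>L 'a) \<Rightarrow> 'a \<Rightarrow> (('a \<Rightarrow>\<^sub>L real) \<Rightarrow> real)" where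
  "sun_j T x = (\<lambda>x'. if x' \<in> sun T then blinfun_apply x' x else 0)"

text \<open>
  The set below does not depend on the choice of \<open>l\<close> in the resolvent set of the generator.
\<close>

definition sun_cross ::
    "(real \<Rightarrow> 'a::banach \<Rightarrow>\<^sub>L 'a) \<Rightarrow> real \<Rightarrow> (('a \<Rightarrow>\<^sub>L real) \<Rightarrow> real) set" where
  "sun_cross T l = {\<phi> \<in> sun_star T. dual_resolvent (A_sun_star T) l \<phi> \<in> range (sun_j T)}"

text \<open>
  Groups on a subspace E. If a group \<open>G\<close> extends the semigroup \<open>S\<close> on \<open>E\<close>, then \<open>G (- t)\<close> is
  necessarily the inverse of \<open>S t\<close> on \<open>E\<close> for \<open>t > 0\<close>; this determines \<open>group_ext\<close>.
\<close>

definition group_ext :: "(real \<Rightarrow> 'v \<Rightarrow> 'v) \<Rightarrow> 'v set \<Rightarrow> real \<Rightarrow> 'v \<Rightarrow> 'v" where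
  "group_ext S E t = (if 0 \<le> t then S t else the_inv_into E (S (- t)))"

definition C0_group_on :: "'v::real_normed_vector set \<Rightarrow> (real \<Rightarrow> 'v \<Rightarrow> 'v) \<Rightarrow> bool" where
  "C0_group_on E G \<longleftrightarrow>
     (\<forall>t. (\<forall>x\<in>E. G t x \<in> E)
        \<and> (\<forall>x\<in>E. \<forall>y\<in>E. G t (x + y) = G t x + G t y)
        \<and> (\<forall>c. \<forall>x\<in>E. G t (c *\<^sub>R x) = c *\<^sub>R G t x)
        \<and> (\<exists>C. \<forall>x\<in>E. norm (G t x) \<le> C * norm x))
     \<and> (\<forall>x\<in>E. G 0 x = x)
     \<and> (\<forall>s t. \<forall>x\<in>E. G (s + t) x = G s (G t x))
     \<and> (\<forall>x\<in>E. ((\<lambda>t. G t x) \<longlongrightarrow> x) (at 0))"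

definition extends_to_C0_group ::
    "(real \<Rightarrow> 'v::real_normed_vector \<Rightarrow> 'v) \<Rightarrow> 'v set \<Rightarrow> bool" where
  "extends_to_C0_group S E \<longleftrightarrow>
     (\<exists>G. C0_group_on E G \<and> (\<forall>t\<ge>0. \<forall>x\<in>E. G t x = S t x))"

definition trichotomy ::
    "(real \<Rightarrow> 'a::banach \<Rightarrow>\<^sub>L 'a) \<Rightarrow> 'a set \<Rightarrow> 'a set \<Rightarrow> 'a set \<Rightarrow> real \<Rightarrow> real \<Rightarrow> bool" where
  "trichotomy T Xm X0 Xp a b \<longleftrightarrow>
     a < 0 \<and> 0 < b
     \<and> (\<forall>E\<in>{Xm, X0, Xp}. subspace E \<and> closed E \<and> (\<forall>t\<ge>0. blinfun_apply (T t) ` E \<subseteq> E))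
     \<and> (\<forall>x. \<exists>!p. p \<in> Xm \<times> X0 \<times> Xp \<and> x = fst p + fst (snd p) + snd (snd p))
     \<and> extends_to_C0_group (\<lambda>t. blinfun_apply (T t)) X0
     \<and> extends_to_C0_group (\<lambda>t. blinfun_apply (T t)) Xp
     \<and> (\<forall>\<epsilon>>0. \<exists>K>0.
          (\<forall>t\<ge>0. \<forall>x\<in>Xm. norm (blinfun_apply (T t) x) \<le> K * exp (a * t) * norm x)
        \<and> (\<forall>t. \<forall>x\<in>X0. norm (group_ext (\<lambda>t. blinfun_apply (T t)) X0 t x)
                          \<le> K * exp (\<epsilon> * \<bar>t\<bar>) * norm x)
        \<and> (\<forall>t\<le>0. \<forall>x\<in>Xp. norm (group_ext (\<lambda>t. blinfun_apply (T t)) Xp t x)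
                             \<le> K * exp (b * t) * norm x))"

text \<open>The projector onto U along V + W\<close>

definition projector :: "'a::ab_group_add set \<Rightarrow> 'a set \<Rightarrow> 'a set \<Rightarrow> 'a \<Rightarrow> 'a" where
  "projector U V W x = (THE u. u \<in> U \<and> (\<exists>v\<in>V. \<exists>w\<in>W. x = u + v + w))"

text \<open>
  Here \<open>P\<close> is a projector between closed summands, hence bounded, so \<open>Blinfun P\<close> is \<open>P\<close> itself.
\<close>

definition P_sun_star ::
    "(real \<Rightarrow> 'a::banach \<Rightarrow>\<^sub>L 'a) \<Rightarrow> ('a \<Rightarrow> 'a)
      \<Rightarrow> (('a \<Rightarrow>\<^sub>L real) \<Rightarrow> real) \<Rightarrow> (('a \<Rightarrow>\<^sub>L real) \<Rightarrow> real)" where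
  "P_sun_star T P = dual_map (sun T) (adj (Blinfun P))"

definition sun_cross_part ::
    "(real \<Rightarrow> 'a::banach \<Rightarrow>\<^sub>L 'a) \<Rightarrow> real \<Rightarrow> ('a \<Rightarrow> 'a) \<Rightarrow> (('a \<Rightarrow>\<^sub>L real) \<Rightarrow> real) set" where
  "sun_cross_part T l P = P_sun_star T P ` sun_cross T l"

text \<open>
  The space of continuous functions of growth rate \<open>eta\<close> with values in the carrier \<open>E\<close>
  normed by \<open>N\<close>.
\<close>

definition BC :: "real \<Rightarrow> 'v::minus set \<Rightarrow> ('v \<Rightarrow> real) \<Rightarrow> (real \<Rightarrow> 'v) set" where
  "BC eta E N = {f. (\<forall>t. f t \<in> E)
      \<and> (\<forall>t. ((\<lambda>s. N (f s - f t)) \<longlongrightarrow> 0) (at t))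
      \<and> bdd_above (range (\<lambda>t. exp (- eta * \<bar>t\<bar>) * N (f t)))}"

definition BC_norm :: "real \<Rightarrow> ('v \<Rightarrow> real) \<Rightarrow> (real \<Rightarrow> 'v) \<Rightarrow> real" where
  "BC_norm eta N f = (SUP t. exp (- eta * \<bar>t\<bar>) * N (f t))"

text \<open>
  The integrands of the operator K. The groups extending \<open>T_sun_star\<close> act on the parts of
  \<open>sun_cross T l\<close> belonging to \<open>P0\<close> and \<open>Pp\<close>; in the integral of \<open>semigroup_integrand\<close>,
  only \<open>\<tau> < t\<close> occurs.
\<close>

definition group_integrand ::
    "(real \<Rightarrow> 'a::banach \<Rightarrow>\<^sub>L 'a) \<Rightarrow> real \<Rightarrow> ('a \<Rightarrow> 'a)
      \<Rightarrow> (real \<Rightarrow> ('a \<Rightarrow>\<^sub>L real) \<Rightarrow> real) \<Rightarrow> real \<Rightarrow> real \<Rightarrow> ('a \<Rightarrow>\<^sub>L real) \<Rightarrow> real" where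
  "group_integrand T l P f t \<tau> =
     group_ext (T_sun_star T) (sun_cross_part T l P) (t - \<tau>) (P_sun_star T P (f \<tau>))"

definition semigroup_integrand ::
    "(real \<Rightarrow> 'a::banach \<Rightarrow>\<^sub>L 'a) \<Rightarrow> ('a \<Rightarrow> 'a)
      \<Rightarrow> (real \<Rightarrow> ('a \<Rightarrow>\<^sub>L real) \<Rightarrow> real) \<Rightarrow> real \<Rightarrow> real \<Rightarrow> ('a \<Rightarrow>\<^sub>L real) \<Rightarrow> real" where
  "semigroup_integrand T P f t \<tau> = T_sun_star T (t - \<tau>) (P_sun_star T P (f \<tau>))"

text \<open>The integral exists as a weak-star integral and lies in the range of \<open>sun_j T\<close>.\<close>

definition integral_in_j ::
    "(real \<Rightarrow> 'a::banach \<Rightarrow>\<^sub>L 'a) \<Rightarrow> ereal \<Rightarrow> ereal \<Rightarrow> (real \<Rightarrow> ('a \<Rightarrow>\<^sub>L real) \<Rightarrow> real) \<Rightarrow> bool" where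
  "integral_in_j T a b q \<longleftrightarrow> wstar_integrable (sun T) a b q
     \<and> wstar_integral (sun T) a b q \<in> range (sun_j T)"

definition j_inv_integral ::
    "(real \<Rightarrow> 'a::banach \<Rightarrow>\<^sub>L 'a) \<Rightarrow> ereal \<Rightarrow> ereal \<Rightarrow> (real \<Rightarrow> ('a \<Rightarrow>\<^sub>L real) \<Rightarrow> real) \<Rightarrow> 'a" where
  "j_inv_integral T a b q = inv (sun_j T) (wstar_integral (sun T) a b q)"

definition K_defined ::
    "(real \<Rightarrow> 'a::banach \<Rightarrow>\<^sub>L 'a) \<Rightarrow> real \<Rightarrow> ('a \<Rightarrow> 'a) \<Rightarrow> ('a \<Rightarrow> 'a) \<Rightarrow> ('a \<Rightarrow> 'a)
      \<Rightarrow> (real \<Rightarrow> ('a \<Rightarrow>\<^sub>L real) \<Rightarrow> real) \<Rightarrow> real \<Rightarrow> bool" where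
  "K_defined T l Pm P0 Pp f t \<longleftrightarrow>
     integral_in_j T 0 (ereal t) (group_integrand T l P0 f t)
     \<and> integral_in_j T \<infinity> (ereal t) (group_integrand T l Pp f t)
     \<and> integral_in_j T (-\<infinity>) (ereal t) (semigroup_integrand T Pm f t)"

definition K_op ::
    "(real \<Rightarrow> 'a::banach \<Rightarrow>\<^sub>L 'a) \<Rightarrow> real \<Rightarrow> ('a \<Rightarrow> 'a) \<Rightarrow> ('a \<Rightarrow> 'a) \<Rightarrow> ('a \<Rightarrow> 'a)
      \<Rightarrow> (real \<Rightarrow> ('a \<Rightarrow>\<^sub>L real) \<Rightarrow> real) \<Rightarrow> real \<Rightarrow> 'a" where
  "K_op T l Pm P0 Pp f t =
     j_inv_integral T 0 (ereal t) (group_integrand T l P0 f t)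
     + j_inv_integral T \<infinity> (ereal t) (group_integrand T l Pp f t)
     + j_inv_integral T (-\<infinity>) (ereal t) (semigroup_integrand T Pm f t)"

definition solves_on_R ::
    "(real \<Rightarrow> 'a::banach \<Rightarrow>\<^sub>L 'a) \<Rightarrow> (real \<Rightarrow> ('a \<Rightarrow>\<^sub>L real) \<Rightarrow> real) \<Rightarrow> (real \<Rightarrow> 'a) \<Rightarrow> bool" where
  "solves_on_R T f u \<longleftrightarrow> (\<forall>s t. s \<le> t \<longrightarrow>
     integral_in_j T (ereal s) (ereal t) (\<lambda>\<tau>. T_sun_star T (t - \<tau>) (f \<tau>))
     \<and> u t = blinfun_apply (T (t - s)) (u s)
         + j_inv_integral T (ereal s) (ereal t) (\<lambda>\<tau>. T_sun_star T (t - \<tau>) (f \<tau>)))"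

end

theory Submission
  imports Defs
begin

text \<open>
  Let A be the generator of T and R the resolvent of A at l. The adjoint of R leaves the sun dual
  invariant and is there the resolvent of the sun generator. Hence a functional \<open>\<phi>\<close> on the sun dual
  belongs to the sun cross space exactly if \<open>\<phi> \<circ> adj R\<close> is the evaluation at some \<open>y\<close> in X. The
  function \<open>r \<mapsto> \<phi> (adj (T r) (adj R x')) = x' (T r y)\<close> then has the derivative
  \<open>l * x' (T r y) - \<phi> (adj (T r) x')\<close>, and integration expresses the integral of
  \<open>\<phi> (adj (T r) x')\<close> over a compact interval by \<open>y\<close> alone: it is the evaluation at an element of X
  (lemma \<open>sun_cross_orbit_integral\<close>). A norm continuous forcing term is locally a uniform limit of
  step functions. The embedding j of X has closed range, because the sun dual is norming
  for X. So the integral of \<open>T_sun_star T (t - \<tau>) (f \<tau>)\<close> over a compact interval lies in the range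
  of j as well (lemma \<open>sun_cross_convolution\<close>).

  The three terms of the operator are then treated separately. In the term for the decaying
  subspace the substitution \<open>\<sigma> = t - \<tau>\<close> gives an integral over a fixed half-line; exponential decay
  makes the integrals over compact intervals converge, the limit stays in the closed range of j,
  and dominated convergence gives continuity in \<open>t\<close>. In the other two terms the projected forcing is
  \<open>j \<circ> y\<close> for a continuous \<open>y\<close> with values in X, and j intertwines the group on X with
  the one on the sun cross space. These terms are therefore \<open>Q t (H t - h)\<close>, where \<open>Q\<close> is the group
  composed with the projector, \<open>H\<close> is an antiderivative of \<open>Q (- \<tau>) (y \<tau>)\<close>, and \<open>h\<close> is \<open>H 0\<close> or the
  limit of \<open>H\<close> at infinity. In all three terms the norm of the integrand is at most a constant times
  \<open>exp (\<eta> * \<bar>t\<bar>) * exp (- \<delta> * \<bar>t - \<tau>\<bar>)\<close> with \<open>\<delta> > 0\<close>, whence the bound on the operator. Each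
  term solves the variation-of-constants equation for the projected forcing, and the sum
  solves the equation for the forcing itself (lemma \<open>K_map_properties\<close>).

  The difference of two solutions is an orbit of T on the whole line with growth rate \<open>\<eta>\<close>. Its
  component in the decaying subspace vanishes by letting the initial time tend to minus infinity,
  its unstable component by letting the final time tend to infinity, and its center component because
  it vanishes at time 0 (lemma \<open>bounded_orbit_unique\<close>). Linearity of the operator is a consequence of
  uniqueness.

  Three facts about Banach spaces enter: the uniform boundedness principle and the boundedness of
  projectors between closed summands, which both follow from Zabreiko's lemma on countably subadditive
  seminorms, and the existence of norming functionals.
\<close>

section \<open>Countably subadditive seminorms\<close>

text \<open>
  Zabreiko's lemma. By Baire's theorem the closure of some sublevel set of \<open>p\<close> has an interior point,
  and by symmetry and convexity it contains a ball around 0. Hence every vector is approximated up to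
  half its norm by one on which \<open>p\<close> is controlled by that norm. Iteration on the remainder writes the
  vector as a series, and countable subadditivity adds up the estimates.
\<close>

lemma bounded_of_countably_subadditive:
  fixes p :: "'a::banach \<Rightarrow> real"
  assumes scale: "\<And>c x. p (c *\<^sub>R x) = \<bar>c\<bar> * p x"
    and csub: "\<And>f. summable f \<Longrightarrow> summable (\<lambda>n. p (f n)) \<Longrightarrow> p (suminf f) \<le> (\<Sum>n. p (f n))"
  obtains C where "C \<ge> 0" "\<And>x. p x \<le> C * norm x"
proof -
  have p0: "p 0 = 0"
    using scale[of 0 0] by simp
  have padd: "p (x + y) \<le> p x + p y" for x y
  proof -
    let ?f = "\<lambda>n. if n = 0 then x else if n = Suc 0 then y else 0"
    have f: "?f sums (x + y)" and pf: "(\<lambda>n. p (?f n)) sums (p x + p y)"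
      using sums_finite[of "{..<2}" ?f] sums_finite[of "{..<2}" "\<lambda>n. p (?f n)"]
      by (auto simp: p0 numeral_2_eq_2)
    show ?thesis
      using csub[OF sums_summable[OF f] sums_summable[OF pf]] sums_unique[OF f] sums_unique[OF pf]
      by simp
  qed
  have pneg: "p (- x) = p x" for x
    using scale[of "-1" x] by simp
  have p_nonneg: "0 \<le> p x" for x
    using padd[of x "- x"] p0 pneg[of x] by simp
  define F where "F n = closure {x. p x \<le> real n}" for n :: nat
  have "\<exists>n. interior (F n) \<noteq> {}"
  proof (rule ccontr)
    assume "\<nexists>n. interior (F n) \<noteq> {}"
    then have e: "interior (F n) = {}" for n by blast
    have "Met_TC.mtopology interior_of \<Union> (range F) = {}"
    proof (rule Met_TC.metric_Baire_category_alt)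
      show "Met_TC.mcomplete TYPE('a)" by (simp add: complete_UNIV)
      show "closedin Met_TC.mtopology S \<and> Met_TC.mtopology interior_of S = {}"
        if "S \<in> range F" for S
        using that e by (auto simp: F_def)
    qed simp
    then have "interior (\<Union> (range F)) = {}" by simp
    moreover have "x \<in> \<Union> (range F)" for x
    proof -
      obtain n :: nat where "p x \<le> real n" using real_arch_simple by blast
      then have "x \<in> F n" unfolding F_def by (intro closure_subset[THEN subsetD]) simp
      then show ?thesis by blast
    qed
    then have "\<Union> (range F) = UNIV" by blast
    ultimately show False by simp
  qed
  then obtain N x0 r where r: "r > 0" "ball x0 r \<subseteq> F N"
    by (metis ex_in_conv mem_interior)
  have approx0: "\<exists>y. p y \<le> real N \<and> norm (z - y) < e" if "norm z < r" "e > 0" for z e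
  proof -
    have "x0 + z \<in> F N" "x0 - z \<in> F N"
      using r that by (auto simp: dist_norm subset_iff)
    then obtain u v where u: "p u \<le> N" "dist u (x0 + z) < e" and v: "p v \<le> N" "dist v (x0 - z) < e"
      using \<open>e > 0\<close> unfolding F_def closure_approachable by blast
    let ?y = "(1/2) *\<^sub>R (u + - v)"
    have "p ?y \<le> N"
      using padd[of u "- v"] pneg[of v] u v by (simp add: scale)
    moreover have "((x0 + z) - u) - ((x0 - z) - v) = (z + z) - (u + - v)"
      by simp
    then have "z - ?y = (1/2) *\<^sub>R (((x0 + z) - u) - ((x0 - z) - v))"
      by (simp only: scaleR_diff_right scaleR_half_double)
    then have "norm (z - ?y) \<le> (1/2) * (dist u (x0 + z) + dist v (x0 - z))"
      using norm_triangle_ineq4[of "(x0 + z) - u" "(x0 - z) - v"]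
      by (simp add: dist_norm norm_minus_commute)
    moreover have "(1/2) * (dist u (x0 + z) + dist v (x0 - z)) < e" using u v by simp
    ultimately have "norm (z - ?y) < e" by linarith
    with \<open>p ?y \<le> N\<close> have "p ?y \<le> N \<and> norm (z - ?y) < e" by (rule conjI)
    then show ?thesis by (rule exI[of _ ?y])
  qed
  \<comment> \<open>A vector \<open>z\<close> is scaled to norm \<open>r / 2\<close> and approximated there up to \<open>r / 4\<close>.\<close>
  define C where "C = 2 * real N / r"
  have C: "C \<ge> 0" using r by (simp add: C_def)
  have "\<exists>y. p y \<le> C * norm z \<and> norm (z - y) \<le> norm z / 2" for z
  proof (cases "z = 0")
    case False
    define c where "c = r / (2 * norm z)"
    have c: "c > 0" using False r by (simp add: c_def)
    have "norm (c *\<^sub>R z) < r" using r False c by (simp add: c_def)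
    from approx0[OF this, of "r/4"] obtain y where y: "p y \<le> N" "norm (c *\<^sub>R z - y) < r / 4"
      using r by auto
    have "p ((1/c) *\<^sub>R y) \<le> C * norm z"
      using y(1) c r False by (simp add: scale c_def C_def field_simps)
    have "c * norm (z - (1/c) *\<^sub>R y) = norm (c *\<^sub>R (z - (1/c) *\<^sub>R y))"
      using c by simp
    then have "c * norm (z - (1/c) *\<^sub>R y) < r / 4"
      using y(2) c by (simp add: scaleR_diff_right)
    moreover have "c * (norm z / 2) = r / 4" using False by (simp add: c_def)
    ultimately have "c * norm (z - (1/c) *\<^sub>R y) < c * (norm z / 2)" by simp
    then have "norm (z - (1/c) *\<^sub>R y) \<le> norm z / 2"
      using c by simp
    with \<open>p ((1/c) *\<^sub>R y) \<le> C * norm z\<close>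
    have "p ((1/c) *\<^sub>R y) \<le> C * norm z \<and> norm (z - (1/c) *\<^sub>R y) \<le> norm z / 2"
      by (rule conjI)
    then show ?thesis by (rule exI[of _ "(1/c) *\<^sub>R y"])
  qed (auto simp: p0 intro: exI[of _ 0])
  then obtain Y where Y: "\<And>z. p (Y z) \<le> C * norm z" "\<And>z. norm (z - Y z) \<le> norm z / 2"
    using choice[of "\<lambda>z y. p y \<le> C * norm z \<and> norm (z - y) \<le> norm z / 2"] by blast
  have "p x \<le> 2 * C * norm x" for x
  proof -
    \<comment> \<open>the remainder after \<open>n\<close> steps\<close>
    define R where "R n = ((\<lambda>z. z - Y z) ^^ n) x" for n
    have R0: "R 0 = x" and RS: "R (Suc n) = R n - Y (R n)" for n
      by (simp_all add: R_def)
    have Rn: "norm (R n) \<le> norm x * (1/2) ^ n" for n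
    proof (induction n)
      case (Suc n)
      then show ?case using Y(2)[of "R n"] by (simp add: RS)
    qed (simp add: R0)
    have "R \<longlonglongrightarrow> 0"
    proof (rule Lim_null_comparison)
      show "(\<lambda>n. norm x * (1/2) ^ n) \<longlonglongrightarrow> 0"
        by (intro tendsto_mult_right_zero LIMSEQ_power_zero) simp
    qed (simp add: Rn)
    then have s: "(\<lambda>n. Y (R n)) sums x"
      using telescope_sums'[of R 0] by (simp add: R0 RS)
    have le: "p (Y (R n)) \<le> C * norm x * (1/2) ^ n" for n
      using order_trans[OF Y(1) mult_left_mono[OF Rn C]] by (simp add: mult.assoc)
    have g: "(\<lambda>n. C * norm x * (1/2) ^ n) sums (C * norm x * 2)"
      using sums_mult[OF geometric_sums[of "1/2::real"], of "C * norm x"] by simp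
    have sp: "summable (\<lambda>n. p (Y (R n)))"
      by (rule summable_comparison_test'[OF sums_summable[OF g]]) (simp add: le p_nonneg)
    have "p x \<le> (\<Sum>n. p (Y (R n)))"
      using csub[OF sums_summable[OF s] sp] sums_unique[OF s] by simp
    also have "\<dots> \<le> C * norm x * 2"
      using suminf_le[OF le sp sums_summable[OF g]] sums_unique[OF g] by simp
    finally show ?thesis by simp
  qed
  with C that[of "2 * C"] show ?thesis by simp
qed

text \<open>
  The pointwise supremum of the norms of \<open>B n x\<close> is a countably subadditive seminorm in \<open>x\<close>.
\<close>

lemma uniform_boundedness:
  fixes B :: "nat \<Rightarrow> 'a::banach \<Rightarrow>\<^sub>L 'b::banach"
  assumes bdd: "\<And>x. bounded (range (\<lambda>n. B n x))"
  obtains C where "\<And>n. norm (B n) \<le> C"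
proof -
  define p where "p x = (SUP n. norm (B n x))" for x
  have bdd': "bdd_above (range (\<lambda>n. norm (B n x)))" for x
    using bdd[of x] by (auto simp: bounded_iff bdd_above_def)
  have le: "norm (B n x) \<le> p x" for n x
    unfolding p_def by (rule cSUP_upper[OF _ bdd']) simp
  have p_nonneg: "p x \<ge> 0" for x
    using le[of 0 x] norm_ge_zero order_trans by blast
  have scale': "p (c *\<^sub>R x) \<le> \<bar>c\<bar> * p x" for c x
    unfolding p_def[of "c *\<^sub>R x"]
    by (rule cSUP_least) (auto simp: blinfun.scaleR_right le mult_left_mono)
  have scale: "p (c *\<^sub>R x) = \<bar>c\<bar> * p x" for c x
  proof (cases "c = 0")
    case True
    then show ?thesis using scale'[of 0 x] p_nonneg[of 0] by simp
  next
    case False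
    have "p x \<le> \<bar>1/c\<bar> * p (c *\<^sub>R x)" using scale'[of "1/c" "c *\<^sub>R x"] False by simp
    then have "\<bar>c\<bar> * p x \<le> p (c *\<^sub>R x)" using False by (simp add: field_simps)
    then show ?thesis using scale'[of c x] by simp
  qed
  obtain C where C: "C \<ge> 0" "\<And>x. p x \<le> C * norm x"
  proof (rule bounded_of_countably_subadditive[of p])
    fix f assume f: "summable f" and pf: "summable (\<lambda>k. p (f k))"
    show "p (suminf f) \<le> (\<Sum>k. p (f k))"
      unfolding p_def[of "suminf f"]
    proof (rule cSUP_least)
      fix n
      have s: "summable (\<lambda>k. norm (B n (f k)))"
        by (rule summable_comparison_test'[OF pf]) (simp add: le)
      have "norm (B n (suminf f)) = norm (\<Sum>k. B n (f k))"
        using bounded_linear.suminf[OF blinfun.bounded_linear_right f, of "B n"] by simp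
      also have "\<dots> \<le> (\<Sum>k. norm (B n (f k)))" by (rule summable_norm[OF s])
      also have "\<dots> \<le> (\<Sum>k. p (f k))" by (intro suminf_le le s pf)
      finally show "norm (B n (suminf f)) \<le> (\<Sum>k. p (f k))" .
    qed simp
  qed (auto simp: scale)
  have "norm (B n) \<le> C" for n
    by (rule norm_blinfun_bound) (use C le order_trans in blast)+
  then show ?thesis by (rule that)
qed

section \<open>Norming functionals\<close>

definition sublinear :: "('a::real_vector \<Rightarrow> real) \<Rightarrow> bool" where
  "sublinear p \<longleftrightarrow> (\<forall>x y. p (x + y) \<le> p x + p y) \<and> (\<forall>c\<ge>0. \<forall>x. p (c *\<^sub>R x) = c * p x)"

lemma sublinear_ge:
  assumes "sublinear p" shows "- p (- x) \<le> p x"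
proof -
  have "p 0 = 0" using assms[unfolded sublinear_def, THEN conjunct2, rule_format, of 0 0] by simp
  moreover have "p (x + - x) \<le> p x + p (- x)" using assms unfolding sublinear_def by blast
  ultimately show ?thesis by simp
qed

text \<open>
  The tilted functional at \<open>y\<close> is the infimum over \<open>t \<ge> 0\<close> of \<open>p (y + t *\<^sub>R x) - t * p x\<close>. A minimal
  sublinear functional coincides with all its tilts, and this makes it odd.
\<close>

lemma sublinear_tilt:
  fixes p :: "'a::real_vector \<Rightarrow> real"
  assumes p: "sublinear p"
  shows "\<exists>q. sublinear q \<and> q \<le> p \<and> q (- x) \<le> - p x"
proof -
  have add: "p (u + v) \<le> p u + p v" and scale: "c \<ge> 0 \<Longrightarrow> p (c *\<^sub>R u) = c * p u" for u v c
    using p by (auto simp: sublinear_def)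
  define h where "h y t = p (y + t *\<^sub>R x) - t * p x" for y t
  define q where "q y = (INF t\<in>{0..}. h y t)" for y
  have low: "- p (- y) \<le> h y t" if "t \<ge> 0" for y t
    using add[of "y + t *\<^sub>R x" "- y"] scale[OF that, of x] by (simp add: h_def)
  have bdd: "bdd_below (h y ` {0..})" for y
    by (rule bdd_belowI[of _ "- p (- y)"]) (use low in auto)
  have qh: "q y \<le> h y t" if "t \<ge> 0" for y t
    unfolding q_def by (rule cINF_lower[OF bdd]) (use that in simp)
  have qadd: "q (u + v) \<le> q u + q v" for u v
  proof -
    have "q (u + v) - h v t \<le> h u s" if "s \<ge> 0" "t \<ge> 0" for s t
    proof -
      have "h (u + v) (s + t) \<le> h u s + h v t"
        using add[of "u + s *\<^sub>R x" "v + t *\<^sub>R x"] by (simp add: h_def algebra_simps)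
      then show ?thesis using qh[of "s + t" "u + v"] that by simp
    qed
    then have "q (u + v) - h v t \<le> q u" if "t \<ge> 0" for t
      unfolding q_def[of u] using that by (intro cINF_greatest) auto
    then have "q (u + v) - q u \<le> h v t" if "t \<ge> 0" for t
      using that by (simp add: algebra_simps)
    then have "q (u + v) - q u \<le> q v"
      unfolding q_def[of v] by (intro cINF_greatest) auto
    then show ?thesis by simp
  qed
  have q0: "q 0 = 0"
  proof -
    have "h 0 t = 0" if "t \<ge> 0" for t using scale[OF that] by (simp add: h_def)
    then have "q 0 = (INF t\<in>{0::real..}. 0::real)" unfolding q_def by (intro INF_cong) auto
    then show ?thesis by simp
  qed
  have qscale': "q (c *\<^sub>R y) \<le> c * q y" if "c > 0" for c y
  proof -
    have "q (c *\<^sub>R y) / c \<le> h y t" if "t \<ge> 0" for t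
    proof -
      have "h (c *\<^sub>R y) (c * t) = c * h y t"
        using scale[of c "y + t *\<^sub>R x"] \<open>c > 0\<close> by (simp add: h_def algebra_simps)
      then show ?thesis using qh[of "c * t" "c *\<^sub>R y"] that \<open>c > 0\<close> by (simp add: field_simps)
    qed
    then have "q (c *\<^sub>R y) / c \<le> q y" unfolding q_def[of y] by (intro cINF_greatest) auto
    then show ?thesis using that by (simp add: field_simps)
  qed
  have "q (c *\<^sub>R y) = c * q y" if "c \<ge> 0" for c y
  proof (cases "c = 0")
    case False
    then have c: "c > 0" using that by simp
    have "q ((1/c) *\<^sub>R (c *\<^sub>R y)) \<le> (1/c) * q (c *\<^sub>R y)" using c by (intro qscale') simp
    then have "c * q y \<le> q (c *\<^sub>R y)" using c by (simp add: field_simps)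
    then show ?thesis using qscale'[OF c, of y] by simp
  qed (simp add: q0)
  then have "sublinear q" using qadd by (simp add: sublinear_def)
  moreover have "q \<le> p" using qh[of 0] by (auto simp: le_fun_def h_def)
  moreover have "q (- x) \<le> - p x"
    using qh[of 1 "- x"] scale[of 0 0] by (simp add: h_def)
  ultimately show ?thesis by blast
qed

text \<open>
  In a chain a single member lies below any two given ones, so it serves for both summands in the
  proof of subadditivity.
\<close>

lemma sublinear_Inf_chain:
  fixes C :: "('a::real_vector \<Rightarrow> real) set"
  assumes sub: "\<And>p. p \<in> C \<Longrightarrow> sublinear p" and ne: "C \<noteq> {}"
    and chain: "\<And>p q. p \<in> C \<Longrightarrow> q \<in> C \<Longrightarrow> p \<le> q \<or> q \<le> p"
    and le: "\<And>p. p \<in> C \<Longrightarrow> p \<le> u"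
  shows "sublinear (\<lambda>x. INF p\<in>C. p x)" "\<And>p. p \<in> C \<Longrightarrow> (\<lambda>x. INF p\<in>C. p x) \<le> p"
proof -
  have add: "p (x + y) \<le> p x + p y" and scale: "c \<ge> 0 \<Longrightarrow> p (c *\<^sub>R x) = c * p x"
    if "p \<in> C" for p x y c
    using sub[OF that] by (auto simp: sublinear_def)
  have bdd: "bdd_below ((\<lambda>p. p x) ` C)" for x
    by (rule bdd_belowI[of _ "- u (- x)"])
       (use sublinear_ge[OF sub] le in \<open>force simp: le_fun_def intro: order_trans[rotated]\<close>)
  have low: "(INF p\<in>C. p x) \<le> p x" if "p \<in> C" for p x
    by (rule cINF_lower[OF bdd that])
  then show "\<And>p. p \<in> C \<Longrightarrow> (\<lambda>x. INF p\<in>C. p x) \<le> p" by (auto simp: le_fun_def)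
  have "(INF p\<in>C. p (x + y)) \<le> (INF p\<in>C. p x) + (INF p\<in>C. p y)" for x y
  proof -
    have "(INF p\<in>C. p (x + y)) - q y \<le> p x" if pq: "p \<in> C" "q \<in> C" for p q
    proof -
      obtain r where r: "r \<in> C" "r \<le> p" "r \<le> q" using chain[OF pq] pq by blast
      show ?thesis using low[OF r(1), of "x + y"] add[OF r(1), of x y] r(2,3)
        by (smt (verit) le_fun_def)
    qed
    then have "(INF p\<in>C. p (x + y)) - q y \<le> (INF p\<in>C. p x)" if "q \<in> C" for q
      using that by (intro cINF_greatest[OF ne]) auto
    then have "(INF p\<in>C. p (x + y)) - (INF p\<in>C. p x) \<le> q y" if "q \<in> C" for q
      using that by (simp add: algebra_simps)
    then have "(INF p\<in>C. p (x + y)) - (INF p\<in>C. p x) \<le> (INF p\<in>C. p y)"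
      by (intro cINF_greatest[OF ne]) auto
    then show ?thesis by simp
  qed
  moreover have "(INF p\<in>C. p (c *\<^sub>R x)) = c * (INF p\<in>C. p x)" if "c \<ge> 0" for c x
  proof (cases "c = 0")
    case True
    have "(INF p\<in>C. p 0) = (INF p\<in>C. 0::real)" using scale[of _ 0 0] by (intro INF_cong) auto
    then show ?thesis using True ne by simp
  next
    case False
    then have c: "c > 0" using that by simp
    show ?thesis
    proof (rule antisym)
      have "(INF p\<in>C. p (c *\<^sub>R x)) / c \<le> (INF p\<in>C. p x)"
        using low[of _ "c *\<^sub>R x"] scale c by (intro cINF_greatest[OF ne]) (auto simp: field_simps)
      then show "(INF p\<in>C. p (c *\<^sub>R x)) \<le> c * (INF p\<in>C. p x)" using c by (simp add: field_simps)
      show "c * (INF p\<in>C. p x) \<le> (INF p\<in>C. p (c *\<^sub>R x))"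
      proof (intro cINF_greatest[OF ne])
        fix p assume "p \<in> C"
        then show "c * (INF p\<in>C. p x) \<le> p (c *\<^sub>R x)"
          using low[of p x] scale[of p c x] c by (simp add: mult_left_mono)
      qed
    qed
  qed
  ultimately show "sublinear (\<lambda>x. INF p\<in>C. p x)" by (simp add: sublinear_def)
qed

text \<open>
  This is the Hahn-Banach theorem: Zorn's lemma gives a minimal sublinear functional below \<open>u\<close>,
  and a minimal one is odd by comparison with its tilts, hence linear.
\<close>

lemma linear_below_sublinear:
  fixes u :: "'a::real_vector \<Rightarrow> real"
  assumes u: "sublinear u"
  obtains f where "linear f" "f \<le> u"
proof -
  let ?A = "{p. sublinear p \<and> p \<le> u}" and ?P = "\<lambda>p q :: 'a \<Rightarrow> real. q \<le> p"
  have "\<exists>m\<in>?A. \<forall>q\<in>?A. q \<le> m \<longrightarrow> q = m"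
  proof (rule predicate_Zorn)
    show "partial_order_on ?A (relation_of ?P ?A)"
      by (rule partial_order_on_relation_ofI) auto
    fix C assume "C \<in> Chains (relation_of ?P ?A)"
    then have C: "\<And>p. p \<in> C \<Longrightarrow> sublinear p \<and> p \<le> u"
        "\<And>p q. p \<in> C \<Longrightarrow> q \<in> C \<Longrightarrow> p \<le> q \<or> q \<le> p"
      by (auto simp: Chains_def relation_of_def)
    show "\<exists>m\<in>?A. \<forall>p\<in>C. m \<le> p"
    proof (cases "C = {}")
      case True
      then show ?thesis using u by auto
    next
      case False
      let ?m = "\<lambda>x. INF p\<in>C. p x"
      have "sublinear ?m" and m: "\<And>p. p \<in> C \<Longrightarrow> ?m \<le> p"
        using sublinear_Inf_chain[of C u] C False by blast+
      moreover have "?m \<le> u" using m C False by (meson ex_in_conv order_trans)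
      ultimately show ?thesis by blast
    qed
  qed
  then obtain f where f: "sublinear f" "f \<le> u"
    and min: "\<And>q. sublinear q \<Longrightarrow> q \<le> f \<Longrightarrow> q = f"
    by (auto intro: order_trans)
  have neg: "f (- x) = - f x" for x
  proof -
    obtain q where "sublinear q" "q \<le> f" "q (- x) \<le> - f x"
      using sublinear_tilt[OF f(1)] by blast
    then have "f (- x) \<le> - f x" using min by blast
    then show ?thesis using sublinear_ge[OF f(1), of x] by simp
  qed
  have add: "f (x + y) \<le> f x + f y" and scale: "c \<ge> 0 \<Longrightarrow> f (c *\<^sub>R x) = c * f x" for x y c
    using f(1) by (auto simp: sublinear_def)
  have "linear f"
  proof (rule linearI)
    show "f (x + y) = f x + f y" for x y
      using add[of x y] add[of "- x" "- y"] neg[of "x + y"] neg[of x] neg[of y] by simp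
    show "f (c *\<^sub>R x) = c *\<^sub>R f x" for c x
      using scale[of c x] scale[of "- c" "- x"] neg[of x] by (cases "c \<ge> 0") auto
  qed
  then show ?thesis using f(2) by (rule that)
qed

text \<open>
  The norm tilted in the direction \<open>x\<close> is at most \<open>- norm x\<close> at \<open>- x\<close>, and a linear functional
  below it inherits this value.
\<close>

lemma norming_functional:
  fixes x :: "'a::real_normed_vector"
  obtains x' :: "'a \<Rightarrow>\<^sub>L real" where "norm x' \<le> 1" "blinfun_apply x' x = norm x"
proof -
  have "sublinear (norm :: 'a \<Rightarrow> real)"
    unfolding sublinear_def by (simp add: norm_triangle_ineq)
  then obtain q where q: "sublinear q" "q \<le> (norm :: 'a \<Rightarrow> real)" "q (- x) \<le> - norm x"
    using sublinear_tilt by blast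
  obtain f where f: "linear f" "f \<le> q"
    using linear_below_sublinear[OF q(1)] .
  have le: "f y \<le> norm y" for y
    using f(2) q(2) by (meson le_funE order_trans)
  have abs: "\<bar>f y\<bar> \<le> norm y" for y
    using le[of y] le[of "- y"] linear_neg[OF f(1), of y] by (simp add: abs_le_iff)
  have bl: "bounded_linear f"
    using f(1) abs by (auto simp: bounded_linear_def bounded_linear_axioms_def intro!: exI[of _ 1])
  have "norm (Blinfun f) \<le> 1"
    by (rule norm_blinfun_bound) (simp_all add: bounded_linear_Blinfun_apply bl abs)
  moreover have "f x = norm x"
    using le[of x] le_funD[OF f(2), of "- x"] q(3) linear_neg[OF f(1), of x] by simp
  ultimately show ?thesis
    using that[of "Blinfun f"] by (simp add: bounded_linear_Blinfun_apply bl)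
qed

section \<open>Semigroups, projectors and groups\<close>

text \<open>
  Otherwise there are times \<open>\<theta> n\<close> tending to 0 at which the norms are unbounded, although
  \<open>T (\<theta> n) x\<close> converges for every \<open>x\<close>. The semigroup law extends the bound to compact intervals.
\<close>

lemma C0_semigroup_locally_bounded:
  fixes T :: "real \<Rightarrow> 'a::banach \<Rightarrow>\<^sub>L 'a"
  assumes T: "C0_semigroup T"
  obtains M where "M \<ge> 1" "\<And>t. 0 \<le> t \<Longrightarrow> t \<le> r \<Longrightarrow> norm (T t) \<le> M"
proof -
  have T0: "T 0 = id_blinfun" and Tadd: "\<And>s t. 0 \<le> s \<Longrightarrow> 0 \<le> t \<Longrightarrow> T (s + t) = T s o\<^sub>L T t"
    and Tcont: "\<And>x. ((\<lambda>t. T t x) \<longlongrightarrow> x) (at_right 0)"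
    using T by (auto simp: C0_semigroup_def)
  have "\<exists>n::nat. \<forall>t. 0 \<le> t \<and> t \<le> 1 / Suc n \<longrightarrow> norm (T t) \<le> n"
  proof (rule ccontr)
    assume "\<not> ?thesis"
    then have "\<forall>n. \<exists>t. 0 \<le> t \<and> t \<le> 1 / Suc n \<and> norm (T t) > real n"
      by (auto simp: not_le)
    then obtain \<theta> where \<theta>: "\<And>n. 0 \<le> \<theta> n" "\<And>n. \<theta> n \<le> 1 / Suc n" "\<And>n. norm (T (\<theta> n)) > real n"
      by metis
    have \<theta>0: "\<theta> \<longlonglongrightarrow> 0"
    proof (rule Lim_null_comparison)
      show "(\<lambda>n. 1 / real (Suc n)) \<longlonglongrightarrow> 0" by (rule LIMSEQ_Suc) (rule lim_1_over_n)
      show "\<forall>\<^sub>F n in sequentially. norm (\<theta> n) \<le> 1 / real (Suc n)"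
        using \<theta>(1,2) by (intro always_eventually allI) simp
    qed
    have "bounded (range (\<lambda>n. T (\<theta> n) x))" for x
    proof (rule convergent_imp_bounded)
      have "continuous (at 0 within {0..}) (\<lambda>t. T t x)"
        using Tcont[of x] T0 by (simp add: continuous_within at_within_Ici_at_right)
      then show "(\<lambda>n. T (\<theta> n) x) \<longlonglongrightarrow> T 0 x"
        using \<theta>0 \<theta>(1) by (auto simp: continuous_within_sequentially o_def)
    qed
    from uniform_boundedness[OF this] obtain C where "\<And>n. norm (T (\<theta> n)) \<le> C" by blast
    moreover obtain n :: nat where "C \<le> n" using real_arch_simple by blast
    ultimately show False using \<theta>(3)[of n] by (meson not_le order_trans)
  qed
  then obtain N :: nat where N: "\<And>t. 0 \<le> t \<Longrightarrow> t \<le> 1 / Suc N \<Longrightarrow> norm (T t) \<le> N"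
    by blast
  define \<delta> where "\<delta> = 1 / real (Suc N)"
  have \<delta>: "\<delta> > 0" by (simp add: \<delta>_def)
  have iter: "norm (T t) \<le> (real N + 1) ^ Suc k" if "0 \<le> t" "t \<le> \<delta> * Suc k" for t k
    using that
  proof (induction k arbitrary: t)
    case 0
    then show ?case using N[of t] by (simp add: \<delta>_def)
  next
    case (Suc k)
    show ?case
    proof (cases "t \<le> \<delta>")
      case True
      have "norm (T t) \<le> real N + 1" using N[of t] Suc.prems True by (simp add: \<delta>_def)
      also have "\<dots> \<le> (real N + 1) ^ Suc (Suc k)" by (rule self_le_power) auto
      finally show ?thesis .
    next
      case False
      have "T t = T \<delta> o\<^sub>L T (t - \<delta>)" using Tadd[of \<delta> "t - \<delta>"] False \<delta> by simp
      have "norm (T \<delta>) \<le> real N + 1" using N[of \<delta>] \<delta> by (simp add: \<delta>_def)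
      moreover have "norm (T (t - \<delta>)) \<le> (real N + 1) ^ Suc k"
        using Suc False by (intro Suc.IH) (auto simp: algebra_simps)
      ultimately have "norm (T \<delta>) * norm (T (t - \<delta>)) \<le> (real N + 1) * (real N + 1) ^ Suc k"
        by (intro mult_mono) auto
      then show ?thesis
        using norm_blinfun_compose[of "T \<delta>" "T (t - \<delta>)"] \<open>T t = _\<close> by simp
    qed
  qed
  obtain k :: nat where "r / \<delta> \<le> k" using real_arch_simple by blast
  then have k: "r \<le> \<delta> * Suc k" using \<delta> by (simp add: field_simps)
  show ?thesis
  proof (rule that)
    show "(1::real) \<le> (real N + 1) ^ Suc k" by (rule one_le_power) simp
    show "norm (T t) \<le> (real N + 1) ^ Suc k" if "0 \<le> t" "t \<le> r" for t
      using iter[of t k] that k by simp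
  qed
qed

text \<open>
  Strong continuity is required on the set \<open>E\<close> only. This covers both a semigroup on the whole space
  and its adjoint, which is strongly continuous on the sun dual.
\<close>

locale linear_semigroup =
  fixes S :: "real \<Rightarrow> 'v \<Rightarrow> 'v::real_normed_vector" and E :: "'v set"
  assumes linear_S: "0 \<le> t \<Longrightarrow> linear (S t)"
    and S_zero: "S 0 x = x"
    and S_add: "0 \<le> s \<Longrightarrow> 0 \<le> t \<Longrightarrow> S (s + t) x = S s (S t x)"
    and S_bounded: "\<exists>M\<ge>1. \<forall>t\<in>{0..r}. \<forall>x. norm (S t x) \<le> M * norm x"
    and S_tendsto: "x \<in> E \<Longrightarrow> ((\<lambda>h. S h x) \<longlongrightarrow> x) (at_right 0)"
begin

lemma continuous_orbit:
  assumes x: "x \<in> E"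
  shows "continuous_on {0..} (\<lambda>t. S t x)"
  unfolding continuous_on_iff
proof safe
  fix t e :: real assume t: "0 \<le> t" and e: "0 < e"
  obtain M where M: "M \<ge> 1" "\<And>s x. 0 \<le> s \<Longrightarrow> s \<le> t + 1 \<Longrightarrow> norm (S s x) \<le> M * norm x"
    using S_bounded[of "t + 1"] by auto
  obtain d where d: "d > 0" "\<And>h. 0 < h \<Longrightarrow> h < d \<Longrightarrow> norm (S h x - x) < e / M"
    using tendstoD[OF S_tendsto[OF x], of "e / M"] e M(1)
    by (auto simp: eventually_at_right_field dist_norm)
  show "\<exists>d>0. \<forall>s\<in>{0..}. dist s t < d \<longrightarrow> dist (S s x) (S t x) < e"
  proof (intro exI conjI ballI impI)
    show "min d 1 > 0" using d by simp
    fix s assume s: "s \<in> {0..}" "dist s t < min d 1"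
    define m h where "m = min s t" and "h = \<bar>s - t\<bar>"
    have m: "0 \<le> m" "m \<le> t + 1" using s t by (auto simp: m_def)
    have "S (m + h) x - S m x = S m (S h x - x)"
      using S_add[of m h x] linear_diff[OF linear_S, of m "S h x" x] m by (simp add: h_def)
    moreover have "norm (S s x - S t x) = norm (S (m + h) x - S m x)"
      by (cases "s \<le> t") (auto simp: m_def h_def norm_minus_commute)
    ultimately have "norm (S s x - S t x) \<le> M * norm (S h x - x)"
      using M(2)[OF m, of "S h x - x"] by simp
    also have "\<dots> < e"
    proof (cases "h = 0")
      case True
      then show ?thesis using e by (simp add: S_zero)
    next
      case False
      then show ?thesis using d(2)[of h] s M(1) by (simp add: h_def dist_norm field_simps)
    qed
    finally show "dist (S s x) (S t x) < e" by (simp add: dist_norm)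
  qed
qed

text \<open>
  The generator supplies the right difference quotient at 0. For two times with minimum \<open>m\<close> and
  distance \<open>h\<close>, the difference of the orbit is \<open>S m\<close> applied to the difference between the times
  0 and \<open>h\<close>, so the left derivative is covered too.
\<close>

lemma orbit_has_vector_derivative:
  assumes xy: "(x, y) \<in> generator E S" and t: "0 \<le> t"
  shows "((\<lambda>t. S t x) has_vector_derivative S t y) (at t within {0..})"
  unfolding has_vector_derivative_def has_derivative_within_alt
proof (intro conjI allI impI)
  show "bounded_linear (\<lambda>h. h *\<^sub>R S t y)" by (rule bounded_linear_scaleR_left)
  fix e :: real assume e: "e > 0"
  have y: "y \<in> E" and lim: "((\<lambda>h. (S h x - x) /\<^sub>R h) \<longlongrightarrow> y) (at_right 0)"
    using xy by (auto simp: generator_def)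
  obtain M where M: "M \<ge> 1" "\<And>s x. 0 \<le> s \<Longrightarrow> s \<le> t + 1 \<Longrightarrow> norm (S s x) \<le> M * norm x"
    using S_bounded[of "t + 1"] by auto
  obtain d1 where d1: "d1 > 0" "\<And>h. 0 < h \<Longrightarrow> h < d1 \<Longrightarrow> norm ((S h x - x) /\<^sub>R h - y) < e / (2 * M)"
    using tendstoD[OF lim, of "e / (2 * M)"] e M(1)
    by (auto simp: eventually_at_right_field dist_norm)
  obtain d2 where d2: "d2 > 0" "\<And>s. 0 \<le> s \<Longrightarrow> \<bar>s - t\<bar> < d2 \<Longrightarrow> norm (S s y - S t y) < e / 2"
    using continuous_orbit[OF y, unfolded continuous_on_iff, rule_format, of t "e / 2"] t e
    by (auto simp: dist_norm)
  show "\<exists>d>0. \<forall>s\<in>{0..}. norm (s - t) < d \<longrightarrow>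
      norm (S s x - S t x - (s - t) *\<^sub>R S t y) \<le> e * norm (s - t)"
  proof (intro exI conjI ballI impI)
    show "min (min d1 d2) 1 > 0" using d1 d2 by simp
    fix s assume s: "s \<in> {0..}" "norm (s - t) < min (min d1 d2) 1"
    define m h where "m = min s t" and "h = \<bar>s - t\<bar>"
    have m: "0 \<le> m" "m \<le> t + 1" using s t by (auto simp: m_def)
    show "norm (S s x - S t x - (s - t) *\<^sub>R S t y) \<le> e * norm (s - t)"
    proof (cases "h = 0")
      case False
      then have h: "h > 0" by (simp add: h_def)
      define w where "w = (S h x - x) /\<^sub>R h - y"
      have "S h x - x - h *\<^sub>R y = h *\<^sub>R w" using h by (simp add: w_def scaleR_diff_right)
      then have hx: "S h x = x + h *\<^sub>R y + h *\<^sub>R w" by (simp add: algebra_simps)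
      have "S (m + h) x = S m x + h *\<^sub>R S m y + h *\<^sub>R S m w"
        using S_add[of m h x] linear_S[OF m(1)] h m
        by (simp add: hx linear_add linear_scale)
      then have eq: "S (m + h) x - S m x - h *\<^sub>R S t y = h *\<^sub>R (S m w + (S m y - S t y))"
        by (simp add: algebra_simps)
      have "norm (S m w) \<le> M * norm w" by (rule M(2)[OF m])
      also have "\<dots> \<le> e / 2"
        using d1(2)[of h] h s M(1) by (simp add: w_def h_def field_simps)
      finally have "norm (S m w) \<le> e / 2" .
      moreover have "norm (S m y - S t y) \<le> e / 2"
        using d2(2)[of m] s t m e by (cases "s \<le> t") (auto simp: m_def)
      ultimately have "norm (S (m + h) x - S m x - h *\<^sub>R S t y) \<le> h * e"
        unfolding eq using h norm_triangle_ineq[of "S m w" "S m y - S t y"] by simp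
      moreover have "norm (S s x - S t x - (s - t) *\<^sub>R S t y)
          = norm (S (m + h) x - S m x - h *\<^sub>R S t y)"
      proof (cases "s \<le> t")
        case True
        then have "S s x - S t x - (s - t) *\<^sub>R S t y
            = - (S (m + h) x - S m x - h *\<^sub>R S t y)"
          by (simp add: m_def h_def algebra_simps)
        then show ?thesis by (simp only: norm_minus_cancel)
      qed (simp add: m_def h_def)
      ultimately show ?thesis by (simp add: h_def mult.commute)
    qed (simp add: h_def)
  qed
qed

end

lemma continuous_on_strongly_continuous_apply:
  fixes B :: "real \<Rightarrow> 'a::real_normed_vector \<Rightarrow>\<^sub>L 'b::real_normed_vector"
  assumes sc: "\<And>x. continuous_on A (\<lambda>t. B t x)"
    and bdd: "\<And>r. \<exists>M. \<forall>t\<in>A. \<bar>t\<bar> \<le> r \<longrightarrow> norm (B t) \<le> M"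
    and g: "continuous_on I g" "g ` I \<subseteq> A" and y: "continuous_on I y"
  shows "continuous_on I (\<lambda>\<tau>. B (g \<tau>) (y \<tau>))"
  unfolding continuous_on_def
proof
  fix c assume c: "c \<in> I"
  obtain M where M: "\<And>t. t \<in> A \<Longrightarrow> \<bar>t\<bar> \<le> \<bar>g c\<bar> + 1 \<Longrightarrow> norm (B t) \<le> M"
    using bdd[of "\<bar>g c\<bar> + 1"] by auto
  have g_lim: "(g \<longlongrightarrow> g c) (at c within I)" and y_lim: "(y \<longlongrightarrow> y c) (at c within I)"
    using g y c by (auto simp: continuous_on_def)
  have "eventually (\<lambda>\<tau>. dist (g \<tau>) (g c) < 1 \<and> \<tau> \<in> I) (at c within I)"
    using tendstoD[OF g_lim, of 1] by (auto simp: eventually_at_filter)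
  then have "eventually (\<lambda>\<tau>. norm (B (g \<tau>) (y \<tau> - y c)) \<le> norm (y \<tau> - y c) * M) (at c within I)"
  proof eventually_elim
    case (elim \<tau>)
    then have "norm (B (g \<tau>)) \<le> M" using g(2) by (intro M) (auto simp: dist_real_def)
    then show ?case using norm_blinfun[of "B (g \<tau>)" "y \<tau> - y c"]
      by (smt (verit) mult.commute mult_right_mono norm_ge_zero)
  qed
  moreover have "((\<lambda>\<tau>. norm (y \<tau> - y c)) \<longlongrightarrow> 0) (at c within I)"
    using y_lim by (simp add: tendsto_norm_zero_iff LIM_zero_iff)
  ultimately have 1: "((\<lambda>\<tau>. B (g \<tau>) (y \<tau> - y c)) \<longlongrightarrow> 0) (at c within I)"
    using tendsto_0_le[of "\<lambda>\<tau>. norm (y \<tau> - y c)" "at c within I" "\<lambda>\<tau>. B (g \<tau>) (y \<tau> - y c)" M]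
    by simp
  have 2: "((\<lambda>\<tau>. B (g \<tau>) (y c)) \<longlongrightarrow> B (g c) (y c)) (at c within I)"
    using continuous_on_compose2[OF sc g] c by (auto simp: continuous_on_def)
  show "((\<lambda>\<tau>. B (g \<tau>) (y \<tau>)) \<longlongrightarrow> B (g c) (y c)) (at c within I)"
    using tendsto_add[OF 1 2] by (simp add: blinfun.diff_right)
qed

text \<open>
  The sum of the norms of the three components is a countably subadditive seminorm: if a series and the
  norms of its components are summable, the components sum up inside the closed summands, and
  uniqueness of the decomposition identifies the sums.
\<close>

lemma projectors_bounded:
  fixes U V W :: "'a::banach set"
  assumes sub: "subspace U" "subspace V" "subspace W"
    and cl: "closed U" "closed V" "closed W"
    and ex: "\<And>x. \<exists>!p. p \<in> U \<times> V \<times> W \<and> x = fst p + fst (snd p) + snd (snd p)"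
  obtains P Q R :: "'a \<Rightarrow>\<^sub>L 'a" where
    "projector U V W = P" "projector V U W = Q" "projector W U V = R"
    "\<And>x. P x \<in> U" "\<And>x. Q x \<in> V" "\<And>x. R x \<in> W" "\<And>x. x = P x + Q x + R x"
    "\<And>u v w x. u \<in> U \<Longrightarrow> v \<in> V \<Longrightarrow> w \<in> W \<Longrightarrow> x = u + v + w \<Longrightarrow> P x = u \<and> Q x = v \<and> R x = w"
proof -
  obtain d where d: "\<And>x. d x \<in> U \<times> V \<times> W \<and> x = fst (d x) + fst (snd (d x)) + snd (snd (d x))"
    using ex by metis
  define p q r where "p x = fst (d x)" and "q x = fst (snd (d x))" and "r x = snd (snd (d x))" for x
  have mem: "p x \<in> U" "q x \<in> V" "r x \<in> W" and dec: "x = p x + q x + r x" for x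
    using d[of x] by (auto simp: p_def q_def r_def)
  have uniq: "p x = u \<and> q x = v \<and> r x = w" if "u \<in> U" "v \<in> V" "w \<in> W" "x = u + v + w" for u v w x
  proof -
    have "(p x, q x, r x) = (u, v, w)"
    proof (rule ex1E[OF ex[of x]])
      fix z assume z: "\<forall>y. y \<in> U \<times> V \<times> W \<and> x = fst y + fst (snd y) + snd (snd y) \<longrightarrow> y = z"
      have "(p x, q x, r x) = z" "(u, v, w) = z"
        using z[rule_format, of "(p x, q x, r x)"] z[rule_format, of "(u, v, w)"]
          mem[of x] dec[of x] that by auto
      then show ?thesis by simp
    qed
    then show ?thesis by simp
  qed
  have add: "p (x + y) = p x + p y \<and> q (x + y) = q x + q y \<and> r (x + y) = r x + r y" for x y
  proof (intro uniq subspace_add sub mem)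
    have "x + y = (p x + q x + r x) + (p y + q y + r y)" using dec by simp
    then show "x + y = p x + p y + (q x + q y) + (r x + r y)" by (simp only: add_ac)
  qed
  have scale: "p (c *\<^sub>R x) = c *\<^sub>R p x \<and> q (c *\<^sub>R x) = c *\<^sub>R q x \<and> r (c *\<^sub>R x) = c *\<^sub>R r x" for c x
  proof (intro uniq subspace_scale sub mem)
    have "c *\<^sub>R x = c *\<^sub>R (p x + q x + r x)" using dec by simp
    then show "c *\<^sub>R x = c *\<^sub>R p x + c *\<^sub>R q x + c *\<^sub>R r x" by (simp only: scaleR_add_right)
  qed
  define n where "n x = norm (p x) + norm (q x) + norm (r x)" for x
  obtain C where C: "C \<ge> 0" "\<And>x. n x \<le> C * norm x"
  proof (rule bounded_of_countably_subadditive[of n])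
    show "n (c *\<^sub>R x) = \<bar>c\<bar> * n x" for c x
      by (simp add: n_def scale algebra_simps)
    fix f assume f: "summable f" and nf: "summable (\<lambda>k. n (f k))"
    have part: "summable (\<lambda>k. norm (g (f k)))" if "\<And>x. norm (g x) \<le> n x" for g :: "'a \<Rightarrow> 'a"
      by (rule summable_comparison_test'[OF nf]) (simp add: that)
    have s: "summable (\<lambda>k. norm (p (f k)))" "summable (\<lambda>k. norm (q (f k)))" "summable (\<lambda>k. norm (r (f k)))"
      by (auto intro!: part simp: n_def)
    note s' = s[THEN summable_norm_cancel]
    have inc: "suminf g \<in> Y" if "summable g" "\<And>k. g k \<in> Y" "subspace Y" "closed Y" for g :: "nat \<Rightarrow> 'a" and Y
    proof (rule closed_sequentially[OF that(4) _ summable_LIMSEQ[OF that(1)]])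
      show "sum g {..<k} \<in> Y" for k by (rule subspace_sum[OF that(3)]) (rule that(2))
    qed
    have "f = (\<lambda>k. p (f k) + q (f k) + r (f k))" by (rule ext) (rule dec)
    then have "suminf f = (\<Sum>k. p (f k) + q (f k) + r (f k))" by (rule arg_cong)
    also have "\<dots> = (\<Sum>k. p (f k)) + (\<Sum>k. q (f k)) + (\<Sum>k. r (f k))"
      using s' by (simp add: suminf_add summable_add)
    finally have "p (suminf f) = (\<Sum>k. p (f k)) \<and> q (suminf f) = (\<Sum>k. q (f k)) \<and> r (suminf f) = (\<Sum>k. r (f k))"
      by (intro uniq inc s' sub cl mem)
    then have "n (suminf f) \<le> (\<Sum>k. norm (p (f k))) + (\<Sum>k. norm (q (f k))) + (\<Sum>k. norm (r (f k)))"
      unfolding n_def using summable_norm[OF s(1)] summable_norm[OF s(2)] summable_norm[OF s(3)] by auto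
    also have "\<dots> = (\<Sum>k. n (f k))"
      using s by (simp add: n_def suminf_add summable_add)
    finally show "n (suminf f) \<le> (\<Sum>k. n (f k))" .
  qed (rule that)
  have bl': "bounded_linear g"
    if "\<And>x y. g (x + y) = g x + g y" "\<And>c x. g (c *\<^sub>R x) = c *\<^sub>R g x" "\<And>x. norm (g x) \<le> n x" for g :: "'a \<Rightarrow> 'a"
  proof (rule bounded_linear_intro[of _ C])
    show "norm (g x) \<le> norm x * C" for x
      using order_trans[OF that(3) C(2)] by (simp add: mult.commute)
  qed (rule that)+
  have bl: "bounded_linear p" "bounded_linear q" "bounded_linear r"
    by (auto intro!: bl' simp: add scale n_def)
  have proj: "projector Y Y' Y'' = g"
    if "\<And>x. g x \<in> Y" "\<And>x. \<exists>v\<in>Y'. \<exists>w\<in>Y''. x = g x + v + w"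
      "\<And>x u v w. u \<in> Y \<Longrightarrow> v \<in> Y' \<Longrightarrow> w \<in> Y'' \<Longrightarrow> x = u + v + w \<Longrightarrow> u = g x"
    for Y Y' Y'' :: "'a set" and g
    unfolding projector_def by (rule ext, rule the_equality) (use that in auto)
  show ?thesis
  proof (rule that[of "Blinfun p" "Blinfun q" "Blinfun r"])
    show "projector U V W = Blinfun p"
      unfolding bounded_linear_Blinfun_apply[OF bl(1)]
    proof (rule proj)
      show "\<exists>v\<in>V. \<exists>w\<in>W. x = p x + v + w" for x
        by (intro bexI[of _ "q x"] bexI[of _ "r x"] mem dec)
      show "u = p x" if "u \<in> U" "v \<in> V" "w \<in> W" "x = u + v + w" for x u v w
        using uniq[OF that] by simp
    qed (rule mem)
    show "projector V U W = Blinfun q"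
      unfolding bounded_linear_Blinfun_apply[OF bl(2)]
    proof (rule proj)
      have "x = q x + p x + r x" for x using dec[of x] by (simp only: add_ac)
      then show "\<exists>v\<in>U. \<exists>w\<in>W. x = q x + v + w" for x
        by (intro bexI[of _ "p x"] bexI[of _ "r x"] mem)
      show "v = q x" if "v \<in> V" "u \<in> U" "w \<in> W" "x = v + u + w" for x u v w
        using uniq[OF that(2,1,3), of x] that(4) by (simp add: add_ac)
    qed (rule mem)
    show "projector W U V = Blinfun r"
      unfolding bounded_linear_Blinfun_apply[OF bl(3)]
    proof (rule proj)
      have "x = r x + p x + q x" for x using dec[of x] by (simp only: add_ac)
      then show "\<exists>v\<in>U. \<exists>w\<in>V. x = r x + v + w" for x
        by (intro bexI[of _ "p x"] bexI[of _ "q x"] mem)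
      show "w = r x" if "w \<in> W" "u \<in> U" "v \<in> V" "x = w + u + v" for x u v w
        using uniq[OF that(2,3,1), of x] that(4) by (simp add: add_ac)
    qed (rule mem)
  next
    show "x = Blinfun p x + Blinfun q x + Blinfun r x" for x
      unfolding bounded_linear_Blinfun_apply[OF bl(1)] bounded_linear_Blinfun_apply[OF bl(2)]
        bounded_linear_Blinfun_apply[OF bl(3)] by (rule dec)
  qed (simp_all add: bounded_linear_Blinfun_apply bl mem uniq)
qed

text \<open>
  A group that extends T on \<open>E\<close> is \<open>group_ext\<close> there, because \<open>G t\<close> inverts \<open>T (- t)\<close>.
  Composition with \<open>P\<close> turns its members into bounded operators on the whole space. Local boundedness
  comes from that of T, as \<open>Q t\<close> is \<open>Q (- r)\<close> after \<open>T (t + r)\<close> and \<open>P\<close>.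
\<close>

lemma group_through_projector:
  fixes T :: "real \<Rightarrow> 'a::banach \<Rightarrow>\<^sub>L 'a" and P :: "'a \<Rightarrow>\<^sub>L 'a"
  assumes T: "C0_semigroup T" and G: "extends_to_C0_group (\<lambda>t. blinfun_apply (T t)) E"
    and PE: "\<And>x. P x \<in> E" and P_id: "\<And>x. x \<in> E \<Longrightarrow> P x = x"
  obtains Q :: "real \<Rightarrow> 'a \<Rightarrow>\<^sub>L 'a" where
    "\<And>t x. x \<in> E \<Longrightarrow> Q t x = group_ext (\<lambda>t. blinfun_apply (T t)) E t x"
    "\<And>t x. Q t x \<in> E" "\<And>s t x. Q (s + t) x = Q s (Q t x)" "Q 0 = P"
    "\<And>t x. 0 \<le> t \<Longrightarrow> Q t x = T t (P x)"
    "\<And>x. continuous_on UNIV (\<lambda>t. Q t x)"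
    "\<And>r. \<exists>M. \<forall>t. \<bar>t\<bar> \<le> r \<longrightarrow> norm (Q t) \<le> M"
proof -
  obtain G where G: "C0_group_on E G" and GT: "\<And>t x. 0 \<le> t \<Longrightarrow> x \<in> E \<Longrightarrow> G t x = T t x"
    using G by (auto simp: extends_to_C0_group_def)
  have GE: "x \<in> E \<Longrightarrow> G t x \<in> E"
    and Gadd: "x \<in> E \<Longrightarrow> y \<in> E \<Longrightarrow> G t (x + y) = G t x + G t y"
    and Gscale: "x \<in> E \<Longrightarrow> G t (c *\<^sub>R x) = c *\<^sub>R G t x"
    and Gbdd: "\<exists>C. \<forall>x\<in>E. norm (G t x) \<le> C * norm x"
    and G0: "x \<in> E \<Longrightarrow> G 0 x = x"
    and Gst: "x \<in> E \<Longrightarrow> G (s + t) x = G s (G t x)"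
    and Gcont: "x \<in> E \<Longrightarrow> ((\<lambda>t. G t x) \<longlongrightarrow> x) (at 0)" for s t c x y
    using G by (auto simp: C0_group_on_def)
  have bl: "bounded_linear (\<lambda>x. G t (P x))" for t
  proof -
    obtain C where C: "\<And>x. x \<in> E \<Longrightarrow> norm (G t x) \<le> C * norm x" using Gbdd[of t] by blast
    have "norm (G t (P x)) \<le> norm x * (\<bar>C\<bar> * norm P)" for x
    proof -
      have "norm (G t (P x)) \<le> C * norm (P x)" by (rule C[OF PE])
      also have "\<dots> \<le> \<bar>C\<bar> * (norm P * norm x)"
        by (intro mult_mono norm_blinfun) auto
      finally show ?thesis by (simp add: algebra_simps)
    qed
    then show ?thesis
      by (intro bounded_linear_intro[of _ "\<bar>C\<bar> * norm P"])
         (auto simp: blinfun.add_right blinfun.scaleR_right Gadd Gscale PE)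
  qed
  define Q where "Q t = Blinfun (\<lambda>x. G t (P x))" for t
  have Q: "Q t x = G t (P x)" for t x
    by (simp add: Q_def bounded_linear_Blinfun_apply bl)
  have QE: "Q t x \<in> E" for t x by (simp add: Q GE PE)
  have Qst: "Q (s + t) x = Q s (Q t x)" for s t x
    by (simp add: Q Gst PE P_id GE)
  have QT: "Q t x = T t (P x)" if "0 \<le> t" for t x
    by (simp add: Q GT PE that)
  show ?thesis
  proof (rule that[of Q])
    show "Q t x = group_ext (\<lambda>t. blinfun_apply (T t)) E t x" if x: "x \<in> E" for t x
    proof (cases "0 \<le> t")
      case False
      have "the_inv_into E (T (- t)) x = G t x"
      proof (rule the_inv_into_f_eq)
        show "inj_on (T (- t)) E"
        proof (rule inj_onI)
          fix u v assume uv: "u \<in> E" "v \<in> E" "T (- t) u = T (- t) v"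
          then have "G t (G (- t) u) = G t (G (- t) v)" using False by (simp add: GT)
          then show "u = v" using uv Gst[of _ t "- t"] by (simp add: G0)
        qed
        show "T (- t) (G t x) = x"
          using Gst[OF x, of "- t" t] GT[of "- t" "G t x"] GE[OF x] G0[OF x] False by simp
      qed (rule GE[OF x])
      then show ?thesis using False x by (simp add: group_ext_def Q P_id)
    qed (simp add: group_ext_def QT P_id x)
    show "Q 0 = P" by (rule blinfun_eqI) (simp add: Q G0 PE)
    show "continuous_on UNIV (\<lambda>t. Q t x)" for x
    proof -
      have "((\<lambda>h. Q c (G h (P x))) \<longlongrightarrow> Q c (P x)) (at 0)" for c
        by (intro bounded_linear.tendsto[OF blinfun.bounded_linear_right] Gcont PE)
      then have "((\<lambda>h. Q (c + h) x) \<longlongrightarrow> Q c x) (at 0)" for c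
        unfolding Qst by (simp add: Q P_id PE GE)
      then show ?thesis
        by (simp add: continuous_on_eq_continuous_at isCont_def LIM_offset_zero_iff)
    qed
    show "\<exists>M. \<forall>t. \<bar>t\<bar> \<le> r \<longrightarrow> norm (Q t) \<le> M" for r
    proof -
      obtain M where M: "M \<ge> 1" "\<And>t. 0 \<le> t \<Longrightarrow> t \<le> r + r \<Longrightarrow> norm (T t) \<le> M"
        using C0_semigroup_locally_bounded[OF T, of "r + r"] by blast
      have "norm (Q t) \<le> norm (Q (- r)) * (M * norm P)" if t: "\<bar>t\<bar> \<le> r" for t
      proof -
        have "Q t = Q (- r) o\<^sub>L (T (t + r) o\<^sub>L P)"
        proof (rule blinfun_eqI)
          fix x
          show "Q t x = (Q (- r) o\<^sub>L (T (t + r) o\<^sub>L P)) x"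
            using Qst[of "- r" "t + r" x] QT[of "t + r" x] t by simp
        qed
        then have "norm (Q t) \<le> norm (Q (- r)) * (norm (T (t + r)) * norm P)"
          using norm_blinfun_compose[of "Q (- r)" "T (t + r) o\<^sub>L P"]
            norm_blinfun_compose[of "T (t + r)" P]
          by (metis (no_types, opaque_lifting) mult_left_mono norm_ge_zero order_trans)
        also have "\<dots> \<le> norm (Q (- r)) * (M * norm P)"
          using M(2)[of "t + r"] t by (intro mult_left_mono mult_right_mono) auto
        finally show ?thesis .
      qed
      then show ?thesis by blast
    qed
  qed (use QE Qst QT in auto)
qed

section \<open>Functionals on a subspace\<close>

lemma adj_apply [simp]: "adj B x' x = x' (B x)"
  by (simp add: adj_def)

lemma adj_compose: "adj (A o\<^sub>L B) x' = adj B (adj A x')"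
  by (rule blinfun_eqI) simp

lemma linear_adj: "linear (adj B)"
  by (rule linearI) (auto intro!: blinfun_eqI simp: blinfun.add_left blinfun.scaleR_left)

lemmas adj_linear_simps = linear_add[OF linear_adj] linear_diff[OF linear_adj] linear_scale[OF linear_adj]

lemma norm_adj_le: "norm (adj B x') \<le> norm B * norm x'"
  unfolding adj_def by (rule order_trans[OF norm_blinfun_compose]) (simp add: mult.commute)

lemma norm_blinfun_le: "norm B \<le> M \<Longrightarrow> norm (blinfun_apply B x) \<le> M * norm x"
  by (rule order_trans[OF norm_blinfun mult_right_mono[OF _ norm_ge_zero]])

lemma norm_adj_le': "norm B \<le> M \<Longrightarrow> norm (adj B x') \<le> M * norm x'"
  by (rule order_trans[OF norm_adj_le mult_right_mono[OF _ norm_ge_zero]])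

lemma dual_onD:
  assumes "\<phi> \<in> dual_on S"
  shows "x \<notin> S \<Longrightarrow> \<phi> x = 0" "x \<in> S \<Longrightarrow> y \<in> S \<Longrightarrow> \<phi> (x + y) = \<phi> x + \<phi> y"
    "x \<in> S \<Longrightarrow> \<phi> (c *\<^sub>R x) = c * \<phi> x" "\<exists>C. \<forall>x\<in>S. \<bar>\<phi> x\<bar> \<le> C * norm x"
  using assms by (auto simp: dual_on_def)

lemma dual_on_diff_apply:
  assumes "\<phi> \<in> dual_on S" "subspace S" "x \<in> S" "y \<in> S"
  shows "\<phi> (x - y) = \<phi> x - \<phi> y"
  using dual_onD(2)[OF assms(1,3) subspace_scale[OF assms(2,4), of "-1"]]
    dual_onD(3)[OF assms(1,4), of "-1"] by simp

lemma dual_on_bdd_above: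
  assumes "\<phi> \<in> dual_on S"
  shows "bdd_above ((\<lambda>x. \<bar>\<phi> x\<bar>) ` {x \<in> S. norm x \<le> 1})"
proof -
  obtain C where C: "\<And>x. x \<in> S \<Longrightarrow> \<bar>\<phi> x\<bar> \<le> C * norm x" using dual_onD(4)[OF assms] by blast
  show ?thesis
  proof (rule bdd_aboveI2)
    fix x assume "x \<in> {x \<in> S. norm x \<le> 1}"
    then show "\<bar>\<phi> x\<bar> \<le> \<bar>C\<bar>"
      using C[of x] mult_mono[of C "\<bar>C\<bar>" "norm x" 1] by fastforce
  qed
qed

lemma abs_le_dual_norm:
  assumes \<phi>: "\<phi> \<in> dual_on S" and S: "subspace S" and x: "x \<in> S"
  shows "\<bar>\<phi> x\<bar> \<le> dual_norm S \<phi> * norm x"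
proof -
  show ?thesis
  proof (cases "x = 0")
    case True
    then show ?thesis using dual_onD(3)[OF \<phi> x, of 0] by simp
  next
    case False
    have "\<bar>\<phi> (x /\<^sub>R norm x)\<bar> \<le> dual_norm S \<phi>"
      unfolding dual_norm_def using x S False by (intro cSUP_upper[OF _ dual_on_bdd_above[OF \<phi>]]) (auto simp: subspace_scale)
    then show ?thesis using False by (simp add: dual_onD(3)[OF \<phi> x] abs_mult field_simps)
  qed
qed

lemma dual_norm_le:
  assumes "subspace S" "\<And>x. x \<in> S \<Longrightarrow> \<bar>\<phi> x\<bar> \<le> C * norm x" "C \<ge> 0"
  shows "dual_norm S \<phi> \<le> C"
  unfolding dual_norm_def
proof (rule cSUP_least)
  show "{x \<in> S. norm x \<le> 1} \<noteq> {}" using subspace_0[OF assms(1)] by force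
  show "\<bar>\<phi> x\<bar> \<le> C" if "x \<in> {x \<in> S. norm x \<le> 1}" for x
    using that assms(2)[of x] assms(3) mult_left_le[of "norm x" C] by auto
qed

lemma dual_norm_nonneg:
  assumes "\<phi> \<in> dual_on S" "subspace S"
  shows "0 \<le> dual_norm S \<phi>"
  unfolding dual_norm_def
  by (rule cSUP_upper2[OF dual_on_bdd_above[OF assms(1)], of 0]) (use subspace_0[OF assms(2)] in auto)

lemma dual_on_closed:
  assumes S: "subspace S" and "\<phi> \<in> dual_on S" "\<psi> \<in> dual_on S"
  shows "(\<lambda>x. \<phi> x + \<psi> x) \<in> dual_on S" "(\<lambda>x. c * \<phi> x) \<in> dual_on S" "\<phi> - \<psi> \<in> dual_on S"
proof -
  obtain C D where C: "\<And>x. x \<in> S \<Longrightarrow> \<bar>\<phi> x\<bar> \<le> C * norm x" and D: "\<And>x. x \<in> S \<Longrightarrow> \<bar>\<psi> x\<bar> \<le> D * norm x"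
    using dual_onD(4)[OF assms(2)] dual_onD(4)[OF assms(3)] by blast
  note lin = dual_onD(1-3)[OF assms(2)] dual_onD(1-3)[OF assms(3)]
  have b: "\<forall>x\<in>S. \<bar>\<phi> x + \<psi> x\<bar> \<le> (C + D) * norm x" "\<forall>x\<in>S. \<bar>\<phi> x - \<psi> x\<bar> \<le> (C + D) * norm x"
    using C D by (fastforce simp: algebra_simps)+
  have b': "\<forall>x\<in>S. \<bar>c * \<phi> x\<bar> \<le> (\<bar>c\<bar> * C) * norm x"
    using C by (auto simp: abs_mult mult.assoc intro!: mult_left_mono)
  show "(\<lambda>x. \<phi> x + \<psi> x) \<in> dual_on S"
    unfolding dual_on_def using lin b(1) by (auto simp: algebra_simps intro: exI[of _ "C + D"])
  show "\<phi> - \<psi> \<in> dual_on S"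
    unfolding dual_on_def using lin b(2) by (auto simp: algebra_simps intro: exI[of _ "C + D"])
  show "(\<lambda>x. c * \<phi> x) \<in> dual_on S"
    unfolding dual_on_def using lin b' by (auto simp: algebra_simps intro: exI[of _ "\<bar>c\<bar> * C"])
qed

lemma dual_map_in_dual_on:
  assumes "\<phi> \<in> dual_on S" and B: "linear B" "\<And>x. x \<in> S \<Longrightarrow> B x \<in> S"
    and bdd: "\<And>x. norm (B x) \<le> C * norm x" and S: "subspace S"
  shows "dual_map S B \<phi> \<in> dual_on S"
proof -
  have "\<bar>\<phi> (B x)\<bar> \<le> (dual_norm S \<phi> * C) * norm x" if "x \<in> S" for x
  proof -
    have "\<bar>\<phi> (B x)\<bar> \<le> dual_norm S \<phi> * norm (B x)"
      by (rule abs_le_dual_norm[OF assms(1) S B(2)[OF that]])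
    also have "\<dots> \<le> dual_norm S \<phi> * (C * norm x)"
      by (intro mult_left_mono bdd dual_norm_nonneg[OF assms(1) S])
    finally show ?thesis by (simp add: mult.assoc)
  qed
  then show ?thesis
    unfolding dual_on_def dual_map_def
    using B S dual_onD(2,3)[OF assms(1)]
    by (auto simp: subspace_add subspace_scale linear_add linear_scale intro!: exI[of _ "dual_norm S \<phi> * C"])
qed

lemma continuous_on_dual_apply:
  fixes f :: "real \<Rightarrow> 'v::real_normed_vector \<Rightarrow> real"
  assumes S: "subspace S" and f: "\<And>t. f t \<in> dual_on S"
    and f_lim: "\<And>t. ((\<lambda>s. dual_norm S (f s - f t)) \<longlongrightarrow> 0) (at t)"
    and g: "continuous_on I g" "g ` I \<subseteq> S"
  shows "continuous_on I (\<lambda>\<tau>. f \<tau> (g \<tau>))"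
  unfolding continuous_on_def
proof
  fix c assume c: "c \<in> I"
  have g_lim: "(g \<longlongrightarrow> g c) (at c within I)" using g(1) c by (auto simp: continuous_on_def)
  have f_lim': "((\<lambda>s. dual_norm S (f s - f c)) \<longlongrightarrow> 0) (at c within I)"
    by (rule tendsto_within_subset[OF f_lim]) simp
  have "eventually (\<lambda>\<tau>. norm (f \<tau> (g \<tau>) - f c (g c))
      \<le> dual_norm S (f \<tau> - f c) * norm (g \<tau>) + dual_norm S (f c) * norm (g \<tau> - g c)) (at c within I)"
    unfolding eventually_at_filter
  proof (rule always_eventually, intro allI impI)
    fix \<tau> assume "\<tau> \<in> I"
    then have m: "g \<tau> \<in> S" "g c \<in> S" using g(2) c by auto
    then have m': "g \<tau> - g c \<in> S" by (intro subspace_diff[OF S])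
    have "f \<tau> (g \<tau>) - f c (g c) = (f \<tau> - f c) (g \<tau>) + f c (g \<tau> - g c)"
      using dual_on_diff_apply[OF f S m(1,2)] by simp
    then show "norm (f \<tau> (g \<tau>) - f c (g c))
      \<le> dual_norm S (f \<tau> - f c) * norm (g \<tau>) + dual_norm S (f c) * norm (g \<tau> - g c)"
      using abs_le_dual_norm[OF dual_on_closed(3)[OF S f[of \<tau>] f[of c]] S m(1)]
        abs_le_dual_norm[OF f[of c] S m'] by simp
  qed
  moreover have "((\<lambda>\<tau>. dual_norm S (f \<tau> - f c) * norm (g \<tau>) + dual_norm S (f c) * norm (g \<tau> - g c))
      \<longlongrightarrow> 0 * norm (g c) + dual_norm S (f c) * norm (g c - g c)) (at c within I)"
    by (intro tendsto_intros f_lim' g_lim)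
  ultimately have "((\<lambda>\<tau>. f \<tau> (g \<tau>) - f c (g c)) \<longlongrightarrow> 0) (at c within I)"
    by (intro Lim_null_comparison[of "\<lambda>\<tau>. f \<tau> (g \<tau>) - f c (g c)"]) simp_all
  then show "((\<lambda>\<tau>. f \<tau> (g \<tau>)) \<longlongrightarrow> f c (g c)) (at c within I)"
    by (simp add: LIM_zero_iff)
qed

text \<open>
  The functional is linear and bounded on \<open>S\<close> only and 0 elsewhere, so the chain rule for bounded
  linear maps does not apply to it.
\<close>

lemma dual_on_has_vector_derivative:
  assumes \<phi>: "\<phi> \<in> dual_on S" and S: "subspace S"
    and Z: "\<And>r. r \<in> I \<Longrightarrow> Z r \<in> S" "D \<in> S" "t \<in> I"
    and der: "(Z has_vector_derivative D) (at t within I)"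
  shows "((\<lambda>r. \<phi> (Z r)) has_vector_derivative \<phi> D) (at t within I)"
  unfolding has_vector_derivative_def has_derivative_within_alt
proof (intro conjI allI impI)
  show "bounded_linear (\<lambda>h. h *\<^sub>R \<phi> D)" by (rule bounded_linear_scaleR_left)
  fix e :: real assume e: "e > 0"
  define C where "C = dual_norm S \<phi> + 1"
  have C: "C > 0" using dual_norm_nonneg[OF \<phi> S] by (simp add: C_def)
  obtain d where d: "d > 0" "\<And>s. s \<in> I \<Longrightarrow> norm (s - t) < d \<Longrightarrow>
      norm (Z s - Z t - (s - t) *\<^sub>R D) \<le> e / C * norm (s - t)"
    using der[unfolded has_vector_derivative_def has_derivative_within_alt, THEN conjunct2,
        rule_format, of "e / C"] e C by auto
  show "\<exists>d>0. \<forall>s\<in>I. norm (s - t) < d \<longrightarrow>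
      norm (\<phi> (Z s) - \<phi> (Z t) - (s - t) *\<^sub>R \<phi> D) \<le> e * norm (s - t)"
  proof (intro exI conjI ballI impI)
    fix s assume s: "s \<in> I" "norm (s - t) < d"
    have m: "Z s \<in> S" "Z t \<in> S" "(s - t) *\<^sub>R D \<in> S" "Z s - Z t \<in> S"
      using Z s S by (auto simp: subspace_diff subspace_scale)
    have "\<phi> (Z s) - \<phi> (Z t) - (s - t) *\<^sub>R \<phi> D = \<phi> (Z s - Z t - (s - t) *\<^sub>R D)"
      using m dual_onD(3)[OF \<phi> Z(2)] by (simp add: dual_on_diff_apply[OF \<phi> S])
    also have "norm \<dots> \<le> dual_norm S \<phi> * norm (Z s - Z t - (s - t) *\<^sub>R D)"
      using abs_le_dual_norm[OF \<phi> S] m S by (simp add: subspace_diff)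
    also have "\<dots> \<le> C * (e / C * norm (s - t))"
      using d(2)[OF s] C by (intro mult_mono) (auto simp: C_def)
    finally show "norm (\<phi> (Z s) - \<phi> (Z t) - (s - t) *\<^sub>R \<phi> D) \<le> e * norm (s - t)"
      using C by simp
  qed (rule d(1))
qed

lemma integral_reflect_shift:
  fixes f :: "real \<Rightarrow> 'b::banach"
  shows "integral {c..d} (\<lambda>\<tau>. f (t - \<tau>)) = integral {t - d..t - c} f"
proof -
  have "integral {c..d} (\<lambda>\<tau>. f (t - \<tau>)) = integral {-d..-c} (\<lambda>\<sigma>. f (\<sigma> + t))"
    using Henstock_Kurzweil_Integration.integral_reflect_real[where f="\<lambda>\<tau>. f (t - \<tau>)" and a=c and b=d]
    by (simp add: add.commute)
  also have "\<dots> = integral {t - d..t - c} f"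
    using integral_shift_real_ivl[of "t - d" t "t - c" f] by simp
  finally show ?thesis .
qed

section \<open>The sun dual\<close>

locale sun_dual =
  fixes T :: "real \<Rightarrow> 'a::banach \<Rightarrow>\<^sub>L 'a"
  assumes T: "C0_semigroup T"
begin

lemma T_zero: "T 0 = id_blinfun" and T_add: "0 \<le> s \<Longrightarrow> 0 \<le> t \<Longrightarrow> T (s + t) = T s o\<^sub>L T t"
  and T_tendsto: "((\<lambda>t. T t x) \<longlongrightarrow> x) (at_right 0)"
  using T by (auto simp: C0_semigroup_def)

lemma T_add_apply: "0 \<le> s \<Longrightarrow> 0 \<le> t \<Longrightarrow> T (s + t) x = T s (T t x)"
  by (simp add: T_add)

lemma T_commute: "0 \<le> s \<Longrightarrow> 0 \<le> t \<Longrightarrow> T s o\<^sub>L T t = T t o\<^sub>L T s"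
  using T_add[of s t] T_add[of t s] by (simp add: add.commute)

sublocale flow: linear_semigroup "\<lambda>t. blinfun_apply (T t)" UNIV
proof (rule linear_semigroup.intro)
  show "linear (T t)" for t by (rule bounded_linear.linear[OF blinfun.bounded_linear_right])
  show "\<exists>M\<ge>1. \<forall>t\<in>{0..r}. \<forall>x. norm (T t x) \<le> M * norm x" for r
  proof -
    obtain M where M: "M \<ge> 1" "\<And>t. 0 \<le> t \<Longrightarrow> t \<le> r \<Longrightarrow> norm (T t) \<le> M"
      using C0_semigroup_locally_bounded[OF T, of r] by blast
    then show ?thesis
      by (intro exI[of _ M]) (auto intro: norm_blinfun_le)
  qed
qed (simp_all add: T_zero T_add T_tendsto)

lemma sun_subspace: "subspace (sun T)"
proof (rule subspaceI)
  show "0 \<in> sun T" by (simp add: sun_def linear_0[OF linear_adj])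
  fix x' y' :: "'a \<Rightarrow>\<^sub>L real" and c :: real
  assume x: "x' \<in> sun T"
  then have x_lim: "((\<lambda>t. norm (adj (T t) x' - x')) \<longlongrightarrow> 0) (at_right 0)" by (simp add: sun_def)
  have "norm (adj (T t) (c *\<^sub>R x') - c *\<^sub>R x') = \<bar>c\<bar> * norm (adj (T t) x' - x')" for t
    by (simp add: adj_linear_simps flip: scaleR_diff_right)
  then show "c *\<^sub>R x' \<in> sun T"
    using tendsto_mult_left[OF x_lim, of "\<bar>c\<bar>"] by (simp add: sun_def)
  assume y: "y' \<in> sun T"
  then have y_lim: "((\<lambda>t. norm (adj (T t) y' - y')) \<longlongrightarrow> 0) (at_right 0)" by (simp add: sun_def)
  have le: "norm (adj (T t) (x' + y') - (x' + y')) \<le> norm (adj (T t) x' - x') + norm (adj (T t) y' - y')" for t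
    using norm_triangle_ineq[of "adj (T t) x' - x'" "adj (T t) y' - y'"]
    by (simp add: adj_linear_simps algebra_simps)
  have "((\<lambda>t. adj (T t) (x' + y') - (x' + y')) \<longlongrightarrow> 0) (at_right 0)"
    by (rule Lim_null_comparison[OF always_eventually[OF allI[OF le]]])
       (use tendsto_add[OF x_lim y_lim] in simp)
  then show "x' + y' \<in> sun T" by (simp add: sun_def tendsto_norm_zero_iff)
qed

lemma adj_in_sun:
  assumes comm: "\<And>t. 0 \<le> t \<Longrightarrow> B o\<^sub>L T t = T t o\<^sub>L B" and x': "x' \<in> sun T"
  shows "adj B x' \<in> sun T"
proof -
  have lim: "((\<lambda>t. norm (adj (T t) x' - x') * norm B) \<longlongrightarrow> 0) (at_right 0)"
    using x' by (auto simp: sun_def intro: tendsto_mult_left_zero)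
  have "norm (adj (T t) (adj B x') - adj B x') \<le> norm (adj (T t) x' - x') * norm B" if "t > 0" for t
  proof -
    have "adj (T t) (adj B x') - adj B x' = adj B (adj (T t) x' - x')"
      using comm[of t] that by (simp add: adj_linear_simps flip: adj_compose)
    then show ?thesis using norm_adj_le[of B "adj (T t) x' - x'"] by (simp add: mult.commute)
  qed
  then have "((\<lambda>t. adj (T t) (adj B x') - adj B x') \<longlongrightarrow> 0) (at_right 0)"
    by (intro Lim_null_comparison[OF _ lim]) (auto simp: eventually_at_filter)
  then show ?thesis by (simp add: sun_def tendsto_norm_zero_iff)
qed

lemma adj_T_in_sun: "0 \<le> t \<Longrightarrow> x' \<in> sun T \<Longrightarrow> adj (T t) x' \<in> sun T"
  by (rule adj_in_sun) (simp_all add: T_commute)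

sublocale sun: linear_semigroup "\<lambda>t. adj (T t)" "sun T"
proof (rule linear_semigroup.intro)
  show "\<exists>M\<ge>1. \<forall>t\<in>{0..r}. \<forall>x'. norm (adj (T t) x') \<le> M * norm x'" for r
  proof -
    obtain M where M: "M \<ge> 1" "\<And>t. 0 \<le> t \<Longrightarrow> t \<le> r \<Longrightarrow> norm (T t) \<le> M"
      using C0_semigroup_locally_bounded[OF T, of r] by blast
    then show ?thesis
      by (intro exI[of _ M]) (auto intro: norm_adj_le')
  qed
  show "((\<lambda>h. adj (T h) x') \<longlongrightarrow> x') (at_right 0)" if "x' \<in> sun T" for x'
    using that by (simp add: sun_def tendsto_norm_zero_iff LIM_zero_iff)
  show "adj (T (s + t)) x' = adj (T s) (adj (T t) x')" if "0 \<le> s" "0 \<le> t" for s t x'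
    using that T_add[of t s] by (simp add: adj_compose add.commute)
  show "adj (T 0) x' = x'" for x' by (rule blinfun_eqI) (simp add: T_zero)
  show "linear (adj (T t))" for t by (rule linear_adj)
qed

lemma orbit_integrable:
  assumes "0 \<le> c"
  shows "(\<lambda>s. T s x) integrable_on {c..d}"
  by (intro integrable_continuous_interval continuous_on_subset[OF flow.continuous_orbit]) (use assms in auto)

text \<open>
  These means tend strongly to the identity as \<open>h\<close> tends to 0, and their adjoints carry the
  whole dual space into the sun dual.
\<close>

definition orbit_mean :: "real \<Rightarrow> 'a \<Rightarrow>\<^sub>L 'a" where
  "orbit_mean h = Blinfun (\<lambda>x. (1/h) *\<^sub>R integral {0..h} (\<lambda>s. T s x))"

lemma orbit_mean:
  assumes h: "0 < h" and M: "\<And>t. 0 \<le> t \<Longrightarrow> t \<le> h \<Longrightarrow> norm (T t) \<le> M"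
  shows "orbit_mean h x = (1/h) *\<^sub>R integral {0..h} (\<lambda>s. T s x)" "norm (orbit_mean h) \<le> M"
proof -
  have bound: "norm ((1/h) *\<^sub>R integral {0..h} (\<lambda>s. T s x)) \<le> norm x * M" for x
  proof -
    have "norm (integral {0..h} (\<lambda>s. T s x)) \<le> (M * norm x) * (h - 0)"
    proof (rule integral_bound)
      show "continuous_on {0..h} (\<lambda>s. T s x)"
        by (rule continuous_on_subset[OF flow.continuous_orbit]) auto
      show "norm (T s x) \<le> M * norm x" if "s \<in> {0..h}" for s
        using M[of s] that by (intro norm_blinfun_le) auto
    qed (use h in simp)
    then show ?thesis using h by (simp add: field_simps)
  qed
  have "bounded_linear (\<lambda>x. (1/h) *\<^sub>R integral {0..h} (\<lambda>s. T s x))"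
    by (rule bounded_linear_intro[OF _ _ bound])
       (simp_all add: blinfun.add_right blinfun.scaleR_right Henstock_Kurzweil_Integration.integral_add
          orbit_integrable scaleR_add_right)
  then show eq: "orbit_mean h x = (1/h) *\<^sub>R integral {0..h} (\<lambda>s. T s x)" for x
    by (simp add: orbit_mean_def bounded_linear_Blinfun_apply)
  have "M \<ge> 0" using order_trans[OF norm_ge_zero M[of 0]] h by simp
  then show "norm (orbit_mean h) \<le> M"
    by (rule norm_blinfun_bound) (use bound in \<open>simp add: eq mult.commute\<close>)
qed

text \<open>
  A shift of the orbit by \<open>t\<close> changes its integral over an interval only by two integrals
  over intervals of length \<open>t\<close>.
\<close>

lemma adj_orbit_mean_in_sun:
  assumes h: "0 < h"
  shows "adj (orbit_mean h) x' \<in> sun T"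
proof -
  let ?D = "\<lambda>t. adj (T t) (adj (orbit_mean h) x') - adj (orbit_mean h) x'"
  obtain M where M: "M \<ge> 1" "\<And>t. 0 \<le> t \<Longrightarrow> t \<le> h + 1 \<Longrightarrow> norm (T t) \<le> M"
    using C0_semigroup_locally_bounded[OF T, of "h + 1"] by blast
  have mean: "orbit_mean h x = (1/h) *\<^sub>R integral {0..h} (\<lambda>s. T s x)" for x
    using M(2) h by (intro orbit_mean(1)[of h M]) auto
  have est: "norm (?D t) \<le> t * (norm x' * (2 * M / h))"
    if t: "0 < t" "t \<le> 1" for t
  proof (rule norm_blinfun_bound)
    show "0 \<le> t * (norm x' * (2 * M / h))" using t h M by simp
    fix x
    let ?I = "\<lambda>c d. integral {c..d} (\<lambda>s. T s x)"
    have bound: "norm (?I c (c + t)) \<le> M * norm x * t" if c: "0 \<le> c" "c \<le> h" for c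
    proof -
      have "norm (?I c (c + t)) \<le> (M * norm x) * (c + t - c)"
      proof (rule integral_bound)
        show "continuous_on {c..c + t} (\<lambda>s. T s x)"
          by (rule continuous_on_subset[OF flow.continuous_orbit]) (use c in auto)
        show "norm (T s x) \<le> M * norm x" if "s \<in> {c..c + t}" for s
          using M(2)[of s] that c t by (intro norm_blinfun_le) auto
      qed (use t in simp)
      then show ?thesis by simp
    qed
    have "integral {0..h} (\<lambda>s. T s (T t x)) = integral {0..h} (\<lambda>s. T (s + t) x)"
      using t by (intro integral_cong) (simp add: T_add_apply)
    also have "\<dots> = ?I t (h + t)"
      using integral_shift_real_ivl[of t t "h + t" "\<lambda>s. T s x"] by simp
    finally have shift: "integral {0..h} (\<lambda>s. T s (T t x)) = ?I t (h + t)" .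
    have "?I 0 t + ?I t (h + t) = ?I 0 (h + t)"
      by (rule Henstock_Kurzweil_Integration.integral_combine) (use h t orbit_integrable[of 0] in simp_all)
    moreover have "?I 0 h + ?I h (h + t) = ?I 0 (h + t)"
      by (rule Henstock_Kurzweil_Integration.integral_combine) (use h t orbit_integrable[of 0] in simp_all)
    ultimately have "?I t (h + t) - ?I 0 h = ?I h (h + t) - ?I 0 t" by (simp add: algebra_simps)
    moreover have "norm (?I h (h + t) - ?I 0 t) \<le> M * norm x * t + M * norm x * t"
      using bound[of h] bound[of 0] h by (intro order_trans[OF norm_triangle_ineq4] add_mono) auto
    ultimately have *: "norm (?I t (h + t) - ?I 0 h) \<le> M * norm x * t + M * norm x * t" by simp
    have "?D t x
        = x' ((1/h) *\<^sub>R (?I t (h + t) - ?I 0 h))"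
      by (simp add: blinfun.diff_left mean shift blinfun.diff_right blinfun.scaleR_right right_diff_distrib)
    also have "norm \<dots> \<le> norm x' * norm ((1/h) *\<^sub>R (?I t (h + t) - ?I 0 h))"
      by (rule norm_blinfun)
    also have "\<dots> \<le> norm x' * ((1/h) * (M * norm x * t + M * norm x * t))"
      using h * by (auto intro!: mult_left_mono divide_right_mono)
    finally have "norm (?D t x)
        \<le> norm x' * ((1/h) * (M * norm x * t + M * norm x * t))" .
    then show "norm (?D t x)
        \<le> t * (norm x' * (2 * M / h)) * norm x"
      by (simp add: algebra_simps)
  qed
  have "((\<lambda>t. t * (norm x' * (2 * M / h))) \<longlongrightarrow> 0 * (norm x' * (2 * M / h))) (at_right 0)"
    by (intro tendsto_intros)
  then have lim: "((\<lambda>t. t * (norm x' * (2 * M / h))) \<longlongrightarrow> 0) (at_right 0)" by simp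
  have "((\<lambda>t. ?D t) \<longlongrightarrow> 0) (at_right 0)"
  proof (rule Lim_null_comparison[OF _ lim])
    show "\<forall>\<^sub>F t in at_right 0. norm (?D t)
        \<le> t * (norm x' * (2 * M / h))"
      unfolding eventually_at_right_field by (intro exI[of _ 1] conjI allI impI est) simp_all
  qed
  then show ?thesis by (simp add: sun_def tendsto_norm_zero_iff)
qed

text \<open>
  A functional that norms \<open>x\<close> is replaced by its image under the adjoint of a mean, which belongs
  to the sun dual. The norm grows at most by the local bound of the semigroup, and the value at
  \<open>x\<close> changes by as little as desired.
\<close>

lemma sun_norming:
  "\<exists>M\<ge>1. \<forall>x. \<forall>C\<ge>0. (\<forall>x'\<in>sun T. \<bar>blinfun_apply x' x\<bar> \<le> C * norm x') \<longrightarrow> norm x \<le> M * C"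
proof -
  obtain M where M: "M \<ge> 1" "\<And>t. 0 \<le> t \<Longrightarrow> t \<le> 1 \<Longrightarrow> norm (T t) \<le> M"
    using C0_semigroup_locally_bounded[OF T, of 1] by blast
  have "norm x \<le> M * C" if "0 \<le> C" and C: "\<And>x'. x' \<in> sun T \<Longrightarrow> \<bar>x' x\<bar> \<le> C * norm x'" for x C
  proof (rule field_le_epsilon)
    fix e :: real assume e: "e > 0"
    obtain x' :: "'a \<Rightarrow>\<^sub>L real" where x': "norm x' \<le> 1" "x' x = norm x"
      using norming_functional .
    obtain d where d: "d > 0" "\<And>s. 0 < s \<Longrightarrow> s < d \<Longrightarrow> norm (T s x - x) < e"
      using tendstoD[OF T_tendsto[of x] e] by (auto simp: eventually_at_right_field dist_norm)
    define h where "h = min (d / 2) 1"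
    have h: "0 < h" "h \<le> 1" "h < d" using d by (auto simp: h_def)
    have mean: "orbit_mean h x = (1/h) *\<^sub>R integral {0..h} (\<lambda>s. T s x)"
      and mean_le: "norm (orbit_mean h) \<le> M"
      using orbit_mean(1)[of h M x] orbit_mean(2)[of h M] M h by auto
    have "norm (integral {0..h} (\<lambda>s. T s x - x)) \<le> e * (h - 0)"
    proof (rule integral_bound)
      show "continuous_on {0..h} (\<lambda>s. T s x - x)"
        by (intro continuous_intros continuous_on_subset[OF flow.continuous_orbit]) auto
      show "norm (T s x - x) \<le> e" if "s \<in> {0..h}" for s
        using d(2)[of s] that h e by (cases "s = 0") (auto simp: T_zero less_imp_le)
    qed (use h in simp)
    moreover have "integral {0..h} (\<lambda>s. T s x - x) = h *\<^sub>R (orbit_mean h x - x)"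
      using h Henstock_Kurzweil_Integration.integral_diff[OF orbit_integrable[of 0 x h] integrable_const_ivl, of x]
      by (simp add: mean scaleR_diff_right)
    ultimately have close: "norm (orbit_mean h x - x) \<le> e" using h by simp
    have "norm x = x' (orbit_mean h x) - x' (orbit_mean h x - x)"
      by (simp add: blinfun.diff_right x')
    also have "\<dots> \<le> \<bar>adj (orbit_mean h) x' x\<bar> + \<bar>x' (orbit_mean h x - x)\<bar>" by simp
    also have "\<dots> \<le> C * norm (adj (orbit_mean h) x') + norm x' * norm (orbit_mean h x - x)"
      using C[OF adj_orbit_mean_in_sun[OF h(1), of x']] norm_blinfun[of x' "orbit_mean h x - x"] by simp
    also have "\<dots> \<le> C * (M * 1) + 1 * e"
    proof (intro add_mono mult_mono)
      show "norm (adj (orbit_mean h) x') \<le> M * 1"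
        using mean_le x'(1) M(1) by (intro order_trans[OF norm_adj_le] mult_mono) auto
    qed (use x' close \<open>C \<ge> 0\<close> in auto)
    finally show "norm x \<le> M * C + e" by (simp add: mult.commute)
  qed
  with M(1) show ?thesis by blast
qed

definition norming_const :: real where
  "norming_const = (SOME M. M \<ge> 1 \<and>
    (\<forall>x. \<forall>C\<ge>0. (\<forall>x'\<in>sun T. \<bar>blinfun_apply x' x\<bar> \<le> C * norm x') \<longrightarrow> norm x \<le> M * C))"

lemma norming_const_ge_1: "1 \<le> norming_const"
  and norm_le_of_sun:
    "0 \<le> C \<Longrightarrow> (\<And>x'. x' \<in> sun T \<Longrightarrow> \<bar>x' x\<bar> \<le> C * norm x') \<Longrightarrow> norm x \<le> norming_const * C"
  using someI_ex[OF sun_norming, folded norming_const_def] by auto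

end

section \<open>The canonical embedding into the sun star space\<close>

context sun_dual
begin

lemma sun_separates:
  assumes "\<And>x'. x' \<in> sun T \<Longrightarrow> x' x = x' y"
  shows "x = y"
proof -
  have "norm (x - y) \<le> norming_const * 0" by (rule norm_le_of_sun) (simp_all add: blinfun.diff_right assms)
  then show ?thesis by simp
qed

lemma inj_sun_j: "inj (sun_j T)"
proof (rule injI)
  fix x y assume "sun_j T x = sun_j T y"
  then have "x' x = x' y" if "x' \<in> sun T" for x' using fun_cong[of _ _ x'] that by (fastforce simp: sun_j_def)
  then show "x = y" by (rule sun_separates)
qed

lemma sun_j_eqI:
  assumes "\<And>x'. x' \<notin> sun T \<Longrightarrow> \<phi> x' = 0" "\<And>x'. x' \<in> sun T \<Longrightarrow> \<phi> x' = x' z"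
  shows "\<phi> = sun_j T z"
  using assms by (auto simp: sun_j_def)

text \<open>
  Approximations with error \<open>1 / Suc n\<close> form a Cauchy sequence in X because the sun dual is norming.
\<close>

lemma sun_j_range_closed:
  fixes \<phi> :: "('a \<Rightarrow>\<^sub>L real) \<Rightarrow> real"
  assumes approx: "\<And>e. 0 < e \<Longrightarrow> \<exists>z. \<forall>x'\<in>sun T. \<bar>\<phi> x' - x' z\<bar> \<le> e * norm x'"
  shows "\<exists>z. \<forall>x'\<in>sun T. \<phi> x' = x' z"
proof -
  note M1 = norming_const_ge_1
  have "\<exists>z. \<forall>x'\<in>sun T. \<bar>\<phi> x' - x' z\<bar> \<le> (1 / real (Suc n)) * norm x'" for n
    by (rule approx) simp
  then obtain z where z: "\<And>n x'. x' \<in> sun T \<Longrightarrow> \<bar>\<phi> x' - x' (z n)\<bar> \<le> (1 / real (Suc n)) * norm x'"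
    by metis
  have diff: "norm (z m - z n) \<le> norming_const * (1 / real (Suc m) + 1 / real (Suc n))" for m n
  proof (rule norm_le_of_sun)
    fix x' assume x': "x' \<in> sun T"
    show "\<bar>x' (z m - z n)\<bar> \<le> (1 / real (Suc m) + 1 / real (Suc n)) * norm x'"
      using z[OF x', of m] z[OF x', of n] by (simp add: blinfun.diff_right distrib_right)
  qed simp
  have "Cauchy z"
  proof (rule CauchyI')
    fix e :: real assume e: "e > 0"
    obtain N :: nat where N: "2 * norming_const / e < N" using reals_Archimedean2 by blast
    show "\<exists>N. \<forall>m\<ge>N. \<forall>n>m. dist (z m) (z n) < e"
    proof (intro exI allI impI)
      fix m n assume mn: "N \<le> m" "m < n"
      have "1 / real (Suc m) + 1 / real (Suc n) \<le> 1 / real (Suc N) + 1 / real (Suc N)"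
        using mn by (intro add_mono divide_left_mono) auto
      then have "norming_const * (1 / real (Suc m) + 1 / real (Suc n)) \<le> norming_const * (2 / real (Suc N))"
        using M1 by (intro mult_left_mono) auto
      also have "\<dots> < e"
      proof -
        have "2 * norming_const < e * N" using N e by (simp add: field_simps)
        then have "2 * norming_const < e * real (Suc N)" using e by (simp add: algebra_simps)
        then show ?thesis by (simp add: field_simps)
      qed
      finally show "dist (z m) (z n) < e" using diff[of m n] by (simp add: dist_norm)
    qed
  qed
  then obtain w where w: "z \<longlonglongrightarrow> w" by (auto simp: Cauchy_convergent_iff convergent_def)
  have "\<phi> x' = x' w" if x': "x' \<in> sun T" for x'
  proof -
    have "(\<lambda>n. 1 / real (Suc n) * norm x') \<longlonglongrightarrow> 0"
      by (intro tendsto_mult_left_zero LIMSEQ_Suc[OF lim_1_over_n])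
    then have "(\<lambda>n. \<phi> x' - x' (z n)) \<longlonglongrightarrow> 0"
      by (rule Lim_null_comparison[OF always_eventually[OF allI], rotated]) (use z[OF x'] in simp)
    moreover have "(\<lambda>n. \<phi> x' - x' (z n)) \<longlonglongrightarrow> \<phi> x' - x' w"
      by (intro tendsto_intros w)
    ultimately show ?thesis using LIMSEQ_unique by fastforce
  qed
  then show ?thesis by blast
qed

end

section \<open>The resolvent on the sun dual\<close>

locale sun_resolvent = sun_dual +
  fixes l :: real
  assumes l: "l \<in> resolvent_set (generator UNIV (\<lambda>t. blinfun_apply (T t)))"
begin

abbreviation gen :: "('a \<times> 'a) set" where
  "gen \<equiv> generator UNIV (\<lambda>t. blinfun_apply (T t))"

lemma gen_map:
  assumes "(x, z) \<in> gen" and comm: "\<And>t. 0 \<le> t \<Longrightarrow> B o\<^sub>L T t = T t o\<^sub>L B"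
  shows "(B x, B z) \<in> gen"
proof -
  have "((\<lambda>h. B ((T h x - x) /\<^sub>R h)) \<longlongrightarrow> B z) (at_right 0)"
    using assms(1) by (intro bounded_linear.tendsto[OF blinfun.bounded_linear_right]) (simp add: generator_def)
  moreover have "B ((T h x - x) /\<^sub>R h) = (T h (B x) - B x) /\<^sub>R h" if "h > 0" for h
  proof -
    have "B (T h x) = T h (B x)"
      using arg_cong[OF comm[of h], of "\<lambda>C. blinfun_apply C x"] that by simp
    then show ?thesis by (simp add: blinfun.scaleR_right blinfun.diff_right)
  qed
  ultimately have "((\<lambda>h. (T h (B x) - B x) /\<^sub>R h) \<longlongrightarrow> B z) (at_right 0)"
    by (subst (asm) tendsto_cong[of _ "\<lambda>h. (T h (B x) - B x) /\<^sub>R h"]) (auto simp: eventually_at_filter)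
  then show ?thesis by (simp add: generator_def)
qed

lemma gen_add:
  assumes "(x, z) \<in> gen" "(y, w) \<in> gen"
  shows "(x + y, z + w) \<in> gen"
proof -
  from assms have "((\<lambda>h. (T h x - x) /\<^sub>R h + (T h y - y) /\<^sub>R h) \<longlongrightarrow> z + w) (at_right 0)"
    by (intro tendsto_add) (simp_all add: generator_def)
  moreover have "(T h x - x) /\<^sub>R h + (T h y - y) /\<^sub>R h = (T h (x + y) - (x + y)) /\<^sub>R h" for h
    by (simp add: blinfun.add_right add_diff_add flip: scaleR_add_right)
  ultimately show ?thesis by (simp add: generator_def)
qed

lemma gen_scale:
  assumes "(x, z) \<in> gen" shows "(c *\<^sub>R x, c *\<^sub>R z) \<in> gen"
proof -
  have "(c *\<^sub>R id_blinfun) o\<^sub>L T t = T t o\<^sub>L (c *\<^sub>R id_blinfun)" for t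
    by (rule blinfun_eqI) (simp add: blinfun.scaleR_left blinfun.scaleR_right)
  from gen_map[OF assms this] show ?thesis by (simp add: blinfun.scaleR_left)
qed

lemma resolvent_exists:
  "\<exists>R :: 'a \<Rightarrow>\<^sub>L 'a. (\<forall>y. (R y, l *\<^sub>R R y - y) \<in> gen) \<and> (\<forall>x z. (x, z) \<in> gen \<longrightarrow> R (l *\<^sub>R x - z) = x)"
proof -
  have ex1: "\<exists>!x. \<exists>z. (x, z) \<in> gen \<and> l *\<^sub>R x - z = y" for y
    using l by (simp add: resolvent_set_def)
  obtain M where M: "\<And>x z. (x, z) \<in> gen \<Longrightarrow> norm x \<le> M * norm (l *\<^sub>R x - z)"
    using l unfolding resolvent_set_def by blast
  have "\<forall>y. \<exists>x. \<exists>z. (x, z) \<in> gen \<and> l *\<^sub>R x - z = y" using ex1 by blast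
  then obtain r where r: "\<And>y. \<exists>z. (r y, z) \<in> gen \<and> l *\<^sub>R r y - z = y" by metis
  have r_gen: "(r y, l *\<^sub>R r y - y) \<in> gen" for y
  proof -
    obtain z where z: "(r y, z) \<in> gen" "l *\<^sub>R r y - z = y" using r by blast
    then have "z = l *\<^sub>R r y - y" by (simp add: algebra_simps)
    with z show ?thesis by simp
  qed
  have r_eq: "r (l *\<^sub>R x - z) = x" if "(x, z) \<in> gen" for x z
    by (rule ex1E[OF ex1[of "l *\<^sub>R x - z"]]) (use r[of "l *\<^sub>R x - z"] that in blast)
  have add: "r (x + y) = r x + r y" for x y
    using r_eq[OF gen_add[OF r_gen[of x] r_gen[of y]]] by (simp add: algebra_simps)
  have scale: "r (c *\<^sub>R x) = c *\<^sub>R r x" for c x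
    using r_eq[OF gen_scale[OF r_gen[of x], of c]] by (simp add: algebra_simps)
  have bl: "bounded_linear r"
    by (rule bounded_linear_intro[of _ M]) (use add scale M[OF r_gen] in \<open>simp_all add: mult.commute\<close>)
  show ?thesis
    by (rule exI[of _ "Blinfun r"]) (simp add: bounded_linear_Blinfun_apply[OF bl] r_gen r_eq)
qed

text \<open>
  The resolvent of the generator at \<open>l\<close>
\<close>

definition R :: "'a \<Rightarrow>\<^sub>L 'a" where
  "R = (SOME R. (\<forall>y. (blinfun_apply R y, l *\<^sub>R R y - y) \<in> gen) \<and> (\<forall>x z. (x, z) \<in> gen \<longrightarrow> R (l *\<^sub>R x - z) = x))"

lemma R_gen: "(R y, l *\<^sub>R R y - y) \<in> gen" and R_eq: "(x, z) \<in> gen \<Longrightarrow> R (l *\<^sub>R x - z) = x"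
  using someI_ex[OF resolvent_exists, folded R_def] by auto

lemma R_commute:
  assumes "\<And>t. 0 \<le> t \<Longrightarrow> B o\<^sub>L T t = T t o\<^sub>L B"
  shows "B o\<^sub>L R = R o\<^sub>L B"
proof (rule blinfun_eqI)
  fix y
  have "B (R y) = R (l *\<^sub>R B (R y) - B (l *\<^sub>R R y - y))"
    by (rule R_eq[symmetric, OF gen_map[OF R_gen assms]])
  then show "(B o\<^sub>L R) y = (R o\<^sub>L B) y" by (simp add: blinfun.diff_right blinfun.scaleR_right)
qed

lemma adj_R_in_sun: "x' \<in> sun T \<Longrightarrow> adj R x' \<in> sun T"
  by (rule adj_in_sun) (simp_all add: R_commute T_commute)

text \<open>
  For \<open>v = l *\<^sub>R R x - x\<close> the function \<open>s \<mapsto> x' (T s (R x))\<close> has the derivative \<open>x' (T s v)\<close>. This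
  differs from \<open>x' v\<close> by at most the norm of \<open>adj (T s) x' - x'\<close> times that of \<open>v\<close>, which is small
  uniformly on bounded sets of \<open>x\<close>. So the difference quotients converge in norm.
\<close>

lemma adj_R_generator:
  assumes x': "x' \<in> sun T"
  shows "(adj R x', l *\<^sub>R adj R x' - x') \<in> generator (sun T) (\<lambda>t. adj (T t))"
proof -
  define C where "C = norm (l *\<^sub>R R - id_blinfun) + 1"
  have C: "C > 0" by (simp add: C_def add_nonneg_pos)
  have "((\<lambda>h. (adj (T h) (adj R x') - adj R x') /\<^sub>R h) \<longlongrightarrow> l *\<^sub>R adj R x' - x') (at_right 0)"
  proof (rule tendstoI)
    fix e :: real assume e: "e > 0"
    have "((\<lambda>s. adj (T s) x') \<longlongrightarrow> x') (at_right 0)" by (rule sun.S_tendsto[OF x'])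
    from tendstoD[OF this, of "e / (2 * C)"] e C obtain d where
      d: "d > 0" "\<And>s. 0 < s \<Longrightarrow> s < d \<Longrightarrow> norm (adj (T s) x' - x') < e / (2 * C)"
      by (auto simp: eventually_at_right_field dist_norm)
    let ?D = "\<lambda>h. (adj (T h) (adj R x') - adj R x') /\<^sub>R h - (l *\<^sub>R adj R x' - x')"
    have "norm (?D h) \<le> e / 2"
      if h: "0 < h" "h < d" for h
    proof (rule norm_blinfun_bound)
      fix x
      define v where "v = l *\<^sub>R R x - x"
      have v: "norm v \<le> C * norm x"
        using norm_blinfun[of "l *\<^sub>R R - id_blinfun" x]
        by (simp add: v_def C_def blinfun.diff_left blinfun.scaleR_left distrib_right add_increasing2)
      have der: "((\<lambda>s. x' (T s (R x))) has_vector_derivative x' (T s v)) (at s within {0..h})"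
        if "s \<in> {0..h}" for s
        unfolding v_def using that h
        by (intro bounded_linear.has_vector_derivative[OF blinfun.bounded_linear_right]
            has_vector_derivative_within_subset[OF flow.orbit_has_vector_derivative[OF R_gen]]) auto
      have "((\<lambda>s. x' (T s v)) has_integral x' (T h (R x)) - x' (T 0 (R x))) {0..h}"
        using h by (intro fundamental_theorem_of_calculus der) auto
      then have "((\<lambda>s. x' (T s v) - x' v) has_integral
          (x' (T h (R x)) - x' (T 0 (R x))) - (h - 0) *\<^sub>R x' v) {0..h}"
        using has_integral_const_real[of "x' v" 0 h] h by (intro has_integral_diff) auto
      moreover have "norm (integral {0..h} (\<lambda>s. x' (T s v) - x' v)) \<le> (e / (2 * C) * norm v) * (h - 0)"
      proof (rule integral_bound)
        show "continuous_on {0..h} (\<lambda>s. x' (T s v) - x' v)"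
          by (intro continuous_intros continuous_on_subset[OF flow.continuous_orbit]) auto
        fix s assume s: "s \<in> {0..h}"
        have "norm (adj (T s) x' - x') \<le> e / (2 * C)"
        proof (cases "s = 0")
          case True
          then show ?thesis using e C by (simp add: sun.S_zero)
        next
          case False
          then show ?thesis using d(2)[of s] s h by simp
        qed
        then have "norm ((adj (T s) x' - x') v) \<le> e / (2 * C) * norm v" by (rule norm_blinfun_le)
        then show "norm (x' (T s v) - x' v) \<le> e / (2 * C) * norm v" by (simp add: blinfun.diff_left)
      qed (use h in simp)
      ultimately have "norm (x' (T h (R x)) - x' (R x) - h * x' v) \<le> (e / (2 * C) * norm v) * h"
        by (simp add: integral_unique T_zero)
      also have "\<dots> \<le> (e / (2 * C) * (C * norm x)) * h"
        using v e C h by (intro mult_right_mono mult_left_mono) auto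
      finally have le: "norm (x' (T h (R x)) - x' (R x) - h * x' v) \<le> h * (e / 2 * norm x)"
        using C by (simp add: field_simps)
      have "R (T h x) = T h (R x)"
        using arg_cong[OF R_commute[of "T h"], of "\<lambda>C. blinfun_apply C x"] T_commute h by simp
      then have "?D h x
          = (x' (T h (R x)) - x' (R x)) / h - x' v"
        by (simp add: v_def blinfun.diff_left blinfun.diff_right blinfun.scaleR_left
            blinfun.scaleR_right divide_inverse mult.commute)
      also have "\<dots> = (x' (T h (R x)) - x' (R x) - h * x' v) / h"
        using h by (simp add: diff_divide_distrib)
      also have "norm \<dots> \<le> e / 2 * norm x"
        using le h by (simp add: field_simps)
      finally show "norm (?D h x)
          \<le> e / 2 * norm x" .
    qed (use e in simp)
    then show "\<forall>\<^sub>F h in at_right 0. dist ((adj (T h) (adj R x') - adj R x') /\<^sub>R h) (l *\<^sub>R adj R x' - x') < e"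
      unfolding eventually_at_right_field dist_norm using d(1) e by (fastforce intro: exI[of _ d])
  qed
  then show ?thesis
    using adj_R_in_sun[OF x'] x' sun_subspace by (simp add: generator_def subspace_diff subspace_scale)
qed

text \<open>
  On a vector \<open>R v\<close>, the difference quotient of the adjoint semigroup at \<open>x'\<close> equals \<open>x'\<close> applied to
  the difference quotient of T at \<open>R v\<close>.
\<close>

lemma sun_generator_eq_adj_R:
  assumes xy: "(x', y') \<in> generator (sun T) (\<lambda>t. adj (T t))"
  shows "x' = adj R (l *\<^sub>R x' - y')"
proof (rule blinfun_eqI)
  fix v
  have lim: "((\<lambda>h. (adj (T h) x' - x') /\<^sub>R h) \<longlongrightarrow> y') (at_right 0)"
    using xy by (simp add: generator_def)
  have "((\<lambda>h. ((adj (T h) x' - x') /\<^sub>R h) (R v)) \<longlongrightarrow> y' (R v)) (at_right 0)"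
    by (intro tendsto_intros lim)
  moreover have "((\<lambda>h. x' ((T h (R v) - R v) /\<^sub>R h)) \<longlongrightarrow> x' (l *\<^sub>R R v - v)) (at_right 0)"
    using R_gen[of v] by (intro tendsto_intros) (simp add: generator_def)
  moreover have "((adj (T h) x' - x') /\<^sub>R h) (R v) = x' ((T h (R v) - R v) /\<^sub>R h)" for h
    by (simp add: blinfun.scaleR_left blinfun.scaleR_right blinfun.diff_left blinfun.diff_right)
  ultimately have "y' (R v) = x' (l *\<^sub>R R v - v)"
    using tendsto_unique[OF trivial_limit_at_right_real] by fastforce
  then show "x' v = adj R (l *\<^sub>R x' - y') v"
    by (simp add: blinfun.diff_left blinfun.diff_right blinfun.scaleR_left blinfun.scaleR_right)
qed

text \<open>
  The adjoint of R is the resolvent of the sun generator on the sun dual, and dualizing once more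
  gives the resolvent of the adjoint of the sun generator.
\<close>

lemma dual_resolvent_sun:
  assumes \<phi>: "\<phi> \<in> sun_star T"
  shows "dual_resolvent (A_sun_star T) l \<phi> = dual_map (sun T) (adj R) \<phi>"
proof -
  note S = sun_subspace
  have \<phi>': "\<phi> \<in> dual_on (sun T)" using \<phi> by (simp add: sun_star_def)
  define \<psi> where "\<psi> = dual_map (sun T) (adj R) \<phi>"
  have \<psi>: "\<psi> \<in> dual_on (sun T)"
    unfolding \<psi>_def by (rule dual_map_in_dual_on[OF \<phi>' linear_adj adj_R_in_sun norm_adj_le S])
  have \<psi>_apply: "\<psi> u = \<phi> (adj R u)" if "u \<in> sun T" for u
    using that by (simp add: \<psi>_def dual_map_def)
  define \<omega> where "\<omega> = (\<lambda>x. l * \<psi> x) - \<phi>"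
  have \<omega>: "\<omega> \<in> dual_on (sun T)"
    unfolding \<omega>_def by (rule dual_on_closed(3)[OF S dual_on_closed(2)[OF S \<psi> \<psi>] \<phi>'])
  have "\<psi> y' = \<omega> x'" if xy: "(x', y') \<in> generator (sun T) (\<lambda>t. adj (T t))" for x' y'
  proof -
    have m: "x' \<in> sun T" "y' \<in> sun T" using xy by (auto simp: generator_def)
    then have "l *\<^sub>R x' - y' \<in> sun T" using S by (simp add: subspace_diff subspace_scale)
    then have "\<psi> (l *\<^sub>R x' - y') = \<phi> x'"
      using \<psi>_apply sun_generator_eq_adj_R[OF xy] by simp
    then show ?thesis
      using dual_on_diff_apply[OF \<psi> S _ m(2), of "l *\<^sub>R x'"] m S dual_onD(3)[OF \<psi> m(1)]
      by (simp add: \<omega>_def subspace_scale)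
  qed
  then have 1: "(\<psi>, \<omega>) \<in> A_sun_star T" using \<psi> \<omega> by (auto simp: A_sun_star_def adjoint_graph_def)
  have 2: "\<psi>2 = \<psi>" if "(\<psi>2, \<omega>2) \<in> A_sun_star T" "(\<lambda>x. l * \<psi>2 x - \<omega>2 x) = \<phi>" for \<psi>2 \<omega>2
  proof
    fix u
    have \<psi>2: "\<psi>2 \<in> dual_on (sun T)" using that by (simp add: A_sun_star_def adjoint_graph_def)
    show "\<psi>2 u = \<psi> u"
    proof (cases "u \<in> sun T")
      case True
      note Ru = adj_R_in_sun[OF True]
      have "\<psi>2 (l *\<^sub>R adj R u - u) = \<omega>2 (adj R u)"
        using that(1) adj_R_generator[OF True] by (auto simp: A_sun_star_def adjoint_graph_def)
      moreover have "\<psi>2 (l *\<^sub>R adj R u - u) = l * \<psi>2 (adj R u) - \<psi>2 u"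
        using dual_on_diff_apply[OF \<psi>2 S subspace_scale[OF S Ru] True] dual_onD(3)[OF \<psi>2 Ru] by simp
      moreover have "\<phi> (adj R u) = l * \<psi>2 (adj R u) - \<omega>2 (adj R u)"
        using that(2) by (auto dest: fun_cong[of _ _ "adj R u"])
      ultimately show ?thesis using \<psi>_apply[OF True] by simp
    qed (simp add: dual_onD(1)[OF \<psi>2] dual_onD(1)[OF \<psi>])
  qed
  show ?thesis
    unfolding dual_resolvent_def \<psi>_def[symmetric]
  proof (rule the_equality)
    show "\<exists>\<omega>. (\<psi>, \<omega>) \<in> A_sun_star T \<and> (\<lambda>x. l * \<psi> x - \<omega> x) = \<phi>"
      using 1 by (intro exI[of _ \<omega>]) (simp add: \<omega>_def)
  qed (use 2 in blast)
qed

section \<open>Convolution with functions valued in the sun cross space\<close>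

lemma sun_cross_iff:
  "\<phi> \<in> sun_cross T l \<longleftrightarrow> \<phi> \<in> dual_on (sun T) \<and> (\<exists>y. \<forall>x'\<in>sun T. \<phi> (adj R x') = x' y)"
proof -
  have iff: "dual_map (sun T) (adj R) \<phi> \<in> range (sun_j T) \<longleftrightarrow> (\<exists>y. \<forall>x'\<in>sun T. \<phi> (adj R x') = x' y)"
  proof
    assume "dual_map (sun T) (adj R) \<phi> \<in> range (sun_j T)"
    then obtain y where y: "dual_map (sun T) (adj R) \<phi> = sun_j T y" by blast
    have "\<phi> (adj R x') = x' y" if "x' \<in> sun T" for x'
      using fun_cong[OF y, of x'] that by (simp add: dual_map_def sun_j_def)
    then show "\<exists>y. \<forall>x'\<in>sun T. \<phi> (adj R x') = x' y" by blast
  next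
    assume "\<exists>y. \<forall>x'\<in>sun T. \<phi> (adj R x') = x' y"
    then obtain y where "\<forall>x'\<in>sun T. \<phi> (adj R x') = x' y" by blast
    then have "dual_map (sun T) (adj R) \<phi> = sun_j T y"
      by (intro sun_j_eqI) (simp_all add: dual_map_def)
    then show "dual_map (sun T) (adj R) \<phi> \<in> range (sun_j T)" by simp
  qed
  show ?thesis
  proof (cases "\<phi> \<in> sun_star T")
    case True
    then show ?thesis using iff dual_resolvent_sun[OF True] by (simp add: sun_cross_def sun_star_def)
  qed (simp add: sun_cross_def sun_star_def)
qed

lemma sun_crossD: "\<phi> \<in> sun_cross T l \<Longrightarrow> \<phi> \<in> dual_on (sun T)"
  by (simp add: sun_cross_iff)

lemma sun_j_in_sun_cross: "sun_j T x \<in> sun_cross T l"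
  unfolding sun_cross_iff
proof (intro conjI exI ballI)
  have "\<bar>blinfun_apply x' x\<bar> \<le> norm x * norm x'" for x' :: "'a \<Rightarrow>\<^sub>L real"
    using norm_blinfun[of x' x] by (simp add: mult.commute)
  then show "sun_j T x \<in> dual_on (sun T)"
    using sun_subspace
    by (auto simp: dual_on_def sun_j_def blinfun.add_left blinfun.scaleR_left subspace_add subspace_scale)
  show "sun_j T x (adj R x') = x' (R x)" if "x' \<in> sun T" for x'
    using adj_R_in_sun[OF that] by (simp add: sun_j_def)
qed

lemma dual_map_in_sun_cross:
  assumes \<phi>: "\<phi> \<in> sun_cross T l" and comm: "\<And>t. 0 \<le> t \<Longrightarrow> B o\<^sub>L T t = T t o\<^sub>L B"
  shows "dual_map (sun T) (adj B) \<phi> \<in> sun_cross T l"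
  unfolding sun_cross_iff
proof (intro conjI)
  show "dual_map (sun T) (adj B) \<phi> \<in> dual_on (sun T)"
    by (rule dual_map_in_dual_on[OF sun_crossD[OF \<phi>] linear_adj adj_in_sun[OF comm] norm_adj_le sun_subspace])
  obtain y where y: "\<And>x'. x' \<in> sun T \<Longrightarrow> \<phi> (adj R x') = x' y"
    using \<phi> by (auto simp: sun_cross_iff)
  have "dual_map (sun T) (adj B) \<phi> (adj R x') = x' (B y)" if x': "x' \<in> sun T" for x'
  proof -
    have "adj B (adj R x') = adj R (adj B x')"
      using R_commute[OF comm] by (simp flip: adj_compose)
    then show ?thesis
      using y[OF adj_in_sun[OF comm x']] adj_R_in_sun[OF x'] by (simp add: dual_map_def)
  qed
  then show "\<exists>y. \<forall>x'\<in>sun T. dual_map (sun T) (adj B) \<phi> (adj R x') = x' y" by blast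
qed

lemma sun_cross_add_scale:
  assumes "\<phi> \<in> sun_cross T l" "\<psi> \<in> sun_cross T l"
  shows "(\<lambda>x. \<phi> x + \<psi> x) \<in> sun_cross T l" "(\<lambda>x. c * \<phi> x) \<in> sun_cross T l"
proof -
  obtain y w where y: "\<And>x'. x' \<in> sun T \<Longrightarrow> \<phi> (adj R x') = x' y"
    and w: "\<And>x'. x' \<in> sun T \<Longrightarrow> \<psi> (adj R x') = x' w"
    using assms by (auto simp: sun_cross_iff)
  show "(\<lambda>x. \<phi> x + \<psi> x) \<in> sun_cross T l"
    using dual_on_closed(1)[OF sun_subspace sun_crossD sun_crossD, OF assms] y w
    unfolding sun_cross_iff by (auto simp: blinfun.add_right intro: exI[of _ "y + w"])
  show "(\<lambda>x. c * \<phi> x) \<in> sun_cross T l"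
    using dual_on_closed(2)[OF sun_subspace sun_crossD sun_crossD, OF assms] y
    unfolding sun_cross_iff by (auto simp: blinfun.scaleR_right intro: exI[of _ "c *\<^sub>R y"])
qed

text \<open>
  Let \<open>y\<close> represent \<open>\<phi> \<circ> adj R\<close>. Since R commutes with T, the function \<open>r \<mapsto> \<phi> (adj (T r) (adj R x'))\<close>
  is \<open>x' (T r y)\<close>. Its derivative is \<open>l * x' (T r y) - \<phi> (adj (T r) x')\<close> because \<open>adj R x'\<close> is in the
  domain of the sun generator. Integrating this identity expresses the integral in question
  by \<open>y\<close>.
\<close>

lemma sun_cross_orbit_integral:
  assumes \<phi>: "\<phi> \<in> sun_cross T l" and cd: "0 \<le> c" "c \<le> d"
  shows "\<exists>z. \<forall>x'\<in>sun T. integral {c..d} (\<lambda>r. \<phi> (adj (T r) x')) = x' z"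
proof -
  note S = sun_subspace and \<phi>' = sun_crossD[OF \<phi>]
  obtain y where y: "\<And>x'. x' \<in> sun T \<Longrightarrow> \<phi> (adj R x') = x' y"
    using \<phi> by (auto simp: sun_cross_iff)
  define z where "z = l *\<^sub>R integral {c..d} (\<lambda>r. T r y) - (T d y - T c y)"
  have "integral {c..d} (\<lambda>r. \<phi> (adj (T r) x')) = x' z" if x': "x' \<in> sun T" for x'
  proof -
    have comm: "adj (T r) (adj R x') = adj R (adj (T r) x')" if "r \<ge> 0" for r
      using R_commute[of "T r"] T_commute that by (simp flip: adj_compose)
    have eq: "\<phi> (adj (T r) (adj R x')) = x' (T r y)" if "r \<ge> 0" for r
      using comm[OF that] y[OF adj_T_in_sun[OF that x']] by simp
    have der: "((\<lambda>r. x' (T r y)) has_vector_derivative l * x' (T r y) - \<phi> (adj (T r) x')) (at r within {c..d})"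
      if r: "r \<in> {c..d}" for r
    proof -
      have r0: "r \<ge> 0" using r cd by simp
      note m = adj_T_in_sun[OF r0 x'] adj_T_in_sun[OF r0 adj_R_in_sun[OF x']]
      have "((\<lambda>r. \<phi> (adj (T r) (adj R x'))) has_vector_derivative
          \<phi> (adj (T r) (l *\<^sub>R adj R x' - x'))) (at r within {c..d})"
      proof (rule dual_on_has_vector_derivative[OF \<phi>' S])
        show "((\<lambda>r. adj (T r) (adj R x')) has_vector_derivative adj (T r) (l *\<^sub>R adj R x' - x')) (at r within {c..d})"
          by (rule has_vector_derivative_within_subset[OF sun.orbit_has_vector_derivative[OF adj_R_generator[OF x'] r0]])
             (use cd in auto)
        show "adj (T r) (l *\<^sub>R adj R x' - x') \<in> sun T"
          using m S by (simp add: adj_linear_simps subspace_diff subspace_scale)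
      qed (use cd r x' in \<open>auto intro: adj_T_in_sun adj_R_in_sun\<close>)
      moreover have "\<phi> (adj (T r) (l *\<^sub>R adj R x' - x')) = l * x' (T r y) - \<phi> (adj (T r) x')"
        using m S dual_onD(3)[OF \<phi>' m(2)]
        by (simp add: adj_linear_simps dual_on_diff_apply[OF \<phi>' S] subspace_scale eq[OF r0])
      ultimately show ?thesis
        by (rule has_vector_derivative_transform[rotated 2, OF has_vector_derivative_eq_rhs])
           (use r cd eq in auto)
    qed
    have "((\<lambda>r. l * x' (T r y) - \<phi> (adj (T r) x')) has_integral x' (T d y) - x' (T c y)) {c..d}"
      by (rule fundamental_theorem_of_calculus[OF cd(2) der])
    moreover have "((\<lambda>r. l * x' (T r y)) has_integral l * x' (integral {c..d} (\<lambda>r. T r y))) {c..d}"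
      using has_integral_linear[OF integrable_integral[OF orbit_integrable[OF cd(1)]] blinfun.bounded_linear_right[of x']]
      by (intro has_integral_mult_right) (simp add: o_def)
    ultimately have "((\<lambda>r. l * x' (T r y) - (l * x' (T r y) - \<phi> (adj (T r) x'))) has_integral
        l * x' (integral {c..d} (\<lambda>r. T r y)) - (x' (T d y) - x' (T c y))) {c..d}"
      by (rule has_integral_diff[rotated])
    then show ?thesis
      by (simp add: z_def integral_unique blinfun.diff_right blinfun.scaleR_right)
  qed
  then show ?thesis by blast
qed

lemma continuous_on_sun_cross_orbit:
  fixes f :: "real \<Rightarrow> ('a \<Rightarrow>\<^sub>L real) \<Rightarrow> real"
  assumes f: "\<And>t. f t \<in> dual_on (sun T)"
    and f_lim: "\<And>t. ((\<lambda>s. dual_norm (sun T) (f s - f t)) \<longlongrightarrow> 0) (at t)"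
    and x': "x' \<in> sun T"
  shows "continuous_on {..t} (\<lambda>\<tau>. f \<tau> (adj (T (t - \<tau>)) x'))"
proof (rule continuous_on_dual_apply[OF sun_subspace f f_lim])
  show "continuous_on {..t} (\<lambda>\<tau>. adj (T (t - \<tau>)) x')"
    by (rule continuous_on_compose2[OF sun.continuous_orbit[OF x']]) (auto intro!: continuous_intros)
  show "(\<lambda>\<tau>. adj (T (t - \<tau>)) x') ` {..t} \<subseteq> sun T" by (auto intro: adj_T_in_sun x')
qed

text \<open>
  On a short interval around \<open>\<tau>0\<close> the forcing is replaced by its value at \<open>\<tau>0\<close>, for which the integral
  is represented in X. The resulting error is proportional to the length of the interval. These
  estimates add up over adjacent intervals, so Bolzano's induction yields an
  approximation on the whole interval, and the closed range of j completes the proof.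
\<close>

lemma sun_cross_convolution:
  fixes f :: "real \<Rightarrow> ('a \<Rightarrow>\<^sub>L real) \<Rightarrow> real"
  assumes f: "\<And>t. f t \<in> sun_cross T l"
    and f_lim: "\<And>t. ((\<lambda>s. dual_norm (sun T) (f s - f t)) \<longlongrightarrow> 0) (at t)"
    and st: "s \<le> t"
  shows "\<exists>z. \<forall>x'\<in>sun T. integral {s..t} (\<lambda>\<tau>. f \<tau> (adj (T (t - \<tau>)) x')) = x' z"
proof (rule sun_j_range_closed)
  note S = sun_subspace and f' = sun_crossD[OF f]
  let ?q = "\<lambda>x' \<tau>. f \<tau> (adj (T (t - \<tau>)) x')"
  have cont: "continuous_on {c..d} (?q x')" if "x' \<in> sun T" "d \<le> t" for x' c d
    by (rule continuous_on_subset[OF continuous_on_sun_cross_orbit[OF f' f_lim that(1)]]) (use that in auto)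
  obtain M where M: "M \<ge> 1" "\<And>r. 0 \<le> r \<Longrightarrow> r \<le> t - s \<Longrightarrow> norm (T r) \<le> M"
    using C0_semigroup_locally_bounded[OF T, of "t - s"] by blast
  fix e :: real assume e: "e > 0"
  \<comment> \<open>the error allowed per unit of length; the summand 1 covers \<open>s = t\<close>\<close>
  define e1 where "e1 = e / (t - s + 1)"
  have e1: "e1 > 0" using e st by (simp add: e1_def)
  let ?P = "\<lambda>c d. s \<le> c \<longrightarrow> d \<le> t \<longrightarrow>
    (\<exists>z. \<forall>x'\<in>sun T. \<bar>integral {c..d} (?q x') - x' z\<bar> \<le> e1 * (d - c) * norm x')"
  have "?P s t"
  proof (rule Bolzano[where P="?P", OF st])
    fix c d m assume P1: "?P c d" and P2: "?P d m" and cdm: "c \<le> d" "d \<le> m"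
    show "?P c m"
    proof (intro impI)
      assume sm: "s \<le> c" "m \<le> t"
      obtain z1 z2 where z1: "\<And>x'. x' \<in> sun T \<Longrightarrow> \<bar>integral {c..d} (?q x') - x' z1\<bar> \<le> e1 * (d - c) * norm x'"
        and z2: "\<And>x'. x' \<in> sun T \<Longrightarrow> \<bar>integral {d..m} (?q x') - x' z2\<bar> \<le> e1 * (m - d) * norm x'"
        using P1 P2 sm cdm by auto
      have "\<bar>integral {c..m} (?q x') - x' (z1 + z2)\<bar> \<le> e1 * (m - c) * norm x'" if x': "x' \<in> sun T" for x'
      proof -
        have "integral {c..m} (?q x') = integral {c..d} (?q x') + integral {d..m} (?q x')"
          using cdm sm x' by (intro Henstock_Kurzweil_Integration.integral_combine[symmetric]
              integrable_continuous_interval cont) auto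
        then have "\<bar>integral {c..m} (?q x') - x' (z1 + z2)\<bar>
            \<le> e1 * (d - c) * norm x' + e1 * (m - d) * norm x'"
          using z1[OF x'] z2[OF x'] by (simp add: blinfun.add_right)
        then show ?thesis by (simp add: algebra_simps)
      qed
      then show "\<exists>z. \<forall>x'\<in>sun T. \<bar>integral {c..m} (?q x') - x' z\<bar> \<le> e1 * (m - c) * norm x'" by blast
    qed
  next
    fix \<tau>0 assume \<tau>0: "s \<le> \<tau>0" "\<tau>0 \<le> t"
    obtain \<delta> where \<delta>: "\<delta> > 0" "\<And>\<tau>. \<tau> \<noteq> \<tau>0 \<Longrightarrow> dist \<tau> \<tau>0 < \<delta> \<Longrightarrow> \<bar>dual_norm (sun T) (f \<tau> - f \<tau>0)\<bar> < e1 / M"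
      using tendstoD[OF f_lim[of \<tau>0], of "e1 / M"] e1 M(1) by (auto simp: eventually_at)
    have "?P c d" if cd: "c \<le> \<tau>0" "\<tau>0 \<le> d" "d - c < \<delta>" for c d
    proof (intro impI)
      assume sc: "s \<le> c" "d \<le> t"
      obtain z where z: "\<And>x'. x' \<in> sun T \<Longrightarrow> integral {t - d..t - c} (\<lambda>r. f \<tau>0 (adj (T r) x')) = x' z"
        using sun_cross_orbit_integral[OF f[of \<tau>0], of "t - d" "t - c"] cd sc by auto
      have "\<bar>integral {c..d} (?q x') - x' z\<bar> \<le> e1 * (d - c) * norm x'" if x': "x' \<in> sun T" for x'
      proof -
        let ?k = "\<lambda>\<tau>. f \<tau>0 (adj (T (t - \<tau>)) x')"
        have cont0: "continuous_on {c..d} ?k"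
        proof (rule continuous_on_subset)
          have "dual_norm (sun T) (f \<tau>0 - f \<tau>0) = 0"
            using dual_norm_le[OF S, of "f \<tau>0 - f \<tau>0" 0]
              dual_norm_nonneg[OF dual_on_closed(3)[OF S f'[of \<tau>0] f'[of \<tau>0]] S] by simp
          then show "continuous_on {..t} ?k"
            by (intro continuous_on_sun_cross_orbit[where f="\<lambda>_. f \<tau>0"] f' x') simp
        qed (use sc in auto)
        have "x' z = integral {c..d} ?k"
          using z[OF x'] integral_reflect_shift[of c d "\<lambda>r. f \<tau>0 (adj (T r) x')" t] by simp
        then have "integral {c..d} (?q x') - x' z = integral {c..d} (\<lambda>\<tau>. ?q x' \<tau> - ?k \<tau>)"
          using cont[OF x' sc(2)] cont0
          by (simp add: Henstock_Kurzweil_Integration.integral_diff integrable_continuous_interval)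
        moreover have "norm (integral {c..d} (\<lambda>\<tau>. ?q x' \<tau> - ?k \<tau>)) \<le> (e1 * norm x') * (d - c)"
        proof (rule integral_bound)
          show "continuous_on {c..d} (\<lambda>\<tau>. ?q x' \<tau> - ?k \<tau>)"
            by (intro continuous_on_diff cont[OF x' sc(2)] cont0)
          fix \<tau> assume \<tau>: "\<tau> \<in> {c..d}"
          have Tx: "adj (T (t - \<tau>)) x' \<in> sun T" using \<tau> sc by (intro adj_T_in_sun x') auto
          note D = dual_on_closed(3)[OF S f'[of \<tau>] f'[of \<tau>0]]
          have "dual_norm (sun T) (f \<tau> - f \<tau>0) \<le> e1 / M"
          proof (cases "\<tau> = \<tau>0")
            case True
            then show ?thesis using dual_norm_le[OF S, of "f \<tau>0 - f \<tau>0" 0] e1 M by (auto intro: order_trans)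
          next
            case False
            moreover have "dist \<tau> \<tau>0 < \<delta>"
              using \<tau> cd by (auto simp: dist_real_def abs_if)
            ultimately show ?thesis using \<delta>(2)[of \<tau>] by simp
          qed
          then have "dual_norm (sun T) (f \<tau> - f \<tau>0) * norm (adj (T (t - \<tau>)) x') \<le> e1 / M * (M * norm x')"
            using M(2)[of "t - \<tau>"] \<tau> sc e1 M(1) by (intro mult_mono norm_adj_le') auto
          then show "norm (?q x' \<tau> - ?k \<tau>) \<le> e1 * norm x'"
            using abs_le_dual_norm[OF D S Tx] M(1) by simp
        qed (use cd in simp)
        ultimately show ?thesis by (simp add: algebra_simps)
      qed
      then show "\<exists>z. \<forall>x'\<in>sun T. \<bar>integral {c..d} (?q x') - x' z\<bar> \<le> e1 * (d - c) * norm x'" by blast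
    qed
    then show "\<exists>\<delta>>0. \<forall>c d. c \<le> \<tau>0 \<and> \<tau>0 \<le> d \<and> d - c < \<delta> \<longrightarrow> ?P c d"
      using \<delta>(1) by blast
  qed
  then obtain z where z: "\<And>x'. x' \<in> sun T \<Longrightarrow> \<bar>integral {s..t} (?q x') - x' z\<bar> \<le> e1 * (t - s) * norm x'"
    by auto
  have "e1 * (t - s) \<le> e" using st e by (simp add: e1_def field_simps)
  then have "e1 * (t - s) * norm x' \<le> e * norm x'" for x' :: "'a \<Rightarrow>\<^sub>L real" by (rule mult_right_mono) simp
  then show "\<exists>z. \<forall>x'\<in>sun T. \<bar>integral {s..t} (?q x') - x' z\<bar> \<le> e * norm x'"
    using z order_trans by blast
qed

end

section \<open>Integrals of exponentially bounded functions\<close>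

lemma exp_decay_tendsto:
  fixes C \<delta> :: real
  assumes "\<delta> > 0"
  shows "((\<lambda>u. C * exp (- \<delta> * u) / \<delta>) \<longlongrightarrow> 0) at_top"
proof -
  have "filterlim (\<lambda>u. - \<delta> * u) at_bot at_top"
    by (rule filterlim_tendsto_neg_mult_at_bot[OF tendsto_const _ filterlim_ident]) (use assms in simp)
  then have "((\<lambda>u. exp (- \<delta> * u)) \<longlongrightarrow> 0) at_top" by (rule filterlim_compose[OF exp_at_bot])
  then have "((\<lambda>u. C * exp (- \<delta> * u) / \<delta>) \<longlongrightarrow> C * 0 / \<delta>) at_top"
    using assms by (intro tendsto_intros) auto
  then show ?thesis by simp
qed

lemma absolutely_integrable_exp_bound:
  fixes r :: "real \<Rightarrow> real"
  assumes cont: "continuous_on {c..} r" and "\<delta> > 0"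
    and le: "\<And>\<sigma>. c \<le> \<sigma> \<Longrightarrow> \<bar>r \<sigma>\<bar> \<le> C * exp (- \<delta> * \<sigma>)"
  shows "r absolutely_integrable_on {c..}" "\<bar>integral {c..} r\<bar> \<le> C * exp (- \<delta> * c) / \<delta>"
proof -
  have g: "((\<lambda>\<sigma>. C * exp (- \<delta> * \<sigma>)) has_integral C * (exp (- \<delta> * c) / \<delta>)) {c..}"
    by (intro has_integral_mult_right has_integral_exp_minus_to_infinity \<open>\<delta> > 0\<close>)
  show abs: "r absolutely_integrable_on {c..}"
  proof (rule measurable_bounded_by_integrable_imp_absolutely_integrable)
    show "r \<in> borel_measurable (lebesgue_on {c..})"
      by (rule continuous_imp_measurable_on_sets_lebesgue[OF cont]) simp
    show "(\<lambda>\<sigma>. C * exp (- \<delta> * \<sigma>)) integrable_on {c..}" using g by (rule has_integral_integrable)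
  qed (use le in auto)
  have "norm (integral {c..} r) \<le> integral {c..} (\<lambda>\<sigma>. C * exp (- \<delta> * \<sigma>))"
    using abs g le by (intro integral_norm_bound_integral)
      (auto simp: set_lebesgue_integral_eq_integral(1) has_integral_integrable)
  then show "\<bar>integral {c..} r\<bar> \<le> C * exp (- \<delta> * c) / \<delta>" using integral_unique[OF g] by simp
qed

lemma integral_exp_bound:
  fixes r :: "real \<Rightarrow> 'b::banach"
  assumes cont: "continuous_on {c..d} r" and "\<delta> > 0" "C \<ge> 0"
    and le: "\<And>\<sigma>. c \<le> \<sigma> \<Longrightarrow> \<sigma> \<le> d \<Longrightarrow> norm (r \<sigma>) \<le> C * exp (- \<delta> * \<sigma>)"
  shows "norm (integral {c..d} r) \<le> C * exp (- \<delta> * c) / \<delta>"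
proof -
  have g: "((\<lambda>\<sigma>. C * exp (- \<delta> * \<sigma>)) has_integral C * (exp (- \<delta> * c) / \<delta>)) {c..}"
    by (intro has_integral_mult_right has_integral_exp_minus_to_infinity \<open>\<delta> > 0\<close>)
  have gi: "(\<lambda>\<sigma>. C * exp (- \<delta> * \<sigma>)) integrable_on {c..d}"
    by (intro integrable_continuous_interval continuous_intros)
  have "norm (integral {c..d} r) \<le> integral {c..d} (\<lambda>\<sigma>. C * exp (- \<delta> * \<sigma>))"
    by (rule integral_norm_bound_integral[OF integrable_continuous_interval[OF cont] gi]) (use le in auto)
  also have "\<dots> \<le> integral {c..} (\<lambda>\<sigma>. C * exp (- \<delta> * \<sigma>))"
    using g gi \<open>C \<ge> 0\<close> by (intro integral_subset_le) (auto simp: has_integral_integrable)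
  finally show ?thesis using integral_unique[OF g] by simp
qed

lemma integral_halfline_split:
  fixes r :: "real \<Rightarrow> real"
  assumes "r absolutely_integrable_on {c..}" "c \<le> d"
  shows "integral {c..} r = integral {c..d} r + integral {d..} r"
proof -
  have i: "r integrable_on {c..d}" "r integrable_on {d..}"
    using assms(2)
    by (auto intro!: set_lebesgue_integral_eq_integral(1) set_integrable_subset[OF assms(1)])
  have "{c..} = {c..d} \<union> {d..}" "{c..d} \<inter> {d..} = {d}" using assms(2) by auto
  then show ?thesis using integral_Un[OF i] by simp
qed

text \<open>
  For \<open>e = 1\<close> the image of the half-line is a translate, for \<open>e = -1\<close> a reflected translate.
\<close>

lemma absolutely_integrable_affine:
  fixes r :: "real \<Rightarrow> real"
  assumes r: "r absolutely_integrable_on {c..}" and e: "e = 1 \<or> e = -1"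
  shows "(\<lambda>\<tau>. r (e * (\<tau> - t))) absolutely_integrable_on (\<lambda>\<sigma>. t + e * \<sigma>) ` {c..}"
    "integral ((\<lambda>\<sigma>. t + e * \<sigma>) ` {c..}) (\<lambda>\<tau>. r (e * (\<tau> - t))) = integral {c..} r"
proof -
  have "(\<lambda>\<tau>. r (e * (\<tau> - t))) absolutely_integrable_on (\<lambda>\<sigma>. t + e * \<sigma>) ` {c..} \<and>
      integral ((\<lambda>\<sigma>. t + e * \<sigma>) ` {c..}) (\<lambda>\<tau>. r (e * (\<tau> - t))) = integral {c..} r"
  proof (rule has_absolute_integral_change_of_variables_1'[where g'="\<lambda>_. e", THEN iffD1])
    show "((\<lambda>\<sigma>. t + e * \<sigma>) has_field_derivative e) (at x within {c..})" for x
      by (auto intro!: derivative_eq_intros)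
    show "inj_on (\<lambda>\<sigma>. t + e * \<sigma>) {c..}" using e by (auto simp: inj_on_def)
    show "(\<lambda>x. \<bar>e\<bar> * r (e * (t + e * x - t))) absolutely_integrable_on {c..} \<and>
        integral {c..} (\<lambda>x. \<bar>e\<bar> * r (e * (t + e * x - t))) = integral {c..} r"
      using e r by auto
  qed simp
  then show "(\<lambda>\<tau>. r (e * (\<tau> - t))) absolutely_integrable_on (\<lambda>\<sigma>. t + e * \<sigma>) ` {c..}"
    "integral ((\<lambda>\<sigma>. t + e * \<sigma>) ` {c..}) (\<lambda>\<tau>. r (e * (\<tau> - t))) = integral {c..} r"
    by auto
qed

lemma interval_integral_Icc:
  fixes g :: "real \<Rightarrow> real"
  assumes "a \<le> b" "continuous_on {a..b} g"
  shows "interval_lebesgue_integrable lebesgue (ereal a) (ereal b) g"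
    "interval_lebesgue_integral lebesgue (ereal a) (ereal b) g = integral {a..b} g"
    "interval_lebesgue_integrable lebesgue (ereal b) (ereal a) g"
    "interval_lebesgue_integral lebesgue (ereal b) (ereal a) g = - integral {a..b} g"
proof -
  have abs: "g absolutely_integrable_on {a<..<b}"
    by (rule set_integrable_subset[OF absolutely_integrable_continuous_real[OF assms(2)]]) auto
  then have eq: "(LINT x:{a<..<b}|lebesgue. g x) = integral {a..b} g"
    using integral_open_interval_real[of a b g] by (simp add: set_lebesgue_integral_eq_integral)
  show "interval_lebesgue_integrable lebesgue (ereal a) (ereal b) g"
    "interval_lebesgue_integral lebesgue (ereal a) (ereal b) g = integral {a..b} g"
    using assms(1) abs eq by (simp_all add: interval_lebesgue_integrable_def interval_lebesgue_integral_def)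
  show "interval_lebesgue_integrable lebesgue (ereal b) (ereal a) g"
    "interval_lebesgue_integral lebesgue (ereal b) (ereal a) g = - integral {a..b} g"
  proof -
    show "interval_lebesgue_integrable lebesgue (ereal b) (ereal a) g"
      using assms(1) abs by (cases "a = b") (simp_all add: interval_lebesgue_integrable_def)
    show "interval_lebesgue_integral lebesgue (ereal b) (ereal a) g = - integral {a..b} g"
      using assms(1) eq by (cases "a = b") (simp_all add: interval_lebesgue_integral_def set_lebesgue_integral_def)
  qed
qed

lemma interval_integral_from_minus_infinity:
  fixes r :: "real \<Rightarrow> real"
  assumes r: "r absolutely_integrable_on {0..}"
  shows "interval_lebesgue_integrable lebesgue (-\<infinity>) (ereal t) (\<lambda>\<tau>. r (t - \<tau>))"
    "interval_lebesgue_integral lebesgue (-\<infinity>) (ereal t) (\<lambda>\<tau>. r (t - \<tau>)) = integral {0..} r"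
proof -
  have im: "(\<lambda>\<sigma>. t + (-1) * \<sigma>) ` {0..} = {..t}"
  proof (intro equalityI subsetI)
    show "x \<in> (\<lambda>\<sigma>. t + (-1) * \<sigma>) ` {0..}" if "x \<in> {..t}" for x
      using that by (intro image_eqI[of _ _ "t - x"]) auto
  qed auto
  note a = absolutely_integrable_affine[OF r, of "-1" t, unfolded im, simplified]
  have abs: "(\<lambda>\<tau>. r (t - \<tau>)) absolutely_integrable_on {..<t}"
    by (rule set_integrable_subset[OF a(1)]) auto
  have "negligible ({..t} - {..<t})" by (rule negligible_subset[of "{t}"]) auto
  then have "integral {..<t} (\<lambda>\<tau>. r (t - \<tau>)) = integral {..t} (\<lambda>\<tau>. r (t - \<tau>))"
    by (rule integral_subset_negligible[rotated]) (simp add: less_imp_le subset_iff)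
  then show "interval_lebesgue_integrable lebesgue (-\<infinity>) (ereal t) (\<lambda>\<tau>. r (t - \<tau>))"
    "interval_lebesgue_integral lebesgue (-\<infinity>) (ereal t) (\<lambda>\<tau>. r (t - \<tau>)) = integral {0..} r"
    using abs a(2) by (simp_all add: interval_lebesgue_integrable_def interval_lebesgue_integral_def
      set_lebesgue_integral_eq_integral)
qed

lemma interval_integral_from_infinity:
  fixes r :: "real \<Rightarrow> real"
  assumes r: "r absolutely_integrable_on {0..}"
  shows "interval_lebesgue_integrable lebesgue \<infinity> (ereal t) (\<lambda>\<tau>. r (\<tau> - t))"
    "interval_lebesgue_integral lebesgue \<infinity> (ereal t) (\<lambda>\<tau>. r (\<tau> - t)) = - integral {0..} r"
proof -
  have im: "(\<lambda>\<sigma>. t + 1 * \<sigma>) ` {0..} = {t..}"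
  proof (intro equalityI subsetI)
    show "x \<in> (\<lambda>\<sigma>. t + 1 * \<sigma>) ` {0..}" if "x \<in> {t..}" for x
      using that by (intro image_eqI[of _ _ "x - t"]) auto
  qed auto
  note a = absolutely_integrable_affine[OF r, of 1 t, unfolded im, simplified]
  have abs: "(\<lambda>\<tau>. r (\<tau> - t)) absolutely_integrable_on {t<..}"
    by (rule set_integrable_subset[OF a(1)]) auto
  have "negligible ({t..} - {t<..})" by (rule negligible_subset[of "{t}"]) auto
  then have "integral {t<..} (\<lambda>\<tau>. r (\<tau> - t)) = integral {t..} (\<lambda>\<tau>. r (\<tau> - t))"
    by (rule integral_subset_negligible[rotated]) (simp add: less_imp_le subset_iff)
  then show "interval_lebesgue_integrable lebesgue \<infinity> (ereal t) (\<lambda>\<tau>. r (\<tau> - t))"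
    "interval_lebesgue_integral lebesgue \<infinity> (ereal t) (\<lambda>\<tau>. r (\<tau> - t)) = - integral {0..} r"
    using abs a(2) by (simp_all add: interval_lebesgue_integrable_def interval_lebesgue_integral_def
      set_lebesgue_integral_eq_integral)
qed

lemma integral_shift_halfline:
  fixes r :: "real \<Rightarrow> real"
  assumes r: "r absolutely_integrable_on {0..}" and d: "0 \<le> d"
  shows "integral {0..} (\<lambda>\<sigma>. r (\<sigma> + d)) = integral {d..} r"
proof -
  have "r absolutely_integrable_on {d..}" using d by (intro set_integrable_subset[OF r]) auto
  moreover have "(\<lambda>\<sigma>. - d + 1 * \<sigma>) ` {d..} = {0..}"
  proof (intro equalityI subsetI)
    show "x \<in> (\<lambda>\<sigma>. - d + 1 * \<sigma>) ` {d..}" if "x \<in> {0..}" for x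
      using that by (intro image_eqI[of _ _ "x + d"]) auto
  qed auto
  ultimately show ?thesis using absolutely_integrable_affine(2)[where r=r and c=d and e=1 and t="- d"] by simp
qed

text \<open>
  The values need not lie in a separable space. The integral over the half-line is therefore the
  norm limit of integrals over compact intervals, and the tails identify its value under a
  functional with the scalar integral.
\<close>

lemma improper_integral_exp_bound:
  fixes r :: "real \<Rightarrow> 'b::banach"
  assumes cont: "continuous_on {0..} r" and \<delta>: "\<delta> > 0" and C: "C \<ge> 0"
    and le: "\<And>\<sigma>. 0 \<le> \<sigma> \<Longrightarrow> norm (r \<sigma>) \<le> C * exp (- \<delta> * \<sigma>)"
  obtains L where "((\<lambda>u. integral {0..u} r) \<longlongrightarrow> L) at_top" "norm L \<le> C / \<delta>"
    "\<And>x' :: 'b \<Rightarrow>\<^sub>L real. (\<lambda>\<sigma>. x' (r \<sigma>)) absolutely_integrable_on {0..} \<and> integral {0..} (\<lambda>\<sigma>. x' (r \<sigma>)) = x' L"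
proof -
  have int: "r integrable_on {c..d}" if "0 \<le> c" for c d
    by (rule integrable_continuous_interval[OF continuous_on_subset[OF cont]]) (use that in auto)
  define \<epsilon> where "\<epsilon> u = C * exp (- \<delta> * u) / \<delta>" for u
  have \<epsilon>_lim: "(\<epsilon> \<longlongrightarrow> 0) at_top"
    unfolding \<epsilon>_def by (rule exp_decay_tendsto[OF \<delta>])
  have diff: "norm (integral {0..d} r - integral {0..c} r) \<le> \<epsilon> c" if "0 \<le> c" "c \<le> d" for c d
  proof -
    have "integral {0..c} r + integral {c..d} r = integral {0..d} r"
      by (rule Henstock_Kurzweil_Integration.integral_combine) (use that int in auto)
    then have "integral {0..d} r - integral {0..c} r = integral {c..d} r" by (simp add: algebra_simps)
    also have "norm \<dots> \<le> \<epsilon> c"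
      unfolding \<epsilon>_def
      by (rule integral_exp_bound[OF continuous_on_subset[OF cont] \<delta> C]) (use le that in auto)
    finally show ?thesis .
  qed
  have "Cauchy (\<lambda>n. integral {0..real n} r)"
  proof (rule CauchyI')
    fix e :: real assume "e > 0"
    from order_tendstoD(2)[OF \<epsilon>_lim this] obtain N where N: "\<And>u. N \<le> u \<Longrightarrow> \<epsilon> u < e"
      unfolding eventually_at_top_linorder by blast
    show "\<exists>M. \<forall>m\<ge>M. \<forall>n>m. dist (integral {0..real m} r) (integral {0..real n} r) < e"
    proof (intro exI allI impI)
      fix m n assume mn: "m \<ge> nat \<lceil>N\<rceil>" "m < n"
      then have "\<epsilon> (real m) < e" by (intro N) linarith
      then show "dist (integral {0..real m} r) (integral {0..real n} r) < e"
        using diff[of "real m" "real n"] mn by (simp add: dist_norm norm_minus_commute)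
    qed
  qed
  then obtain L where L: "(\<lambda>n. integral {0..real n} r) \<longlonglongrightarrow> L"
    by (auto simp: Cauchy_convergent_iff convergent_def)
  have L_le: "norm (L - integral {0..u} r) \<le> \<epsilon> u" if u: "0 \<le> u" for u
  proof (rule Lim_bounded[where M="nat \<lceil>u\<rceil>"])
    show "(\<lambda>n. norm (integral {0..real n} r - integral {0..u} r)) \<longlonglongrightarrow> norm (L - integral {0..u} r)"
      by (intro tendsto_intros L)
    show "\<forall>n\<ge>nat \<lceil>u\<rceil>. norm (integral {0..real n} r - integral {0..u} r) \<le> \<epsilon> u"
    proof (intro allI impI)
      fix n assume "nat \<lceil>u\<rceil> \<le> n"
      then have "u \<le> real n" by linarith
      then show "norm (integral {0..real n} r - integral {0..u} r) \<le> \<epsilon> u" by (rule diff[OF u])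
    qed
  qed
  have lim: "((\<lambda>u. integral {0..u} r) \<longlongrightarrow> L) at_top"
  proof -
    have "\<forall>\<^sub>F u in at_top. norm (integral {0..u} r - L) \<le> \<epsilon> u"
      using eventually_ge_at_top[of 0]
      by eventually_elim (use L_le in \<open>simp add: norm_minus_commute\<close>)
    from Lim_null_comparison[OF this \<epsilon>_lim] show ?thesis by (simp add: LIM_zero_iff)
  qed
  have "norm L \<le> C / \<delta>" using L_le[of 0] by (simp add: \<epsilon>_def)
  moreover have "(\<lambda>\<sigma>. x' (r \<sigma>)) absolutely_integrable_on {0..} \<and> integral {0..} (\<lambda>\<sigma>. x' (r \<sigma>)) = x' L"
    for x' :: "'b \<Rightarrow>\<^sub>L real"
  proof -
    let ?s = "\<lambda>\<sigma>. x' (r \<sigma>)"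
    have s_cont: "continuous_on {0..} ?s" by (intro continuous_intros cont)
    have s_le: "\<bar>?s \<sigma>\<bar> \<le> (norm x' * C) * exp (- \<delta> * \<sigma>)" if "0 \<le> \<sigma>" for \<sigma>
      using norm_blinfun[of x' "r \<sigma>"] mult_left_mono[OF le[OF that] norm_ge_zero[of x']]
      by (simp add: mult.assoc)
    have abs: "?s absolutely_integrable_on {0..}"
      by (rule absolutely_integrable_exp_bound(1)[OF s_cont \<delta> s_le])
    have "((\<lambda>u. integral {0..u} ?s) \<longlongrightarrow> integral {0..} ?s) at_top"
    proof -
      have "\<forall>\<^sub>F u in at_top. norm (integral {0..u} ?s - integral {0..} ?s) \<le> norm x' * \<epsilon> u"
        using eventually_ge_at_top[of 0]
      proof eventually_elim
        case (elim u)
        have "\<bar>integral {u..} ?s\<bar> \<le> (norm x' * C) * exp (- \<delta> * u) / \<delta>"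
          using elim by (intro absolutely_integrable_exp_bound(2) \<delta> s_le continuous_on_subset[OF s_cont]) auto
        then show ?case using integral_halfline_split[OF abs elim] by (simp add: \<epsilon>_def mult.assoc)
      qed
      moreover have "((\<lambda>u. norm x' * \<epsilon> u) \<longlongrightarrow> 0) at_top" by (rule tendsto_mult_right_zero[OF \<epsilon>_lim])
      ultimately show ?thesis by (rule LIM_zero_cancel[OF Lim_null_comparison])
    qed
    moreover have "integral {0..u} ?s = x' (integral {0..u} r)" for u
      using integral_linear[OF int[of 0 u] blinfun.bounded_linear_right[of x']] by (simp add: o_def)
    moreover have "((\<lambda>u. x' (integral {0..u} r)) \<longlongrightarrow> x' L) at_top" by (intro tendsto_intros lim)
    ultimately have "integral {0..} ?s = x' L"
      by (simp add: tendsto_unique[OF trivial_limit_at_top_linorder])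
    with abs show ?thesis by blast
  qed
  ultimately show ?thesis by (rule that[OF lim])
qed

section \<open>Weak-star integrals with values in the range of the embedding\<close>

context sun_dual
begin

lemma weak_integral_eq:
  assumes "\<And>x'. x' \<in> sun T \<Longrightarrow> interval_lebesgue_integrable lebesgue a b (\<lambda>\<tau>. q \<tau> x')"
    and "\<And>x'. x' \<in> sun T \<Longrightarrow> interval_lebesgue_integral lebesgue a b (\<lambda>\<tau>. q \<tau> x') = x' z"
  shows "integral_in_j T a b q" "j_inv_integral T a b q = z"
proof -
  have eq: "wstar_integral (sun T) a b q = sun_j T z"
    by (rule sun_j_eqI) (simp_all add: wstar_integral_def assms)
  then show "integral_in_j T a b q"
    by (simp add: integral_in_j_def wstar_integrable_def assms)
  show "j_inv_integral T a b q = z"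
    by (simp add: j_inv_integral_def eq inv_f_f[OF inj_sun_j])
qed

text \<open>
  The tails of the scalar integrals are small uniformly for \<open>x'\<close> in the unit ball, so the
  integrals over compact intervals approximate the integral over the half-line as in
  \<open>sun_j_range_closed\<close>.
\<close>

lemma halfline_integral_in_X:
  fixes q :: "('a \<Rightarrow>\<^sub>L real) \<Rightarrow> real \<Rightarrow> real"
  assumes cont: "\<And>x'. x' \<in> sun T \<Longrightarrow> continuous_on {0..} (q x')" and \<delta>: "\<delta> > 0" and C: "C \<ge> 0"
    and le: "\<And>x' \<sigma>. x' \<in> sun T \<Longrightarrow> 0 \<le> \<sigma> \<Longrightarrow> \<bar>q x' \<sigma>\<bar> \<le> C * norm x' * exp (- \<delta> * \<sigma>)"
    and fin: "\<And>u. 0 \<le> u \<Longrightarrow> \<exists>z. \<forall>x'\<in>sun T. integral {0..u} (q x') = x' z"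
  obtains z where "\<And>x'. x' \<in> sun T \<Longrightarrow> integral {0..} (q x') = x' z"
    "norm z \<le> norming_const * (C / \<delta>)"
proof -
  have "\<exists>z. \<forall>x'\<in>sun T. integral {0..} (q x') = x' z"
  proof (rule sun_j_range_closed)
    fix e :: real assume "e > 0"
    have "((\<lambda>u. C * exp (- \<delta> * u) / \<delta>) \<longlongrightarrow> 0) at_top" by (rule exp_decay_tendsto[OF \<delta>])
    from order_tendstoD(2)[OF this \<open>e > 0\<close>]
    obtain N where N: "\<And>u. N \<le> u \<Longrightarrow> C * exp (- \<delta> * u) / \<delta> < e"
      unfolding eventually_at_top_linorder by blast
    define u where "u = max N 0"
    have u: "C * exp (- \<delta> * u) / \<delta> < e" "0 \<le> u" using N[of u] by (simp_all add: u_def)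
    obtain z where z: "\<And>x'. x' \<in> sun T \<Longrightarrow> integral {0..u} (q x') = x' z" using fin[OF u(2)] by blast
    have "\<bar>integral {0..} (q x') - x' z\<bar> \<le> e * norm x'" if x': "x' \<in> sun T" for x'
    proof -
      have "integral {0..} (q x') - x' z = integral {u..} (q x')"
        using integral_halfline_split[OF absolutely_integrable_exp_bound(1)[OF cont[OF x'] \<delta> le[OF x']] u(2)] z[OF x']
        by simp
      moreover have "\<bar>integral {u..} (q x')\<bar> \<le> (C * norm x') * exp (- \<delta> * u) / \<delta>"
        using u by (intro absolutely_integrable_exp_bound(2) \<delta> le x' continuous_on_subset[OF cont[OF x']]) auto
      moreover have "(C * norm x') * exp (- \<delta> * u) / \<delta> = C * exp (- \<delta> * u) / \<delta> * norm x'" by simp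
      moreover have "\<dots> \<le> e * norm x'" using u(1) by (intro mult_right_mono) auto
      ultimately show ?thesis by linarith
    qed
    then show "\<exists>z. \<forall>x'\<in>sun T. \<bar>integral {0..} (q x') - x' z\<bar> \<le> e * norm x'" by blast
  qed
  then obtain z where z: "\<And>x'. x' \<in> sun T \<Longrightarrow> integral {0..} (q x') = x' z" by blast
  have "norm z \<le> norming_const * (C / \<delta>)"
  proof (rule norm_le_of_sun)
    show "0 \<le> C / \<delta>" using C \<delta> by simp
    fix x' assume x': "x' \<in> sun T"
    show "\<bar>x' z\<bar> \<le> C / \<delta> * norm x'"
      using absolutely_integrable_exp_bound(2)[OF cont[OF x'] \<delta> le[OF x']] z[OF x'] by simp
  qed
  with z show ?thesis by (rule that)
qed

end

section \<open>Forcing terms\<close>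

locale forcing = sun_resolvent T l
  for T :: "real \<Rightarrow> 'a::banach \<Rightarrow>\<^sub>L 'a" and l :: real +
  fixes f :: "real \<Rightarrow> ('a \<Rightarrow>\<^sub>L real) \<Rightarrow> real" and \<eta> F :: real
  assumes f_cross: "f t \<in> sun_cross T l"
    and f_lim: "((\<lambda>s. dual_norm (sun T) (f s - f t)) \<longlongrightarrow> 0) (at t)"
    and f_bound: "dual_norm (sun T) (f t) \<le> F * exp (\<eta> * \<bar>t\<bar>)"
    and \<eta>_pos: "0 < \<eta>" and F_nonneg: "0 \<le> F"
begin

abbreviation N :: "(('a \<Rightarrow>\<^sub>L real) \<Rightarrow> real) \<Rightarrow> real" where
  "N \<equiv> dual_norm (sun T)"

lemma f_dual: "f t \<in> dual_on (sun T)" and f_diff_dual: "f s - f t \<in> dual_on (sun T)"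
  using f_cross sun_crossD dual_on_closed(3)[OF sun_subspace] by auto

lemma P_sun_star_eq: "P_sun_star T (blinfun_apply P) = dual_map (sun T) (adj P)"
  by (simp add: P_sun_star_def blinfun_apply_inverse)

lemma f_apply_adj_le:
  assumes "u \<in> sun T"
  shows "\<bar>f t u\<bar> \<le> F * exp (\<eta> * \<bar>t\<bar>) * norm u"
  using abs_le_dual_norm[OF f_dual sun_subspace assms, of t] mult_right_mono[OF f_bound[of t] norm_ge_zero[of u]]
  by linarith

end

section \<open>The parts on which the semigroup is a group\<close>

text \<open>
  Here \<open>Q t\<close> is the group on \<open>E\<close> at time \<open>t\<close> after the projector \<open>P\<close>.
\<close>

locale projected_group = sun_resolvent T l
  for T :: "real \<Rightarrow> 'a::banach \<Rightarrow>\<^sub>L 'a" and l :: real +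
  fixes P :: "'a \<Rightarrow>\<^sub>L 'a" and E :: "'a set" and Q :: "real \<Rightarrow> 'a \<Rightarrow>\<^sub>L 'a"
  assumes P_commute: "0 \<le> t \<Longrightarrow> P o\<^sub>L T t = T t o\<^sub>L P"
    and P_mem: "P x \<in> E" and P_id: "x \<in> E \<Longrightarrow> P x = x"
    and Q_mem: "Q t x \<in> E" and Q_add: "Q (s + t) x = Q s (Q t x)" and Q_zero: "Q 0 = P"
    and Q_nonneg: "0 \<le> t \<Longrightarrow> Q t x = T t (P x)"
    and Q_cont: "continuous_on UNIV (\<lambda>t. Q t x)"
    and Q_bounded: "\<exists>M. \<forall>t. \<bar>t\<bar> \<le> r \<longrightarrow> norm (Q t) \<le> M"
    and part_sub: "sun_cross_part T l P \<subseteq> range (sun_j T)"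
begin

lemma adj_P_in_sun: "x' \<in> sun T \<Longrightarrow> adj P x' \<in> sun T"
  by (rule adj_in_sun[OF P_commute])

lemma P_Q: "P (Q t x) = Q t x"
  by (rule P_id[OF Q_mem])

lemma Q_T_inverse:
  assumes "u \<in> E" "t \<le> 0"
  shows "Q t (T (- t) u) = u"
  using Q_nonneg[of "- t" u] Q_add[of t "- t" u] assms by (simp add: P_id Q_zero)

end

locale group_part = forcing T l f \<eta> F + projected_group T l P E Q
  for T :: "real \<Rightarrow> 'a::banach \<Rightarrow>\<^sub>L 'a" and l f \<eta> F P E Q
begin

text \<open>
  The projected forcing, pulled back from the sun cross space to X
\<close>

definition y :: "real \<Rightarrow> 'a" where
  "y \<tau> = inv (sun_j T) (P_sun_star T P (f \<tau>))"

lemma sun_j_y: "sun_j T (y \<tau>) = P_sun_star T P (f \<tau>)"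
  unfolding y_def by (rule f_inv_into_f) (use part_sub f_cross in \<open>auto simp: sun_cross_part_def\<close>)

lemma y_apply: "x' \<in> sun T \<Longrightarrow> x' (y \<tau>) = f \<tau> (adj P x')"
  using fun_cong[OF sun_j_y[of \<tau>], of x'] by (simp add: sun_j_def P_sun_star_eq dual_map_def)

lemma P_y: "P (y \<tau>) = y \<tau>"
proof (rule sun_separates)
  fix x' assume x': "x' \<in> sun T"
  have "adj P (adj P x') = adj P x'" by (rule blinfun_eqI) (simp add: P_id P_mem)
  then show "x' (P (y \<tau>)) = x' (y \<tau>)"
    using y_apply[OF x'] y_apply[OF adj_P_in_sun[OF x'], of \<tau>] by simp
qed

lemma y_mem: "y \<tau> \<in> E"
  using P_mem[of "y \<tau>"] by (simp add: P_y)

lemma y_diff_le: "norm (y \<tau> - y \<sigma>) \<le> norming_const * (N (f \<tau> - f \<sigma>) * norm P)"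
proof (rule norm_le_of_sun)
  show "0 \<le> N (f \<tau> - f \<sigma>) * norm P"
    using dual_norm_nonneg[OF f_diff_dual sun_subspace] by simp
  fix x' assume x': "x' \<in> sun T"
  have "\<bar>x' (y \<tau> - y \<sigma>)\<bar> = \<bar>(f \<tau> - f \<sigma>) (adj P x')\<bar>"
    by (simp add: blinfun.diff_right y_apply[OF x'])
  also have "\<dots> \<le> N (f \<tau> - f \<sigma>) * norm (adj P x')"
    by (rule abs_le_dual_norm[OF f_diff_dual sun_subspace adj_P_in_sun[OF x']])
  also have "\<dots> \<le> N (f \<tau> - f \<sigma>) * (norm P * norm x')"
    by (intro mult_left_mono norm_adj_le dual_norm_nonneg[OF f_diff_dual sun_subspace])
  finally show "\<bar>x' (y \<tau> - y \<sigma>)\<bar> \<le> N (f \<tau> - f \<sigma>) * norm P * norm x'" by (simp add: mult.assoc)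
qed

lemma y_cont: "continuous_on UNIV y"
proof -
  have "(y \<longlongrightarrow> y t) (at t)" for t
  proof (rule LIM_zero_cancel, rule Lim_null_comparison)
    show "\<forall>\<^sub>F s in at t. norm (y s - y t) \<le> norming_const * (N (f s - f t) * norm P)"
      by (rule always_eventually) (simp add: y_diff_le)
    show "((\<lambda>s. norming_const * (N (f s - f t) * norm P)) \<longlongrightarrow> 0) (at t)"
      by (intro tendsto_mult_right_zero tendsto_mult_left_zero f_lim)
  qed
  then show ?thesis by (simp add: continuous_on_def)
qed

definition Y :: real where "Y = norming_const * (F * norm P)"

lemma Y_nonneg: "0 \<le> Y"
  using norming_const_ge_1 F_nonneg by (simp add: Y_def)

lemma y_bound: "norm (y \<tau>) \<le> Y * exp (\<eta> * \<bar>\<tau>\<bar>)"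
proof -
  have "norm (y \<tau>) \<le> norming_const * (F * exp (\<eta> * \<bar>\<tau>\<bar>) * norm P)"
  proof (rule norm_le_of_sun)
    show "0 \<le> F * exp (\<eta> * \<bar>\<tau>\<bar>) * norm P" using F_nonneg by simp
    fix x' assume x': "x' \<in> sun T"
    have "\<bar>x' (y \<tau>)\<bar> \<le> F * exp (\<eta> * \<bar>\<tau>\<bar>) * norm (adj P x')"
      unfolding y_apply[OF x'] by (rule f_apply_adj_le[OF adj_P_in_sun[OF x']])
    also have "\<dots> \<le> F * exp (\<eta> * \<bar>\<tau>\<bar>) * (norm P * norm x')"
      using F_nonneg by (intro mult_left_mono norm_adj_le) simp
    finally show "\<bar>x' (y \<tau>)\<bar> \<le> F * exp (\<eta> * \<bar>\<tau>\<bar>) * norm P * norm x'" by (simp add: mult.assoc)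
  qed
  then show ?thesis by (simp add: Y_def algebra_simps)
qed

lemma kernel_cont: "continuous_on I (\<lambda>\<tau>. Q (t - \<tau>) (y \<tau>))"
proof -
  have "continuous_on I (\<lambda>\<tau>. t - \<tau>)" by (intro continuous_intros)
  from continuous_on_strongly_continuous_apply[OF Q_cont _ this _ continuous_on_subset[OF y_cont]]
  show ?thesis using Q_bounded by simp
qed

text \<open>
  An antiderivative of \<open>Q (- \<tau>) (y \<tau>)\<close>. Whatever the sign of \<open>t\<close>, at least one of the two integrals
  is 0.
\<close>

definition H :: "real \<Rightarrow> 'a" where
  "H t = integral {0..t} (\<lambda>\<tau>. Q (- \<tau>) (y \<tau>)) - integral {t..0} (\<lambda>\<tau>. Q (- \<tau>) (y \<tau>))"

lemma kernel0_integrable: "(\<lambda>\<tau>. Q (- \<tau>) (y \<tau>)) integrable_on {c..d}"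
  using kernel_cont[of "{c..d}" 0] by (intro integrable_continuous_interval) simp

lemma H_diff:
  assumes "c \<le> d"
  shows "H d - H c = integral {c..d} (\<lambda>\<tau>. Q (- \<tau>) (y \<tau>))"
proof -
  let ?I = "\<lambda>a b. integral {a..b} (\<lambda>\<tau>. Q (- \<tau>) (y \<tau>))"
  have z: "?I a b = 0" if "b \<le> a" for a b
    using that by (cases "a = b") auto
  have c: "?I a b + ?I b e = ?I a e" if "a \<le> b" "b \<le> e" for a b e
    using that kernel0_integrable by (intro Henstock_Kurzweil_Integration.integral_combine)
  consider "0 \<le> c" | "c < 0" "0 \<le> d" | "d < 0" by linarith
  then show ?thesis
  proof cases
    case 1
    then show ?thesis using c[of 0 c d] z[of 0 c] z[of 0 d] assms by (simp add: H_def algebra_simps)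
  next
    case 2
    then show ?thesis using c[of c 0 d] z[of 0 d] z[of c 0] by (simp add: H_def add.commute)
  next
    case 3
    then show ?thesis using c[of c d 0] z[of d 0] z[of c 0] assms by (simp add: H_def algebra_simps)
  qed
qed

lemma H_cont: "continuous_on UNIV H"
proof -
  have "isCont H t" for t
  proof (rule continuous_on_interior[of "{t - 1..t + 1}"])
    have "continuous_on {t - 1..t + 1} (\<lambda>s. H (t - 1) + integral {t - 1..s} (\<lambda>\<tau>. Q (- \<tau>) (y \<tau>)))"
      by (intro continuous_intros indefinite_integral_continuous_1 kernel0_integrable)
    moreover have "H (t - 1) + integral {t - 1..s} (\<lambda>\<tau>. Q (- \<tau>) (y \<tau>)) = H s" if "s \<in> {t - 1..t + 1}" for s
      using H_diff[of "t - 1" s] that by (simp add: algebra_simps)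
    ultimately show "continuous_on {t - 1..t + 1} H" by (rule continuous_on_eq)
  qed simp
  then show ?thesis by (simp add: continuous_on_eq_continuous_at)
qed

lemma Q_H:
  assumes "c \<le> d"
  shows "Q t (H d - H c) = integral {c..d} (\<lambda>\<tau>. Q (t - \<tau>) (y \<tau>))"
proof -
  have "Q t (H d - H c) = integral {c..d} (\<lambda>\<tau>. Q t (Q (- \<tau>) (y \<tau>)))"
    unfolding H_diff[OF assms]
    using integral_linear[OF kernel0_integrable[of c d] blinfun.bounded_linear_right[of "Q t"]] by (simp add: o_def)
  then show ?thesis by (simp flip: Q_add)
qed

text \<open>
  The variation-of-constants formula with the group factored out. The constant \<open>h\<close> selects the
  solution: \<open>H 0\<close> makes it vanish at time 0, and the limit of \<open>H\<close> at infinity makes it grow slowly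
  enough in the unstable case.
\<close>

definition v :: "'a \<Rightarrow> real \<Rightarrow> 'a" where
  "v h t = Q t (H t - h)"

lemma v_cont: "continuous_on UNIV (v h)"
  unfolding v_def
  by (rule continuous_on_strongly_continuous_apply[OF Q_cont _ continuous_on_id _
        continuous_on_diff[OF H_cont continuous_on_const]])
     (use Q_bounded in simp_all)

lemma v_mild:
  assumes x': "x' \<in> sun T" and st: "s \<le> t"
  shows "x' (v h t) = x' (T (t - s) (v h s)) + integral {s..t} (\<lambda>\<tau>. f \<tau> (adj P (adj (T (t - \<tau>)) x')))"
proof -
  have "T (t - s) (v h s) = Q (t - s) (Q s (H s - h))"
    using Q_nonneg[of "t - s" "Q s (H s - h)"] st by (simp add: P_Q v_def)
  also have "\<dots> = Q t (H s - h)" by (simp flip: Q_add)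
  finally have "v h t = T (t - s) (v h s) + Q t (H t - H s)"
    by (simp add: v_def flip: blinfun.add_right)
  moreover have "x' (Q t (H t - H s)) = integral {s..t} (\<lambda>\<tau>. x' (Q (t - \<tau>) (y \<tau>)))"
    unfolding Q_H[OF st]
    using integral_linear[OF integrable_continuous_interval[OF kernel_cont] blinfun.bounded_linear_right[of x'], of s t t]
    by (simp add: o_def)
  moreover have "integral {s..t} (\<lambda>\<tau>. x' (Q (t - \<tau>) (y \<tau>)))
      = integral {s..t} (\<lambda>\<tau>. f \<tau> (adj P (adj (T (t - \<tau>)) x')))"
  proof (rule integral_cong)
    fix \<tau> assume "\<tau> \<in> {s..t}"
    then have \<tau>: "0 \<le> t - \<tau>" by simp
    show "x' (Q (t - \<tau>) (y \<tau>)) = f \<tau> (adj P (adj (T (t - \<tau>)) x'))"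
      using y_apply[OF adj_T_in_sun[OF \<tau> x'], of \<tau>] by (simp add: Q_nonneg[OF \<tau>] P_y)
  qed
  ultimately show ?thesis by (simp add: blinfun.add_right)
qed

text \<open>
  An element of the part that equals \<open>sun_j T x\<close> is fixed by the idempotent dual projector, and
  this forces \<open>P x = x\<close>.
\<close>

lemma sun_cross_part_eq: "sun_cross_part T l P = sun_j T ` E"
proof (intro equalityI subsetI)
  fix \<phi> assume "\<phi> \<in> sun_cross_part T l P"
  then obtain \<psi> where \<psi>: "\<phi> = P_sun_star T P \<psi>" "\<psi> \<in> sun_cross T l" by (auto simp: sun_cross_part_def)
  then obtain x where x: "\<phi> = sun_j T x" using part_sub \<open>\<phi> \<in> _\<close> by blast
  have "P x = x"
  proof (rule sun_separates)
    fix x' assume x': "x' \<in> sun T"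
    have ap: "u x = \<psi> (adj P u)" if "u \<in> sun T" for u
      using that fun_cong[OF x, of u] \<psi>(1) by (simp add: P_sun_star_eq dual_map_def sun_j_def)
    have "adj P (adj P x') = adj P x'" by (rule blinfun_eqI) (simp add: P_id P_mem)
    then show "x' (P x) = x' x"
      using ap[OF x'] ap[OF adj_P_in_sun[OF x']] by simp
  qed
  then show "\<phi> \<in> sun_j T ` E" using x P_mem[of x] by auto
next
  fix \<phi> assume "\<phi> \<in> sun_j T ` E"
  then obtain x where x: "x \<in> E" "\<phi> = sun_j T x" by blast
  have "P_sun_star T P (sun_j T x) = sun_j T x"
    by (rule sun_j_eqI) (simp_all add: P_sun_star_eq dual_map_def adj_P_in_sun sun_j_def P_id x(1))
  then show "\<phi> \<in> sun_cross_part T l P"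
    using x(2) imageI[OF sun_j_in_sun_cross[of x], of "P_sun_star T P"] by (simp add: sun_cross_part_def)
qed

lemma T_sun_star_j: "0 \<le> t \<Longrightarrow> T_sun_star T t (sun_j T x) = sun_j T (T t x)"
  unfolding T_sun_star_def
  by (rule sun_j_eqI) (simp_all add: dual_map_def sun_j_def adj_T_in_sun)

lemma group_ext_sun_star:
  assumes x: "x \<in> E"
  shows "group_ext (T_sun_star T) (sun_cross_part T l P) t (sun_j T x) = sun_j T (Q t x)"
proof (cases "0 \<le> t")
  case True
  then show ?thesis using Q_nonneg[of t x] x by (simp add: group_ext_def T_sun_star_j P_id)
next
  case False
  have QQ: "Q t (T (- t) u) = u" if "u \<in> E" for u
    using Q_T_inverse[OF that] False by simp
  have "the_inv_into (sun_j T ` E) (T_sun_star T (- t)) (sun_j T x) = sun_j T (Q t x)"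
  proof (rule the_inv_into_f_eq)
    show "inj_on (T_sun_star T (- t)) (sun_j T ` E)"
    proof (rule inj_onI)
      fix \<phi> \<psi> assume "\<phi> \<in> sun_j T ` E" "\<psi> \<in> sun_j T ` E"
        and eq: "T_sun_star T (- t) \<phi> = T_sun_star T (- t) \<psi>"
      then obtain u w where uw: "u \<in> E" "w \<in> E" "\<phi> = sun_j T u" "\<psi> = sun_j T w" by blast
      then have "T (- t) u = T (- t) w"
        using eq False inj_sun_j by (simp add: T_sun_star_j inj_eq)
      then have "Q t (T (- t) u) = Q t (T (- t) w)" by (rule arg_cong)
      then have "u = w" unfolding QQ[OF uw(1)] QQ[OF uw(2)] .
      then show "\<phi> = \<psi>" using uw(3,4) by simp
    qed
    show "T_sun_star T (- t) (sun_j T (Q t x)) = sun_j T x"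
      using Q_nonneg[of "- t" "Q t x"] Q_add[of "- t" t x] False x
      by (simp add: T_sun_star_j P_Q Q_zero P_id)
  qed (use Q_mem in simp)
  then show ?thesis using False by (simp add: group_ext_def sun_cross_part_eq)
qed

lemma group_integrand_apply:
  assumes "x' \<in> sun T"
  shows "group_integrand T l P f t \<tau> x' = x' (Q (t - \<tau>) (y \<tau>))"
  using assms group_ext_sun_star[OF y_mem, of "t - \<tau>" \<tau>]
  by (simp add: group_integrand_def sun_j_y[symmetric]) (simp add: sun_j_def)

lemma v_from_zero:
  "integral_in_j T 0 (ereal t) (group_integrand T l P f t)"
  "j_inv_integral T 0 (ereal t) (group_integrand T l P f t) = v (H 0) t"
proof -
  have *: "interval_lebesgue_integrable lebesgue (ereal 0) (ereal t) (\<lambda>\<tau>. x' (Q (t - \<tau>) (y \<tau>))) \<and>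
      interval_lebesgue_integral lebesgue (ereal 0) (ereal t) (\<lambda>\<tau>. x' (Q (t - \<tau>) (y \<tau>))) = x' (v (H 0) t)"
    for x' :: "'a \<Rightarrow>\<^sub>L real"
  proof -
    have cont: "continuous_on {c..d} (\<lambda>\<tau>. x' (Q (t - \<tau>) (y \<tau>)))" for c d
      by (rule bounded_linear.continuous_on[OF blinfun.bounded_linear_right kernel_cont])
    have int: "integral {c..d} (\<lambda>\<tau>. x' (Q (t - \<tau>) (y \<tau>))) = x' (Q t (H d - H c))" if "c \<le> d" for c d
      unfolding Q_H[OF that]
      using integral_linear[OF integrable_continuous_interval[OF kernel_cont] blinfun.bounded_linear_right[of x'], of c d t]
      by (simp add: o_def)
    show ?thesis
    proof (cases "0 \<le> t")
      case True
      then show ?thesis using interval_integral_Icc(1,2)[OF True cont] int[OF True] by (simp add: v_def)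
    next
      case False
      then have t: "t \<le> 0" by simp
      show ?thesis
        using interval_integral_Icc(3,4)[OF t cont] int[OF t] by (simp add: v_def blinfun.diff_right)
    qed
  qed
  show "integral_in_j T 0 (ereal t) (group_integrand T l P f t)"
    "j_inv_integral T 0 (ereal t) (group_integrand T l P f t) = v (H 0) t"
    by (rule weak_integral_eq; use * in \<open>simp add: group_integrand_apply flip: zero_ereal_def\<close>)+
qed

lemma v_zero: "v (H 0) 0 = 0"
  by (simp add: v_def)

text \<open>
  Between 0 and \<open>t\<close> the absolute values satisfy \<open>\<bar>\<tau>\<bar> = \<bar>t\<bar> - \<bar>t - \<tau>\<bar>\<close>. So the growth of the
  integrand is at most \<open>exp (\<eta> * \<bar>t\<bar>) * exp (- (\<eta> - \<epsilon>) * \<bar>t - \<tau>\<bar>)\<close>, whose integral is bounded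
  uniformly in the length of the interval.
\<close>

lemma v_from_zero_bound:
  assumes K: "\<And>s x. x \<in> E \<Longrightarrow> norm (Q s x) \<le> K * exp (\<epsilon> * \<bar>s\<bar>) * norm x" and "0 \<le> K" and \<epsilon>: "\<epsilon> < \<eta>"
  shows "norm (v (H 0) t) \<le> K * Y / (\<eta> - \<epsilon>) * exp (\<eta> * \<bar>t\<bar>)"
proof -
  have bound: "norm (Q s (y \<tau>)) \<le> (K * Y * exp (\<eta> * \<bar>t\<bar>)) * exp (- (\<eta> - \<epsilon>) * \<sigma>)"
    if "\<bar>s\<bar> = \<sigma>" "\<bar>\<tau>\<bar> = \<bar>t\<bar> - \<sigma>" for s \<tau> \<sigma>
  proof -
    have "norm (Q s (y \<tau>)) \<le> K * exp (\<epsilon> * \<sigma>) * norm (y \<tau>)" using K[OF y_mem, of s \<tau>] that by simp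
    also have "\<dots> \<le> K * exp (\<epsilon> * \<sigma>) * (Y * exp (\<eta> * (\<bar>t\<bar> - \<sigma>)))"
      using y_bound[of \<tau>] that \<open>0 \<le> K\<close> by (intro mult_left_mono) auto
    also have "\<dots> = K * Y * (exp (\<epsilon> * \<sigma>) * exp (\<eta> * (\<bar>t\<bar> - \<sigma>)))" by simp
    also have "exp (\<epsilon> * \<sigma>) * exp (\<eta> * (\<bar>t\<bar> - \<sigma>)) = exp (\<eta> * \<bar>t\<bar>) * exp (- (\<eta> - \<epsilon>) * \<sigma>)"
      unfolding exp_add[symmetric] by (simp add: algebra_simps)
    finally show ?thesis by simp
  qed
  have C: "0 \<le> K * Y * exp (\<eta> * \<bar>t\<bar>)" using \<open>0 \<le> K\<close> Y_nonneg by simp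
  show ?thesis
  proof (cases "0 \<le> t")
    case True
    have "v (H 0) t = integral {0..t} (\<lambda>\<tau>. Q (t - \<tau>) (y \<tau>))" by (simp add: v_def Q_H[OF True])
    also have "\<dots> = integral {0..t} (\<lambda>\<sigma>. Q \<sigma> (y (t - \<sigma>)))"
      using integral_reflect_shift[of 0 t "\<lambda>\<sigma>. Q \<sigma> (y (t - \<sigma>))" t] by simp
    also have "norm \<dots> \<le> K * Y * exp (\<eta> * \<bar>t\<bar>) * exp (- (\<eta> - \<epsilon>) * 0) / (\<eta> - \<epsilon>)"
    proof (rule integral_exp_bound[OF _ _ C])
      show "continuous_on {0..t} (\<lambda>\<sigma>. Q \<sigma> (y (t - \<sigma>)))"
        using continuous_on_compose2[OF kernel_cont[of UNIV t], of "{0..t}" "\<lambda>\<sigma>. t - \<sigma>"]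
        by (simp add: continuous_intros)
    qed (use \<epsilon> True bound in auto)
    finally show ?thesis by (simp add: mult.commute)
  next
    case False
    then have t: "t \<le> 0" by simp
    have "v (H 0) t = - Q t (H 0 - H t)" by (simp add: v_def blinfun.diff_right)
    also have "\<dots> = - integral {t..0} (\<lambda>\<tau>. Q (t - \<tau>) (y \<tau>))" by (simp add: Q_H[OF t])
    also have "\<dots> = - integral {0..- t} (\<lambda>\<sigma>. Q (- \<sigma>) (y (\<sigma> + t)))"
      using integral_shift_real_ivl[of t t 0 "\<lambda>\<tau>. Q (t - \<tau>) (y \<tau>)"] by simp
    finally have "norm (v (H 0) t) = norm (integral {0..- t} (\<lambda>\<sigma>. Q (- \<sigma>) (y (\<sigma> + t))))" by simp
    also have "\<dots> \<le> K * Y * exp (\<eta> * \<bar>t\<bar>) * exp (- (\<eta> - \<epsilon>) * 0) / (\<eta> - \<epsilon>)"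
    proof (rule integral_exp_bound[OF _ _ C])
      show "continuous_on {0..- t} (\<lambda>\<sigma>. Q (- \<sigma>) (y (\<sigma> + t)))"
        using continuous_on_compose2[OF kernel_cont[of UNIV t], of "{0..- t}" "\<lambda>\<sigma>. \<sigma> + t"]
        by (simp add: continuous_intros)
    qed (use \<epsilon> t bound in auto)
    finally show ?thesis by (simp add: mult.commute)
  qed
qed

text \<open>
  The group decays backwards in time faster than the forcing grows, so \<open>H\<close> has a limit at infinity.
  With this limit as constant \<open>h\<close>, the vector \<open>- v h t\<close> is the integral from \<open>t\<close> to infinity.
\<close>

lemma v_from_infinity:
  assumes K: "\<And>s x. s \<le> 0 \<Longrightarrow> x \<in> E \<Longrightarrow> norm (Q s x) \<le> K * exp (\<beta> * s) * norm x" and K0: "0 \<le> K" and \<beta>: "\<eta> < \<beta>"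
  obtains h where
    "\<And>t. integral_in_j T \<infinity> (ereal t) (group_integrand T l P f t)"
    "\<And>t. j_inv_integral T \<infinity> (ereal t) (group_integrand T l P f t) = v h t"
    "\<And>t. norm (v h t) \<le> K * Y / (\<beta> - \<eta>) * exp (\<eta> * \<bar>t\<bar>)"
proof -
  define r where "r t \<sigma> = Q (- \<sigma>) (y (\<sigma> + t))" for t \<sigma>
  have r_cont: "continuous_on I (r t)" for t I
    using continuous_on_compose2[OF kernel_cont[of UNIV t], of I "\<lambda>\<sigma>. \<sigma> + t"]
    by (simp add: r_def[abs_def] continuous_intros)
  have r_int: "integral {0..u} (r t) = Q t (H (u + t) - H t)" if "0 \<le> u" for t u
    using integral_shift_real_ivl[of t t "u + t" "\<lambda>\<tau>. Q (t - \<tau>) (y \<tau>)"] Q_H[of t "u + t" t] that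
    by (simp add: r_def[abs_def])
  have r_le: "norm (r t \<sigma>) \<le> (K * Y * exp (\<eta> * \<bar>t\<bar>)) * exp (- (\<beta> - \<eta>) * \<sigma>)" if \<sigma>: "0 \<le> \<sigma>" for t \<sigma>
  proof -
    have "norm (r t \<sigma>) \<le> K * exp (\<beta> * (- \<sigma>)) * norm (y (\<sigma> + t))"
      unfolding r_def using \<sigma> by (intro K y_mem) simp
    also have "\<dots> \<le> K * exp (\<beta> * (- \<sigma>)) * (Y * exp (\<eta> * (\<bar>t\<bar> + \<sigma>)))"
    proof (intro mult_left_mono order_trans[OF y_bound])
      show "exp (\<eta> * \<bar>\<sigma> + t\<bar>) \<le> exp (\<eta> * (\<bar>t\<bar> + \<sigma>))"
        using \<eta>_pos \<sigma> by (simp add: mult_left_mono)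
    qed (use K0 Y_nonneg in auto)
    also have "\<dots> = K * Y * (exp (\<beta> * (- \<sigma>)) * exp (\<eta> * (\<bar>t\<bar> + \<sigma>)))" by simp
    also have "exp (\<beta> * (- \<sigma>)) * exp (\<eta> * (\<bar>t\<bar> + \<sigma>)) = exp (\<eta> * \<bar>t\<bar>) * exp (- (\<beta> - \<eta>) * \<sigma>)"
      unfolding exp_add[symmetric] by (simp add: algebra_simps)
    finally show ?thesis by simp
  qed
  have C: "0 \<le> K * Y * exp (\<eta> * \<bar>t\<bar>)" for t using K0 Y_nonneg by simp
  have \<delta>: "\<beta> - \<eta> > 0" using \<beta> by simp
  let ?lim = "\<lambda>t L. ((\<lambda>u. integral {0..u} (r t)) \<longlongrightarrow> L) at_top \<and>
    norm L \<le> K * Y * exp (\<eta> * \<bar>t\<bar>) / (\<beta> - \<eta>) \<and>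
    (\<forall>x' :: 'a \<Rightarrow>\<^sub>L real. (\<lambda>\<sigma>. x' (r t \<sigma>)) absolutely_integrable_on {0..} \<and>
      integral {0..} (\<lambda>\<sigma>. x' (r t \<sigma>)) = x' L)"
  have "\<forall>t. \<exists>L. ?lim t L"
  proof
    fix t
    show "\<exists>L. ?lim t L"
      by (rule improper_integral_exp_bound[OF r_cont[of "{0..}" t] \<delta> C r_le]) (assumption, blast)
  qed
  from choice[OF this] obtain L where L0: "\<And>t. ?lim t (L t)" by blast
  have L: "\<And>t. ((\<lambda>u. integral {0..u} (r t)) \<longlongrightarrow> L t) at_top"
    "\<And>t. norm (L t) \<le> K * Y * exp (\<eta> * \<bar>t\<bar>) / (\<beta> - \<eta>)"
    "\<And>t (x' :: 'a \<Rightarrow>\<^sub>L real). (\<lambda>\<sigma>. x' (r t \<sigma>)) absolutely_integrable_on {0..}"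
    "\<And>t (x' :: 'a \<Rightarrow>\<^sub>L real). integral {0..} (\<lambda>\<sigma>. x' (r t \<sigma>)) = x' (L t)"
    by (use L0 in blast)+
  define h where "h = H 0 + L 0"
  have H_lim: "(H \<longlongrightarrow> h) at_top"
  proof -
    have "((\<lambda>u. H 0 + integral {0..u} (r 0)) \<longlongrightarrow> h) at_top"
      unfolding h_def by (intro tendsto_intros L(1))
    moreover have "\<forall>\<^sub>F u in at_top. H 0 + integral {0..u} (r 0) = H u"
      using eventually_ge_at_top[of 0]
      by eventually_elim (use H_diff in \<open>simp add: r_def[abs_def] algebra_simps\<close>)
    ultimately show ?thesis by (rule Lim_transform_eventually)
  qed
  have L_eq: "L t = - v h t" for t
  proof -
    have "filterlim (\<lambda>u. u + t) at_top at_top"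
      using filterlim_tendsto_add_at_top[OF tendsto_const[of t] filterlim_ident] by (simp add: add.commute)
    then have "((\<lambda>u. H (u + t)) \<longlongrightarrow> h) at_top" by (rule filterlim_compose[OF H_lim])
    then have "((\<lambda>u. Q t (H (u + t) - H t)) \<longlongrightarrow> Q t (h - H t)) at_top"
      by (intro tendsto_intros)
    moreover have "\<forall>\<^sub>F u in at_top. Q t (H (u + t) - H t) = integral {0..u} (r t)"
      using eventually_ge_at_top[of 0] by eventually_elim (simp add: r_int)
    ultimately have "((\<lambda>u. integral {0..u} (r t)) \<longlongrightarrow> Q t (h - H t)) at_top"
      by (rule Lim_transform_eventually)
    with L(1) have "L t = Q t (h - H t)" by (rule tendsto_unique[OF trivial_limit_at_top_linorder])
    then show ?thesis by (simp add: v_def blinfun.diff_right)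
  qed
  have int: "interval_lebesgue_integrable lebesgue \<infinity> (ereal t) (\<lambda>\<tau>. x' (Q (t - \<tau>) (y \<tau>)))"
    "interval_lebesgue_integral lebesgue \<infinity> (ereal t) (\<lambda>\<tau>. x' (Q (t - \<tau>) (y \<tau>))) = x' (v h t)"
    for t and x' :: "'a \<Rightarrow>\<^sub>L real"
    using interval_integral_from_infinity[OF L(3)[of x' t], of t] L(4)[of x' t]
    by (simp_all add: r_def L_eq blinfun.minus_right)
  show ?thesis
  proof (rule that)
    show "integral_in_j T \<infinity> (ereal t) (group_integrand T l P f t)"
      "j_inv_integral T \<infinity> (ereal t) (group_integrand T l P f t) = v h t" for t
      by (rule weak_integral_eq; simp add: group_integrand_apply int)+
    show "norm (v h t) \<le> K * Y / (\<beta> - \<eta>) * exp (\<eta> * \<bar>t\<bar>)" for t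
      using L(2)[of t] by (simp add: L_eq)
  qed
qed

end

section \<open>The decaying part\<close>

lemma dual_norm_triangle:
  assumes S: "subspace S" and d: "\<phi> - \<psi> \<in> dual_on S" "\<psi> \<in> dual_on S"
  shows "dual_norm S \<phi> \<le> dual_norm S (\<phi> - \<psi>) + dual_norm S \<psi>"
proof (rule dual_norm_le[OF S])
  show "0 \<le> dual_norm S (\<phi> - \<psi>) + dual_norm S \<psi>"
    using dual_norm_nonneg[OF d(1) S] dual_norm_nonneg[OF d(2) S] by simp
  fix x assume x: "x \<in> S"
  have "\<bar>\<phi> x\<bar> \<le> \<bar>(\<phi> - \<psi>) x\<bar> + \<bar>\<psi> x\<bar>" by simp
  then show "\<bar>\<phi> x\<bar> \<le> (dual_norm S (\<phi> - \<psi>) + dual_norm S \<psi>) * norm x"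
    using abs_le_dual_norm[OF d(1) S x] abs_le_dual_norm[OF d(2) S x] by (simp add: distrib_right)
qed

lemma dual_norm_uminus: "dual_norm S (\<psi> - \<phi>) = dual_norm S (\<phi> - \<psi>)"
  by (simp add: dual_norm_def abs_minus_commute)

lemma dual_norm_diff_le:
  assumes S: "subspace S" and d: "\<phi> \<in> dual_on S" "\<psi> \<in> dual_on S"
  shows "dual_norm S (\<phi> - \<psi>) \<le> dual_norm S \<phi> + dual_norm S \<psi>"
proof (rule dual_norm_le[OF S])
  show "0 \<le> dual_norm S \<phi> + dual_norm S \<psi>"
    using dual_norm_nonneg[OF d(1) S] dual_norm_nonneg[OF d(2) S] by simp
  fix x assume x: "x \<in> S"
  have "\<bar>(\<phi> - \<psi>) x\<bar> \<le> \<bar>\<phi> x\<bar> + \<bar>\<psi> x\<bar>" by simp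
  then show "\<bar>(\<phi> - \<psi>) x\<bar> \<le> (dual_norm S \<phi> + dual_norm S \<psi>) * norm x"
    using abs_le_dual_norm[OF d(1) S x] abs_le_dual_norm[OF d(2) S x] by (simp add: distrib_right)
qed

locale decaying_part = forcing T l f \<eta> F
  for T :: "real \<Rightarrow> 'a::banach \<Rightarrow>\<^sub>L 'a" and l f \<eta> F +
  fixes P :: "'a \<Rightarrow>\<^sub>L 'a" and K \<alpha> :: real
  assumes P_commute: "0 \<le> t \<Longrightarrow> P o\<^sub>L T t = T t o\<^sub>L P"
    and decay: "0 \<le> t \<Longrightarrow> norm (T t (P x)) \<le> K * exp (- \<alpha> * t) * norm x"
    and K_nonneg: "0 \<le> K" and \<alpha>: "\<eta> < \<alpha>"
begin

lemma adj_P_in_sun: "x' \<in> sun T \<Longrightarrow> adj P x' \<in> sun T"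
  by (rule adj_in_sun[OF P_commute])

definition g :: "real \<Rightarrow> ('a \<Rightarrow>\<^sub>L real) \<Rightarrow> real" where
  "g \<tau> = P_sun_star T P (f \<tau>)"

lemma g_cross: "g t \<in> sun_cross T l"
  unfolding g_def P_sun_star_eq by (rule dual_map_in_sun_cross[OF f_cross P_commute])

lemma g_apply: "x' \<in> sun T \<Longrightarrow> g t x' = f t (adj P x')"
  by (simp add: g_def P_sun_star_eq dual_map_def)

lemma g_lim: "((\<lambda>s. N (g s - g t)) \<longlongrightarrow> 0) (at t)"
proof (rule Lim_null_comparison)
  have "norm (N (g s - g t)) \<le> N (f s - f t) * norm P" for s
  proof -
    have 0: "0 \<le> N (f s - f t)" by (rule dual_norm_nonneg[OF f_diff_dual sun_subspace])
    have "N (g s - g t) \<le> N (f s - f t) * norm P"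
    proof (rule dual_norm_le[OF sun_subspace])
      fix x' assume x': "x' \<in> sun T"
      have "\<bar>(g s - g t) x'\<bar> = \<bar>(f s - f t) (adj P x')\<bar>" by (simp add: g_apply[OF x'])
      also have "\<dots> \<le> N (f s - f t) * norm (adj P x')"
        by (rule abs_le_dual_norm[OF f_diff_dual sun_subspace adj_P_in_sun[OF x']])
      also have "\<dots> \<le> N (f s - f t) * (norm P * norm x')" by (intro mult_left_mono norm_adj_le 0)
      finally show "\<bar>(g s - g t) x'\<bar> \<le> N (f s - f t) * norm P * norm x'" by (simp add: mult.assoc)
    qed (use 0 in simp)
    moreover have "0 \<le> N (g s - g t)"
      by (rule dual_norm_nonneg[OF dual_on_closed(3)[OF sun_subspace sun_crossD[OF g_cross] sun_crossD[OF g_cross]] sun_subspace])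
    ultimately show ?thesis by simp
  qed
  then show "\<forall>\<^sub>F s in at t. norm (N (g s - g t)) \<le> N (f s - f t) * norm P" by (rule always_eventually[OF allI])
  show "((\<lambda>s. N (f s - f t) * norm P) \<longlongrightarrow> 0) (at t)" by (rule tendsto_mult_left_zero[OF f_lim])
qed

text \<open>
  The integrand in the variable \<open>\<sigma> = t - \<tau>\<close>, so that the domain of integration does not depend
  on \<open>t\<close>
\<close>

definition q :: "real \<Rightarrow> ('a \<Rightarrow>\<^sub>L real) \<Rightarrow> real \<Rightarrow> real" where
  "q t x' \<sigma> = g (t - \<sigma>) (adj (T \<sigma>) x')"

lemma q_cont: "x' \<in> sun T \<Longrightarrow> continuous_on {0..} (q t x')"
  using continuous_on_compose2[OF continuous_on_sun_cross_orbit[OF sun_crossD[OF g_cross] g_lim, of x' t],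
      of "{0..}" "\<lambda>\<sigma>. t - \<sigma>"]
  by (force simp: q_def[abs_def] continuous_intros)

lemma norm_adj_decay:
  assumes \<sigma>: "0 \<le> \<sigma>"
  shows "norm (adj P (adj (T \<sigma>) x')) \<le> K * exp (- \<alpha> * \<sigma>) * norm x'"
proof -
  have "norm (T \<sigma> o\<^sub>L P) \<le> K * exp (- \<alpha> * \<sigma>)"
    by (rule norm_blinfun_bound) (use decay[OF \<sigma>] K_nonneg in simp_all)
  then show ?thesis unfolding adj_compose[symmetric] by (rule norm_adj_le')
qed

lemma q_apply: "x' \<in> sun T \<Longrightarrow> 0 \<le> \<sigma> \<Longrightarrow> q t x' \<sigma> = f (t - \<sigma>) (adj P (adj (T \<sigma>) x'))"
  by (simp add: q_def g_apply adj_T_in_sun)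

lemma exp_shift_le:
  assumes "0 \<le> \<sigma>"
  shows "exp (\<eta> * \<bar>t - \<sigma>\<bar>) * exp (- \<alpha> * \<sigma>) \<le> exp (\<eta> * \<bar>t\<bar>) * exp (- (\<alpha> - \<eta>) * \<sigma>)"
proof -
  have "\<eta> * \<bar>t - \<sigma>\<bar> \<le> \<eta> * (\<bar>t\<bar> + \<sigma>)" using \<eta>_pos assms by (intro mult_left_mono) auto
  then show ?thesis unfolding exp_add[symmetric] by (simp add: algebra_simps)
qed

lemma q_bound:
  assumes x': "x' \<in> sun T" and \<sigma>: "0 \<le> \<sigma>"
  shows "\<bar>q t x' \<sigma>\<bar> \<le> (F * K * exp (\<eta> * \<bar>t\<bar>)) * norm x' * exp (- (\<alpha> - \<eta>) * \<sigma>)"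
proof -
  have "\<bar>q t x' \<sigma>\<bar> \<le> F * exp (\<eta> * \<bar>t - \<sigma>\<bar>) * norm (adj P (adj (T \<sigma>) x'))"
    unfolding q_apply[OF x' \<sigma>] by (rule f_apply_adj_le[OF adj_P_in_sun[OF adj_T_in_sun[OF \<sigma> x']]])
  also have "\<dots> \<le> F * exp (\<eta> * \<bar>t - \<sigma>\<bar>) * (K * exp (- \<alpha> * \<sigma>) * norm x')"
    using F_nonneg by (intro mult_left_mono norm_adj_decay[OF \<sigma>]) simp
  also have "\<dots> = F * K * norm x' * (exp (\<eta> * \<bar>t - \<sigma>\<bar>) * exp (- \<alpha> * \<sigma>))" by simp
  also have "\<dots> \<le> F * K * norm x' * (exp (\<eta> * \<bar>t\<bar>) * exp (- (\<alpha> - \<eta>) * \<sigma>))"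
    using F_nonneg K_nonneg by (intro mult_left_mono exp_shift_le[OF \<sigma>]) simp
  finally show ?thesis by (simp add: mult_ac)
qed

lemma q_bound': "x' \<in> sun T \<Longrightarrow> 0 \<le> \<sigma> \<Longrightarrow> \<bar>q t x' \<sigma>\<bar> \<le> (F * K * exp (\<eta> * \<bar>t\<bar>) * norm x') * exp (- (\<alpha> - \<eta>) * \<sigma>)"
  using q_bound[of x' \<sigma> t] by simp

lemma \<delta>_pos: "0 < \<alpha> - \<eta>"
  using \<alpha> by simp

lemma q_integrable: "x' \<in> sun T \<Longrightarrow> q t x' absolutely_integrable_on {0..}"
  by (rule absolutely_integrable_exp_bound(1)[OF q_cont \<delta>_pos q_bound'])

lemma q_finite_integral: "x' \<in> sun T \<Longrightarrow> integral {0..u} (q t x') = integral {t - u..t} (\<lambda>\<tau>. g \<tau> (adj (T (t - \<tau>)) x'))"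
  using integral_reflect_shift[of "t - u" t "q t x'" t] by (simp add: q_def[abs_def])

lemma v_exists:
  "\<exists>z. (\<forall>x'\<in>sun T. integral {0..} (q t x') = x' z) \<and> norm z \<le> norming_const * (F * K * exp (\<eta> * \<bar>t\<bar>) / (\<alpha> - \<eta>))"
proof -
  have fin: "\<exists>z. \<forall>x'\<in>sun T. integral {0..u} (q t x') = x' z" if "0 \<le> u" for u
    using sun_cross_convolution[OF g_cross g_lim, of "t - u" t] that by (simp add: q_finite_integral)
  have C: "0 \<le> F * K * exp (\<eta> * \<bar>t\<bar>)" using F_nonneg K_nonneg by simp
  obtain z where "\<And>x'. x' \<in> sun T \<Longrightarrow> integral {0..} (q t x') = x' z"
    "norm z \<le> norming_const * (F * K * exp (\<eta> * \<bar>t\<bar>) / (\<alpha> - \<eta>))"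
    by (rule halfline_integral_in_X[where q="q t", OF q_cont \<delta>_pos C q_bound fin]) (assumption+, rule that)
  then show ?thesis by blast
qed

definition v :: "real \<Rightarrow> 'a" where
  "v t = (SOME z. (\<forall>x'\<in>sun T. integral {0..} (q t x') = blinfun_apply x' z) \<and>
    norm z \<le> norming_const * (F * K * exp (\<eta> * \<bar>t\<bar>) / (\<alpha> - \<eta>)))"

lemma v_apply: "x' \<in> sun T \<Longrightarrow> x' (v t) = integral {0..} (q t x')"
  and v_bound': "norm (v t) \<le> norming_const * (F * K * exp (\<eta> * \<bar>t\<bar>) / (\<alpha> - \<eta>))"
  using someI_ex[OF v_exists[of t], folded v_def] by auto

lemma v_bound: "norm (v t) \<le> norming_const * F * K / (\<alpha> - \<eta>) * exp (\<eta> * \<bar>t\<bar>)"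
  using v_bound'[of t] by simp

lemma v_from_minus_infinity:
  "integral_in_j T (-\<infinity>) (ereal t) (semigroup_integrand T P f t)"
  "j_inv_integral T (-\<infinity>) (ereal t) (semigroup_integrand T P f t) = v t"
proof -
  have eq: "semigroup_integrand T P f t \<tau> x' = q t x' (t - \<tau>)" if "x' \<in> sun T" for \<tau> x'
    using that by (simp add: semigroup_integrand_def T_sun_star_def dual_map_def q_def g_def)
  show "integral_in_j T (-\<infinity>) (ereal t) (semigroup_integrand T P f t)"
    "j_inv_integral T (-\<infinity>) (ereal t) (semigroup_integrand T P f t) = v t"
    by (rule weak_integral_eq[where z="v t"];
        simp add: eq v_apply interval_integral_from_minus_infinity[OF q_integrable])+
qed

lemma v_mild:
  assumes x': "x' \<in> sun T" and st: "s \<le> t"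
  shows "x' (v t) = x' (T (t - s) (v s)) + integral {s..t} (\<lambda>\<tau>. f \<tau> (adj P (adj (T (t - \<tau>)) x')))"
proof -
  define d where "d = t - s"
  have d: "0 \<le> d" using st by (simp add: d_def)
  have "x' (T d (v s)) = integral {0..} (q s (adj (T d) x'))"
    using v_apply[OF adj_T_in_sun[OF d x'], of s] by simp
  also have "\<dots> = integral {0..} (\<lambda>\<sigma>. q t x' (\<sigma> + d))"
  proof (rule integral_cong)
    fix \<sigma> :: real assume "\<sigma> \<in> {0..}"
    then have "adj (T \<sigma>) (adj (T d) x') = adj (T (\<sigma> + d)) x'" using sun.S_add[of \<sigma> d x'] d by simp
    then show "q s (adj (T d) x') \<sigma> = q t x' (\<sigma> + d)" by (simp add: q_def d_def algebra_simps)
  qed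
  also have "\<dots> = integral {d..} (q t x')" by (rule integral_shift_halfline[OF q_integrable[OF x'] d])
  finally have "x' (v t) = integral {0..d} (q t x') + x' (T d (v s))"
    using integral_halfline_split[OF q_integrable[OF x'] d, of t] v_apply[OF x', of t] by simp
  moreover have "integral {0..d} (q t x') = integral {s..t} (\<lambda>\<tau>. g \<tau> (adj (T (t - \<tau>)) x'))"
    using q_finite_integral[OF x', of d t] by (simp add: d_def)
  moreover have "\<dots> = integral {s..t} (\<lambda>\<tau>. f \<tau> (adj P (adj (T (t - \<tau>)) x')))"
    by (rule integral_cong) (simp add: g_apply adj_T_in_sun x')
  ultimately show ?thesis by (simp add: d_def)
qed

lemma N_zero: "N (f c - f c) = 0"
  using dual_norm_le[OF sun_subspace, of "f c - f c" 0] dual_norm_nonneg[OF f_diff_dual sun_subspace, of c c]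
  by simp

lemma f_tendsto:
  assumes "(u \<longlongrightarrow> c) A"
  shows "((\<lambda>s. N (f (u s) - f c)) \<longlongrightarrow> 0) A"
proof -
  have "isCont (\<lambda>s. N (f s - f c)) c"
    unfolding isCont_def N_zero by (rule f_lim)
  from isCont_tendsto_compose[OF this assms] show ?thesis by (simp only: N_zero)
qed

lemma N_diff_cont: "continuous_on UNIV (\<lambda>\<sigma>. N (f (a - \<sigma>) - f (b - \<sigma>)))"
proof -
  note S = sun_subspace
  have "((\<lambda>\<sigma>. N (f (a - \<sigma>) - f (b - \<sigma>))) \<longlongrightarrow> N (f (a - \<tau>) - f (b - \<tau>))) (at \<tau>)" for \<tau>
  proof (rule LIM_zero_cancel, rule Lim_null_comparison)
    let ?D = "\<lambda>\<sigma>. f (a - \<sigma>) - f (b - \<sigma>)"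
    have "norm (N (?D \<sigma>) - N (?D \<tau>)) \<le> N (f (a - \<sigma>) - f (a - \<tau>)) + N (f (b - \<sigma>) - f (b - \<tau>))" for \<sigma>
    proof -
      have eq: "?D \<sigma> - ?D \<tau> = (f (a - \<sigma>) - f (a - \<tau>)) - (f (b - \<sigma>) - f (b - \<tau>))" by (rule ext) simp
      have mem: "?D \<sigma> - ?D \<tau> \<in> dual_on (sun T)" "?D \<tau> - ?D \<sigma> \<in> dual_on (sun T)"
        by (intro dual_on_closed(3)[OF S] f_diff_dual)+
      have "N (?D \<sigma> - ?D \<tau>) \<le> N (f (a - \<sigma>) - f (a - \<tau>)) + N (f (b - \<sigma>) - f (b - \<tau>))"
        unfolding eq by (rule dual_norm_diff_le[OF S f_diff_dual f_diff_dual])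
      then show ?thesis
        using dual_norm_triangle[OF S mem(1) f_diff_dual] dual_norm_triangle[OF S mem(2) f_diff_dual]
          dual_norm_uminus[of "sun T" "?D \<sigma>" "?D \<tau>"] by (simp add: abs_le_iff)
    qed
    then show "\<forall>\<^sub>F \<sigma> in at \<tau>. norm (N (?D \<sigma>) - N (?D \<tau>))
        \<le> N (f (a - \<sigma>) - f (a - \<tau>)) + N (f (b - \<sigma>) - f (b - \<tau>))"
      by (rule always_eventually[OF allI])
    have "((\<lambda>\<sigma>. N (f (a - \<sigma>) - f (a - \<tau>)) + N (f (b - \<sigma>) - f (b - \<tau>))) \<longlongrightarrow> 0 + 0) (at \<tau>)"
      by (intro tendsto_add f_tendsto tendsto_diff tendsto_const tendsto_ident_at)
    then show "((\<lambda>\<sigma>. N (f (a - \<sigma>) - f (a - \<tau>)) + N (f (b - \<sigma>) - f (b - \<tau>))) \<longlongrightarrow> 0) (at \<tau>)" by simp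
  qed
  then show ?thesis by (simp add: continuous_on_def)
qed

text \<open>
  The norm of \<open>v (u n) - v t\<close> is at most a constant times the integral of the scalar function \<open>G n\<close>,
  which tends to 0 pointwise and has an exponentially decaying majorant.
\<close>

lemma v_cont: "continuous_on UNIV v"
proof -
  note S = sun_subspace
  have "continuous (at t within UNIV) v" for t
  proof (rule continuous_within_sequentiallyI)
    fix u :: "nat \<Rightarrow> real" assume u: "u \<longlonglongrightarrow> t"
    then obtain B where B: "\<And>n. \<bar>u n\<bar> \<le> B"
      using convergent_imp_Bseq[of u] by (auto simp: convergent_def Bseq_def)
    have Bt: "\<bar>t\<bar> \<le> B"
      by (rule tendsto_upperbound[OF tendsto_rabs[OF u]]) (simp_all add: B)
    define G where "G n \<sigma> = N (f (u n - \<sigma>) - f (t - \<sigma>)) * (K * exp (- \<alpha> * \<sigma>))" for n \<sigma>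
    define C where "C = 2 * F * K * exp (\<eta> * B)"
    have G0: "0 \<le> G n \<sigma>" for n \<sigma>
      using dual_norm_nonneg[OF f_diff_dual S] K_nonneg by (simp add: G_def)
    have G_le: "\<bar>G n \<sigma>\<bar> \<le> C * exp (- (\<alpha> - \<eta>) * \<sigma>)" if \<sigma>: "0 \<le> \<sigma>" for n \<sigma>
    proof -
      have le: "N (f (s - \<sigma>)) * exp (- \<alpha> * \<sigma>) \<le> F * (exp (\<eta> * B) * exp (- (\<alpha> - \<eta>) * \<sigma>))" if "\<bar>s\<bar> \<le> B" for s
      proof -
        have "N (f (s - \<sigma>)) * exp (- \<alpha> * \<sigma>) \<le> F * exp (\<eta> * \<bar>s - \<sigma>\<bar>) * exp (- \<alpha> * \<sigma>)"
          by (intro mult_right_mono f_bound) simp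
        also have "\<dots> = F * (exp (\<eta> * \<bar>s - \<sigma>\<bar>) * exp (- \<alpha> * \<sigma>))" by simp
        also have "\<dots> \<le> F * (exp (\<eta> * \<bar>s\<bar>) * exp (- (\<alpha> - \<eta>) * \<sigma>))"
          by (rule mult_left_mono[OF exp_shift_le[OF \<sigma>] F_nonneg])
        also have "\<dots> \<le> F * (exp (\<eta> * B) * exp (- (\<alpha> - \<eta>) * \<sigma>))"
          using that \<eta>_pos F_nonneg by (intro mult_left_mono mult_right_mono) auto
        finally show ?thesis .
      qed
      have "N (f (u n - \<sigma>) - f (t - \<sigma>)) \<le> N (f (u n - \<sigma>)) + N (f (t - \<sigma>))"
        by (rule dual_norm_diff_le[OF S f_dual f_dual])
      then have "N (f (u n - \<sigma>) - f (t - \<sigma>)) * exp (- \<alpha> * \<sigma>)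
          \<le> N (f (u n - \<sigma>)) * exp (- \<alpha> * \<sigma>) + N (f (t - \<sigma>)) * exp (- \<alpha> * \<sigma>)"
        unfolding distrib_right[symmetric] by (rule mult_right_mono) simp
      also have "\<dots> \<le> 2 * (F * (exp (\<eta> * B) * exp (- (\<alpha> - \<eta>) * \<sigma>)))"
        using le[OF B[of n]] le[OF Bt] by simp
      finally have "K * (N (f (u n - \<sigma>) - f (t - \<sigma>)) * exp (- \<alpha> * \<sigma>))
          \<le> K * (2 * (F * (exp (\<eta> * B) * exp (- (\<alpha> - \<eta>) * \<sigma>))))"
        using K_nonneg by (rule mult_left_mono)
      then show ?thesis using G0[of n \<sigma>] by (simp add: G_def C_def mult_ac)
    qed
    have G_cont: "continuous_on {0..} (G n)" for n
      unfolding G_def[abs_def]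
      by (intro continuous_on_mult continuous_on_subset[OF N_diff_cont] subset_UNIV continuous_intros)
    have G_int: "G n integrable_on {0..}" for n
      using absolutely_integrable_exp_bound(1)[OF G_cont \<delta>_pos G_le] by (rule set_lebesgue_integral_eq_integral(1))
    have G_lim: "(\<lambda>n. integral {0..} (G n)) \<longlonglongrightarrow> integral {0..} (\<lambda>\<sigma>::real. 0::real)"
    proof (rule dominated_convergence(2)[OF G_int])
      have "((\<lambda>\<sigma>. C * exp (- (\<alpha> - \<eta>) * \<sigma>)) has_integral C * (exp (- (\<alpha> - \<eta>) * 0) / (\<alpha> - \<eta>))) {0..}"
        by (intro has_integral_mult_right has_integral_exp_minus_to_infinity \<delta>_pos)
      then show "(\<lambda>\<sigma>. C * exp (- (\<alpha> - \<eta>) * \<sigma>)) integrable_on {0..}" by (rule has_integral_integrable)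
      show "norm (G n \<sigma>) \<le> C * exp (- (\<alpha> - \<eta>) * \<sigma>)" if "\<sigma> \<in> {0..}" for n \<sigma>
        using G_le[of \<sigma> n] that by simp
      show "(\<lambda>n. G n \<sigma>) \<longlonglongrightarrow> 0" for \<sigma>
        unfolding G_def by (intro tendsto_mult_left_zero f_tendsto tendsto_diff u tendsto_const)
    qed
    have diff: "norm (v (u n) - v t) \<le> norming_const * integral {0..} (G n)" for n
    proof (rule norm_le_of_sun)
      show "0 \<le> integral {0..} (G n)" by (rule integral_nonneg[OF G_int]) (rule G0)
      fix x' assume x': "x' \<in> sun T"
      note qi = set_lebesgue_integral_eq_integral(1)[OF q_integrable[OF x']]
      have "x' (v (u n) - v t) = integral {0..} (\<lambda>\<sigma>. q (u n) x' \<sigma> - q t x' \<sigma>)"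
        by (simp add: blinfun.diff_right v_apply[OF x'] Henstock_Kurzweil_Integration.integral_diff[OF qi qi])
      moreover have "norm (integral {0..} (\<lambda>\<sigma>. q (u n) x' \<sigma> - q t x' \<sigma>)) \<le> integral {0..} (\<lambda>\<sigma>. G n \<sigma> * norm x')"
      proof (rule integral_norm_bound_integral)
        show "(\<lambda>\<sigma>. q (u n) x' \<sigma> - q t x' \<sigma>) integrable_on {0..}" by (rule integrable_diff[OF qi qi])
        show "(\<lambda>\<sigma>. G n \<sigma> * norm x') integrable_on {0..}" by (rule integrable_on_mult_left[OF G_int])
        fix \<sigma> :: real assume "\<sigma> \<in> {0..}"
        then have \<sigma>: "0 \<le> \<sigma>" by simp
        let ?w = "adj P (adj (T \<sigma>) x')"
        have w: "?w \<in> sun T" by (intro adj_P_in_sun adj_T_in_sun \<sigma> x')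
        have "norm (q (u n) x' \<sigma> - q t x' \<sigma>) = \<bar>(f (u n - \<sigma>) - f (t - \<sigma>)) ?w\<bar>"
          by (simp add: q_apply[OF x' \<sigma>])
        also have "\<dots> \<le> N (f (u n - \<sigma>) - f (t - \<sigma>)) * norm ?w"
          by (rule abs_le_dual_norm[OF f_diff_dual S w])
        also have "\<dots> \<le> N (f (u n - \<sigma>) - f (t - \<sigma>)) * (K * exp (- \<alpha> * \<sigma>) * norm x')"
          by (intro mult_left_mono norm_adj_decay[OF \<sigma>] dual_norm_nonneg[OF f_diff_dual S])
        finally show "norm (q (u n) x' \<sigma> - q t x' \<sigma>) \<le> G n \<sigma> * norm x'" by (simp add: G_def mult.assoc)
      qed
      moreover have "integral {0..} (\<lambda>\<sigma>. G n \<sigma> * norm x') = integral {0..} (G n) * norm x'"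
        by (rule Henstock_Kurzweil_Integration.integral_mult_left)
      ultimately show "\<bar>x' (v (u n) - v t)\<bar> \<le> integral {0..} (G n) * norm x'" by simp
    qed
    have "(\<lambda>n. norming_const * integral {0..} (G n)) \<longlonglongrightarrow> norming_const * integral {0..} (\<lambda>\<sigma>::real. 0::real)"
      by (intro tendsto_mult_left G_lim)
    then have "(\<lambda>n. norming_const * integral {0..} (G n)) \<longlonglongrightarrow> 0" by simp
    then have "(\<lambda>n. v (u n) - v t) \<longlonglongrightarrow> 0"
      by (rule Lim_null_comparison[OF always_eventually[OF allI[OF diff]]])
    then show "(\<lambda>n. v (u n)) \<longlonglongrightarrow> v t" by (rule LIM_zero_cancel)
  qed
  then show ?thesis by (simp add: continuous_on_eq_continuous_within)
qed

text \<open>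
  The integrand vanishes on functionals of the form \<open>adj B x'\<close>.
\<close>

lemma v_in_kernel:
  assumes comm: "\<And>t. 0 \<le> t \<Longrightarrow> B o\<^sub>L T t = T t o\<^sub>L B" and BP: "\<And>x. B (P x) = 0"
  shows "B (v t) = 0"
proof (rule sun_separates)
  fix x' assume x': "x' \<in> sun T"
  note Bx = adj_in_sun[OF comm x']
  have "q t (adj B x') \<sigma> = 0" if \<sigma>: "\<sigma> \<in> {0..}" for \<sigma>
  proof -
    have "adj P (adj (T \<sigma>) (adj B x')) = 0"
    proof (rule blinfun_eqI)
      fix x
      have "B (T \<sigma> (P x)) = T \<sigma> (B (P x))"
        using arg_cong[OF comm[of \<sigma>], of "\<lambda>C. blinfun_apply C (P x)"] \<sigma> by simp
      then show "adj P (adj (T \<sigma>) (adj B x')) x = blinfun_apply 0 x" by (simp add: BP)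
    qed
    moreover have "f s 0 = 0" for s
      using dual_onD(3)[OF f_dual subspace_0[OF sun_subspace], of s 0] by simp
    ultimately show ?thesis using q_apply[OF Bx, of \<sigma> t] \<sigma> by simp
  qed
  then have "integral {0..} (q t (adj B x')) = integral {0..} (\<lambda>\<sigma>::real. 0::real)" by (rule integral_cong)
  then show "x' (B (v t)) = x' 0" using v_apply[OF Bx, of t] by simp
qed

end

section \<open>Functions of exponential growth\<close>

lemma nonpos_of_exp_decay:
  fixes c D \<delta> r0 :: real
  assumes "\<delta> > 0" and le: "\<And>r. r0 \<le> r \<Longrightarrow> c \<le> D * exp (- \<delta> * r)"
  shows "c \<le> 0"
proof (rule tendsto_lowerbound)
  show "((\<lambda>u. D * \<delta> * exp (- \<delta> * u) / \<delta>) \<longlongrightarrow> 0) at_top" by (rule exp_decay_tendsto[OF assms(1)])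
  show "\<forall>\<^sub>F u in at_top. c \<le> D * \<delta> * exp (- \<delta> * u) / \<delta>"
    using eventually_ge_at_top[of r0] by eventually_elim (use le assms(1) in simp)
qed simp

lemma exp_weight_le_iff: "exp (- (\<eta> * \<bar>t\<bar>)) * c \<le> C \<longleftrightarrow> c \<le> C * exp (\<eta> * \<bar>t\<bar>)" for \<eta> t c C :: real
  by (simp add: exp_minus field_simps)

lemma BC_bound:
  assumes "f \<in> BC \<eta> E n"
  shows "n (f t) \<le> BC_norm \<eta> n f * exp (\<eta> * \<bar>t\<bar>)"
proof -
  have "exp (- \<eta> * \<bar>t\<bar>) * n (f t) \<le> BC_norm \<eta> n f"
    unfolding BC_norm_def by (rule cSUP_upper) (use assms in \<open>auto simp: BC_def\<close>)
  then show ?thesis by (simp only: mult_minus_left exp_weight_le_iff)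
qed

lemma BC_normed_iff:
  fixes u :: "real \<Rightarrow> 'b::real_normed_vector"
  shows "u \<in> BC \<eta> UNIV norm \<longleftrightarrow> continuous_on UNIV u \<and> (\<exists>C. \<forall>t. norm (u t) \<le> C * exp (\<eta> * \<bar>t\<bar>))"
  unfolding BC_def bdd_above_def mult_minus_left ball_simps exp_weight_le_iff
  by (simp add: continuous_on_def tendsto_norm_zero_iff LIM_zero_iff)

lemma BC_norm_le:
  assumes "\<And>t. n (f t) \<le> C * exp (\<eta> * \<bar>t\<bar>)"
  shows "BC_norm \<eta> n f \<le> C"
  unfolding BC_norm_def by (rule cSUP_least) (simp_all only: mult_minus_left exp_weight_le_iff assms UNIV_not_empty not_False_eq_True)

lemma bounded_linear_adj: "bounded_linear (adj B)"
  by (rule bounded_linear_intro[of _ "norm B"])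
     (simp_all add: adj_linear_simps norm_adj_le mult.commute[of _ "norm B"])

context forcing
begin

text \<open>
  The sun dual separates the points of X, so the equation may be tested against its members. The
  integral in it always exists, by \<open>sun_cross_convolution\<close>.
\<close>

lemma solves_on_R_iff:
  "solves_on_R T f u \<longleftrightarrow> (\<forall>s t. s \<le> t \<longrightarrow> (\<forall>x'\<in>sun T.
     blinfun_apply x' (u t) = x' (T (t - s) (u s)) + integral {s..t} (\<lambda>\<tau>. f \<tau> (adj (T (t - \<tau>)) x'))))"
proof -
  have "integral_in_j T (ereal s) (ereal t) (\<lambda>\<tau>. T_sun_star T (t - \<tau>) (f \<tau>)) \<and>
      (u t = T (t - s) (u s) + j_inv_integral T (ereal s) (ereal t) (\<lambda>\<tau>. T_sun_star T (t - \<tau>) (f \<tau>))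
       \<longleftrightarrow> (\<forall>x'\<in>sun T. blinfun_apply x' (u t) = x' (T (t - s) (u s)) + integral {s..t} (\<lambda>\<tau>. f \<tau> (adj (T (t - \<tau>)) x'))))"
    if st: "s \<le> t" for s t
  proof -
    let ?q = "\<lambda>\<tau>. T_sun_star T (t - \<tau>) (f \<tau>)"
    obtain z where z: "\<And>x'. x' \<in> sun T \<Longrightarrow> integral {s..t} (\<lambda>\<tau>. f \<tau> (adj (T (t - \<tau>)) x')) = x' z"
      using sun_cross_convolution[OF f_cross f_lim st] by blast
    have q: "?q \<tau> x' = f \<tau> (adj (T (t - \<tau>)) x')" if "x' \<in> sun T" for \<tau> x'
      using that by (simp add: T_sun_star_def dual_map_def)
    have cont: "continuous_on {s..t} (\<lambda>\<tau>. f \<tau> (adj (T (t - \<tau>)) x'))" if "x' \<in> sun T" for x'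
      by (rule continuous_on_subset[OF continuous_on_sun_cross_orbit[OF f_dual f_lim that]]) auto
    have j: "integral_in_j T (ereal s) (ereal t) ?q" "j_inv_integral T (ereal s) (ereal t) ?q = z"
      by (rule weak_integral_eq[where z=z]; simp add: q interval_integral_Icc[OF st cont] z)+
    have "u t = T (t - s) (u s) + z \<longleftrightarrow> (\<forall>x'\<in>sun T. blinfun_apply x' (u t) = x' (T (t - s) (u s)) + x' z)"
    proof
      assume "\<forall>x'\<in>sun T. blinfun_apply x' (u t) = x' (T (t - s) (u s)) + x' z"
      then show "u t = T (t - s) (u s) + z" by (intro sun_separates) (simp add: blinfun.add_right)
    qed (simp add: blinfun.add_right)
    with j z show ?thesis by simp
  qed
  then show ?thesis unfolding solves_on_R_def by blast
qed

end

section \<open>The trichotomy\<close>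

text \<open>
  The rate \<open>\<eta> / 2\<close> on the center subspace is one choice of a rate strictly between 0 and \<open>\<eta>\<close>.
\<close>

locale trichotomy_setting = sun_resolvent T l
  + c: projected_group T l P0 X0 Q0 + h: projected_group T l Pp Xp Qp
  for T :: "real \<Rightarrow> 'a::banach \<Rightarrow>\<^sub>L 'a" and l P0 X0 Q0 Pp Xp Qp +
  fixes Pm :: "'a \<Rightarrow>\<^sub>L 'a" and K a b \<eta> :: real
  assumes Pm_commute: "0 \<le> t \<Longrightarrow> Pm o\<^sub>L T t = T t o\<^sub>L Pm"
    and decompose: "x = Pm x + P0 x + Pp x"
    and P0_Pm: "P0 (Pm x) = 0" and P0_Xp: "x \<in> Xp \<Longrightarrow> P0 x = 0"
    and decay: "0 \<le> t \<Longrightarrow> norm (T t (Pm x)) \<le> K * exp (a * t) * norm x"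
    and center: "x \<in> X0 \<Longrightarrow> norm (Q0 t x) \<le> K * exp (\<eta> / 2 * \<bar>t\<bar>) * norm x"
    and unstable: "t \<le> 0 \<Longrightarrow> x \<in> Xp \<Longrightarrow> norm (Qp t x) \<le> K * exp (b * t) * norm x"
    and K_nonneg: "0 \<le> K" and \<eta>: "0 < \<eta>" "\<eta> < - a" "\<eta> < b"
begin

abbreviation K_map :: "(real \<Rightarrow> ('a \<Rightarrow>\<^sub>L real) \<Rightarrow> real) \<Rightarrow> real \<Rightarrow> 'a" where
  "K_map \<equiv> K_op T l Pm P0 Pp"

abbreviation BC_cross :: "(real \<Rightarrow> ('a \<Rightarrow>\<^sub>L real) \<Rightarrow> real) set" where
  "BC_cross \<equiv> BC \<eta> (sun_cross T l) (sun_star_norm T)"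

abbreviation cross_norm :: "(real \<Rightarrow> ('a \<Rightarrow>\<^sub>L real) \<Rightarrow> real) \<Rightarrow> real" where
  "cross_norm \<equiv> BC_norm \<eta> (sun_star_norm T)"

definition K_bound :: real where
  "K_bound = K * norming_const * norm P0 / (\<eta> - \<eta> / 2) + K * norming_const * norm Pp / (b - \<eta>)
     + norming_const * K / (- a - \<eta>)"

text \<open>
  Each of the three terms solves the equation for the correspondingly projected forcing, and the
  adjoint projectors add up to the identity of the sun dual.
\<close>

lemma K_map_properties:
  assumes "forcing T l f \<eta> F"
  shows "K_defined T l Pm P0 Pp f t"
    and "continuous_on UNIV (K_map f)"
    and "norm (K_map f t) \<le> K_bound * F * exp (\<eta> * \<bar>t\<bar>)"
    and "solves_on_R T f (K_map f)"
    and "P0 (K_map f 0) = 0"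
proof -
  interpret forcing T l f \<eta> F by fact
  interpret cp: group_part T l f \<eta> F P0 X0 Q0 by unfold_locales
  interpret hp: group_part T l f \<eta> F Pp Xp Qp by unfold_locales
  interpret dm: decaying_part T l f \<eta> F Pm K "- a"
    by unfold_locales (use Pm_commute decay K_nonneg \<eta> in simp_all)
  obtain h where h:
    "\<And>t. integral_in_j T \<infinity> (ereal t) (group_integrand T l Pp f t)"
    "\<And>t. j_inv_integral T \<infinity> (ereal t) (group_integrand T l Pp f t) = hp.v h t"
    "\<And>t. norm (hp.v h t) \<le> K * hp.Y / (b - \<eta>) * exp (\<eta> * \<bar>t\<bar>)"
    by (rule hp.v_from_infinity[of K b, OF unstable K_nonneg \<eta>(3)]) (assumption+, rule that)
  show "K_defined T l Pm P0 Pp f t"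
    unfolding K_defined_def by (intro conjI cp.v_from_zero(1) h(1) dm.v_from_minus_infinity(1))
  have K_map: "K_map f t = cp.v (cp.H 0) t + hp.v h t + dm.v t" for t
    by (simp add: K_op_def cp.v_from_zero(2) h(2) dm.v_from_minus_infinity(2))
  show "continuous_on UNIV (K_map f)"
    unfolding K_map[abs_def] by (intro continuous_on_add cp.v_cont hp.v_cont dm.v_cont)
  have "norm (K_map f t) \<le> norm (cp.v (cp.H 0) t) + norm (hp.v h t) + norm (dm.v t)"
    unfolding K_map by (intro order_trans[OF norm_triangle_ineq] add_right_mono norm_triangle_ineq)
  also have "\<dots> \<le> K * cp.Y / (\<eta> - \<eta> / 2) * exp (\<eta> * \<bar>t\<bar>) + K * hp.Y / (b - \<eta>) * exp (\<eta> * \<bar>t\<bar>)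
      + norming_const * F * K / (- a - \<eta>) * exp (\<eta> * \<bar>t\<bar>)"
  proof (intro add_mono h(3) dm.v_bound)
    show "norm (cp.v (cp.H 0) t) \<le> K * cp.Y / (\<eta> - \<eta> / 2) * exp (\<eta> * \<bar>t\<bar>)"
      by (rule cp.v_from_zero_bound[OF center K_nonneg]) (use \<eta> in simp_all)
  qed
  also have "\<dots> = K_bound * F * exp (\<eta> * \<bar>t\<bar>)"
    by (simp add: K_bound_def cp.Y_def hp.Y_def distrib_right distrib_left mult_ac)
  finally show "norm (K_map f t) \<le> K_bound * F * exp (\<eta> * \<bar>t\<bar>)" .
  show "solves_on_R T f (K_map f)"
    unfolding solves_on_R_iff
  proof (intro allI impI ballI)
    fix s t :: real and x' assume st: "s \<le> t" and x': "x' \<in> sun T"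
    let ?f = "\<lambda>P \<tau>. f \<tau> (adj P (adj (T (t - \<tau>)) x'))"
    have int: "?f P integrable_on {s..t}" if "\<And>u. u \<in> sun T \<Longrightarrow> adj P u \<in> sun T" for P
    proof (rule integrable_continuous_interval, rule continuous_on_dual_apply[OF sun_subspace f_dual f_lim])
      have "continuous_on {s..t} (\<lambda>\<tau>. adj (T (t - \<tau>)) x')"
        by (rule continuous_on_compose2[OF sun.continuous_orbit[OF x']]) (auto intro!: continuous_intros)
      then show "continuous_on {s..t} (\<lambda>\<tau>. adj P (adj (T (t - \<tau>)) x'))"
        by (rule bounded_linear.continuous_on[OF bounded_linear_adj])
      show "(\<lambda>\<tau>. adj P (adj (T (t - \<tau>)) x')) ` {s..t} \<subseteq> sun T"
        by (auto intro!: that adj_T_in_sun x')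
    qed
    note i = int[OF dm.adj_P_in_sun] int[OF c.adj_P_in_sun] int[OF h.adj_P_in_sun]
    have "integral {s..t} (\<lambda>\<tau>. f \<tau> (adj (T (t - \<tau>)) x')) = integral {s..t} (\<lambda>\<tau>. ?f P0 \<tau> + ?f Pp \<tau> + ?f Pm \<tau>)"
    proof (rule integral_cong)
      fix \<tau> assume "\<tau> \<in> {s..t}"
      then have w: "adj (T (t - \<tau>)) x' \<in> sun T" by (intro adj_T_in_sun x') simp
      let ?w = "adj (T (t - \<tau>)) x'"
      have "?w = adj P0 ?w + adj Pp ?w + adj Pm ?w"
      proof (rule blinfun_eqI)
        fix x
        have "?w x = ?w (Pm x + P0 x + Pp x)" using decompose[of x] by simp
        then show "?w x = (adj P0 ?w + adj Pp ?w + adj Pm ?w) x"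
          by (simp add: blinfun.add_right blinfun.add_left)
      qed
      also have "f \<tau> \<dots> = ?f P0 \<tau> + ?f Pp \<tau> + ?f Pm \<tau>"
        using c.adj_P_in_sun[OF w] h.adj_P_in_sun[OF w] dm.adj_P_in_sun[OF w]
        by (simp add: dual_onD(2)[OF f_dual] subspace_add[OF sun_subspace])
      finally show "f \<tau> ?w = ?f P0 \<tau> + ?f Pp \<tau> + ?f Pm \<tau>" .
    qed
    also have "\<dots> = integral {s..t} (?f P0) + integral {s..t} (?f Pp) + integral {s..t} (?f Pm)"
      using i by (simp add: Henstock_Kurzweil_Integration.integral_add integrable_add)
    finally show "x' (K_map f t) = x' (T (t - s) (K_map f s)) + integral {s..t} (\<lambda>\<tau>. f \<tau> (adj (T (t - \<tau>)) x'))"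
      using cp.v_mild[OF x' st, of "cp.H 0"] hp.v_mild[OF x' st, of h] dm.v_mild[OF x' st]
      by (simp add: K_map blinfun.add_right)
  qed
  have "P0 (hp.v h 0) = 0" unfolding hp.v_def by (rule P0_Xp[OF h.Q_mem])
  moreover have "P0 (dm.v 0) = 0" by (rule dm.v_in_kernel[OF c.P_commute P0_Pm])
  ultimately show "P0 (K_map f 0) = 0" by (simp add: K_map cp.v_zero blinfun.add_right)
qed

text \<open>
  The center component is 0 at time 0, hence at later times by the semigroup law and at earlier times
  by injectivity. The unstable component at \<open>t\<close> is a backward image of the one at a late time \<open>s\<close>,
  the decaying component a forward image of the one at an early time \<open>- r\<close>. Since \<open>\<eta>\<close> is smaller
  than both rates, the estimates tend to 0 as \<open>s\<close> and \<open>r\<close> tend to infinity.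
\<close>

lemma bounded_orbit_unique:
  assumes orbit: "\<And>s t. s \<le> t \<Longrightarrow> w t = T (t - s) (w s)"
    and bound: "\<And>t. norm (w t) \<le> C * exp (\<eta> * \<bar>t\<bar>)" and w0: "P0 (w 0) = 0"
  shows "w t = 0"
proof -
  have C: "0 \<le> C" using order_trans[OF norm_ge_zero bound[of 0]] by simp
  have comm: "P (w t) = T (t - s) (P (w s))"
    if "s \<le> t" and P: "\<And>r. 0 \<le> r \<Longrightarrow> P o\<^sub>L T r = T r o\<^sub>L P" for P s t
    using orbit[OF that(1)] arg_cong[OF P[of "t - s"], of "\<lambda>C. blinfun_apply C (w s)"] that(1) by simp
  have "P0 (w t) = 0"
  proof (cases "0 \<le> t")
    case True
    then show ?thesis using comm[OF True c.P_commute] w0 by simp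
  next
    case False
    then have "P0 (w 0) = T (- t) (P0 (w t))" using comm[of t 0 P0] c.P_commute by simp
    then show ?thesis using c.Q_T_inverse[OF c.P_mem, of t "w t"] False w0 by simp
  qed
  moreover have "Pp (w t) = 0"
  proof -
    have "norm (Pp (w t)) \<le> (K * norm Pp * C * exp (b * t)) * exp (- (b - \<eta>) * s)" if s: "max t 0 \<le> s" for s
    proof -
      have "Pp (w t) = Qp (t - s) (Pp (w s))"
        using comm[of t s Pp] h.P_commute s h.Q_T_inverse[OF h.P_mem, of "t - s" "w t"] by simp
      also have "norm \<dots> \<le> K * exp (b * (t - s)) * norm (Pp (w s))"
        using s by (intro unstable h.P_mem) simp
      also have "\<dots> \<le> K * exp (b * (t - s)) * (norm Pp * (C * exp (\<eta> * s)))"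
        using s bound[of s] K_nonneg
        by (intro mult_left_mono order_trans[OF norm_blinfun mult_left_mono[OF _ norm_ge_zero]]) auto
      also have "\<dots> = K * norm Pp * C * (exp (b * (t - s)) * exp (\<eta> * s))" by simp
      also have "exp (b * (t - s)) * exp (\<eta> * s) = exp (b * t) * exp (- (b - \<eta>) * s)"
        unfolding exp_add[symmetric] by (simp add: algebra_simps)
      finally show ?thesis by simp
    qed
    from nonpos_of_exp_decay[where \<delta>="b - \<eta>" and ?r0.0="max t 0", OF _ this] show ?thesis using \<eta> by simp
  qed
  moreover have "Pm (w t) = 0"
  proof -
    have "norm (Pm (w t)) \<le> (K * C * exp (a * t)) * exp (- (- a - \<eta>) * r)" if r: "max (- t) 0 \<le> r" for r
    proof -
      have "T (t + r) (w (- r)) = w t" using orbit[of "- r" t] r by simp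
      then have "Pm (w t) = T (t + r) (Pm (w (- r)))"
        using comm[of "- r" t Pm] Pm_commute r by simp
      also have "norm \<dots> \<le> K * exp (a * (t + r)) * norm (w (- r))"
        using r by (intro decay) simp
      also have "\<dots> \<le> K * exp (a * (t + r)) * (C * exp (\<eta> * r))"
        using r bound[of "- r"] K_nonneg by (intro mult_left_mono) auto
      also have "\<dots> = K * C * (exp (a * (t + r)) * exp (\<eta> * r))" by simp
      also have "exp (a * (t + r)) * exp (\<eta> * r) = exp (a * t) * exp (- (- a - \<eta>) * r)"
        unfolding exp_add[symmetric] by (simp add: algebra_simps)
      finally show ?thesis by simp
    qed
    from nonpos_of_exp_decay[where \<delta>="- a - \<eta>" and ?r0.0="max (- t) 0", OF _ this] show ?thesis using \<eta> by simp
  qed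
  ultimately show ?thesis using decompose[of "w t"] by simp
qed

lemma forcing_of_BC:
  assumes f: "f \<in> BC_cross"
  shows "forcing T l f \<eta> (cross_norm f)"
proof unfold_locales
  have f_cross: "f t \<in> sun_cross T l" for t using f by (simp add: BC_def)
  then show "f t \<in> sun_cross T l" for t .
  show "((\<lambda>s. dual_norm (sun T) (f s - f t)) \<longlongrightarrow> 0) (at t)" for t
    using f by (simp add: BC_def sun_star_norm_def)
  show le: "dual_norm (sun T) (f t) \<le> cross_norm f * exp (\<eta> * \<bar>t\<bar>)" for t
    using BC_bound[OF f, of t] by (simp add: sun_star_norm_def)
  show "0 \<le> cross_norm f"
    using order_trans[OF dual_norm_nonneg[OF sun_crossD[OF f_cross] sun_subspace] le[of 0]] by simp
qed (rule \<eta>(1))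

lemma K_map_in_BC:
  assumes "f \<in> BC_cross"
  shows "K_map f \<in> BC \<eta> UNIV norm"
  using K_map_properties(2,3)[OF forcing_of_BC[OF assms]] by (auto simp: BC_normed_iff)

lemma K_map_unique:
  assumes f: "f \<in> BC_cross"
    and u: "u \<in> BC \<eta> UNIV norm" "solves_on_R T f u" "P0 (u 0) = 0"
  shows "u = K_map f"
proof
  fix t
  note props = K_map_properties[OF forcing_of_BC[OF f]]
  interpret forcing T l f \<eta> "cross_norm f" by (rule forcing_of_BC[OF f])
  define w where "w t = u t - K_map f t" for t
  obtain C where C: "\<And>t. norm (u t) \<le> C * exp (\<eta> * \<bar>t\<bar>)" using u(1) by (auto simp: BC_normed_iff)
  have "w t = 0"
  proof (rule bounded_orbit_unique)
    show "P0 (w 0) = 0" using u(3) props(5) by (simp add: w_def blinfun.diff_right)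
    show "norm (w t) \<le> (C + K_bound * cross_norm f) * exp (\<eta> * \<bar>t\<bar>)" for t
      using norm_triangle_ineq4[of "u t" "K_map f t"] C[of t] props(3)[of t] by (simp add: w_def distrib_right)
    show "w t = T (t - s) (w s)" if st: "s \<le> t" for s t
    proof -
      have "v t = T (t - s) (v s) + j_inv_integral T (ereal s) (ereal t) (\<lambda>\<tau>. T_sun_star T (t - \<tau>) (f \<tau>))"
        if "solves_on_R T f v" for v
        using that st unfolding solves_on_R_def by blast
      from this[OF u(2)] this[OF props(4)] show ?thesis
        by (simp add: w_def blinfun.diff_right)
    qed
  qed
  then show "u t = K_map f t" by (simp add: w_def)
qed

lemma BC_cross_add_scale:
  assumes f: "f \<in> BC_cross" and g: "g \<in> BC_cross"
  shows "(\<lambda>\<tau> x. p * f \<tau> x + r * g \<tau> x) \<in> BC_cross"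
proof -
  let ?N = "dual_norm (sun T)"
  interpret f: forcing T l f \<eta> "cross_norm f" by (rule forcing_of_BC[OF f])
  interpret g: forcing T l g \<eta> "cross_norm g" by (rule forcing_of_BC[OF g])
  let ?h = "\<lambda>\<tau> x. p * f \<tau> x + r * g \<tau> x"
  have cross: "?h t \<in> sun_cross T l" for t
    by (intro sun_cross_add_scale[of _ "f t"] sun_cross_add_scale(1) sun_cross_add_scale(2) f.f_cross g.f_cross)
  have comb: "?N (\<lambda>x. p * \<phi> x + r * \<psi> x) \<le> \<bar>p\<bar> * ?N \<phi> + \<bar>r\<bar> * ?N \<psi>"
    if d: "\<phi> \<in> dual_on (sun T)" "\<psi> \<in> dual_on (sun T)" for \<phi> \<psi>
  proof (rule dual_norm_le[OF sun_subspace])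
    show "0 \<le> \<bar>p\<bar> * ?N \<phi> + \<bar>r\<bar> * ?N \<psi>"
      using dual_norm_nonneg[OF d(1) sun_subspace] dual_norm_nonneg[OF d(2) sun_subspace] by simp
    fix x assume x: "x \<in> sun T"
    have "\<bar>p * \<phi> x + r * \<psi> x\<bar> \<le> \<bar>p\<bar> * \<bar>\<phi> x\<bar> + \<bar>r\<bar> * \<bar>\<psi> x\<bar>"
      by (rule order_trans[OF abs_triangle_ineq]) (simp add: abs_mult)
    also have "\<dots> \<le> \<bar>p\<bar> * (?N \<phi> * norm x) + \<bar>r\<bar> * (?N \<psi> * norm x)"
      by (intro add_mono mult_left_mono abs_le_dual_norm[OF d(1) sun_subspace x] abs_le_dual_norm[OF d(2) sun_subspace x]) auto
    finally show "\<bar>p * \<phi> x + r * \<psi> x\<bar> \<le> (\<bar>p\<bar> * ?N \<phi> + \<bar>r\<bar> * ?N \<psi>) * norm x" by (simp add: algebra_simps)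
  qed
  have lim: "((\<lambda>s. ?N (?h s - ?h t)) \<longlongrightarrow> 0) (at t)" for t
  proof (rule Lim_null_comparison)
    have "norm (?N (?h s - ?h t)) \<le> \<bar>p\<bar> * ?N (f s - f t) + \<bar>r\<bar> * ?N (g s - g t)" for s
    proof -
      have "?h s - ?h t = (\<lambda>x. p * (f s - f t) x + r * (g s - g t) x)"
        by (rule ext) (simp add: algebra_simps)
      moreover have "0 \<le> ?N (?h s - ?h t)"
        by (rule dual_norm_nonneg[OF dual_on_closed(3)[OF sun_subspace sun_crossD[OF cross] sun_crossD[OF cross]] sun_subspace])
      ultimately show ?thesis using comb[OF f.f_diff_dual[of s t] g.f_diff_dual[of s t]] by simp
    qed
    then show "\<forall>\<^sub>F s in at t. norm (?N (?h s - ?h t)) \<le> \<bar>p\<bar> * ?N (f s - f t) + \<bar>r\<bar> * ?N (g s - g t)"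
      by (rule always_eventually[OF allI])
    show "((\<lambda>s. \<bar>p\<bar> * ?N (f s - f t) + \<bar>r\<bar> * ?N (g s - g t)) \<longlongrightarrow> 0) (at t)"
      by (intro tendsto_add_zero tendsto_mult_right_zero f.f_lim g.f_lim)
  qed
  have bdd: "bdd_above (range (\<lambda>t. exp (- \<eta> * \<bar>t\<bar>) * ?N (?h t)))"
  proof (rule bdd_aboveI2)
    fix t
    have "?N (?h t) \<le> \<bar>p\<bar> * ?N (f t) + \<bar>r\<bar> * ?N (g t)" by (rule comb[OF f.f_dual g.f_dual])
    also have "\<dots> \<le> \<bar>p\<bar> * (cross_norm f * exp (\<eta> * \<bar>t\<bar>))
        + \<bar>r\<bar> * (cross_norm g * exp (\<eta> * \<bar>t\<bar>))"
      by (intro add_mono mult_left_mono f.f_bound g.f_bound) auto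
    finally show "exp (- \<eta> * \<bar>t\<bar>) * ?N (?h t)
        \<le> \<bar>p\<bar> * cross_norm f + \<bar>r\<bar> * cross_norm g"
      unfolding mult_minus_left exp_weight_le_iff by (simp add: algebra_simps)
  qed
  show ?thesis unfolding BC_def sun_star_norm_def using cross lim bdd by blast
qed

text \<open>
  The combination of the two solutions solves the equation for the combined forcing, so it is
  the image of that forcing by uniqueness.
\<close>

lemma K_map_linear:
  assumes f: "f \<in> BC_cross" and g: "g \<in> BC_cross"
  shows "K_map (\<lambda>\<tau> x. p * f \<tau> x + r * g \<tau> x) = (\<lambda>t. p *\<^sub>R K_map f t + r *\<^sub>R K_map g t)"
proof (rule K_map_unique[symmetric])
  let ?h = "\<lambda>\<tau> x. p * f \<tau> x + r * g \<tau> x" and ?u = "\<lambda>t. p *\<^sub>R K_map f t + r *\<^sub>R K_map g t"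
  note pf = K_map_properties[OF forcing_of_BC[OF f]] and pg = K_map_properties[OF forcing_of_BC[OF g]]
  show h: "?h \<in> BC_cross" by (rule BC_cross_add_scale[OF f g])
  interpret f: forcing T l f \<eta> "cross_norm f" by (rule forcing_of_BC[OF f])
  interpret g: forcing T l g \<eta> "cross_norm g" by (rule forcing_of_BC[OF g])
  interpret h: forcing T l ?h \<eta> "cross_norm ?h" by (rule forcing_of_BC[OF h])
  show "P0 (?u 0) = 0" using pf(5) pg(5) by (simp add: blinfun.add_right blinfun.scaleR_right)
  show "?u \<in> BC \<eta> UNIV norm"
    unfolding BC_normed_iff
  proof (intro conjI exI allI)
    show "continuous_on UNIV ?u" by (intro continuous_intros pf(2) pg(2))
    fix t
    have "norm (?u t) \<le> \<bar>p\<bar> * norm (K_map f t) + \<bar>r\<bar> * norm (K_map g t)"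
      by (rule order_trans[OF norm_triangle_ineq]) simp
    also have "\<dots> \<le> \<bar>p\<bar> * (K_bound * cross_norm f * exp (\<eta> * \<bar>t\<bar>))
        + \<bar>r\<bar> * (K_bound * cross_norm g * exp (\<eta> * \<bar>t\<bar>))"
      by (intro add_mono mult_left_mono pf(3) pg(3)) auto
    finally show "norm (?u t) \<le> (\<bar>p\<bar> * K_bound * cross_norm f
        + \<bar>r\<bar> * K_bound * cross_norm g) * exp (\<eta> * \<bar>t\<bar>)" by (simp add: algebra_simps)
  qed
  show "solves_on_R T ?h ?u"
    unfolding h.solves_on_R_iff
  proof (intro allI impI ballI)
    fix s t :: real and x' assume st: "s \<le> t" and x': "x' \<in> sun T"
    have cont: "continuous_on {s..t} (\<lambda>\<tau>. f \<tau> (adj (T (t - \<tau>)) x'))" "continuous_on {s..t} (\<lambda>\<tau>. g \<tau> (adj (T (t - \<tau>)) x'))"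
      by (rule continuous_on_subset[OF continuous_on_sun_cross_orbit[OF f.f_dual f.f_lim x']], force)
         (rule continuous_on_subset[OF continuous_on_sun_cross_orbit[OF g.f_dual g.f_lim x']], force)
    have "integral {s..t} (\<lambda>\<tau>. p * f \<tau> (adj (T (t - \<tau>)) x') + r * g \<tau> (adj (T (t - \<tau>)) x'))
        = p * integral {s..t} (\<lambda>\<tau>. f \<tau> (adj (T (t - \<tau>)) x')) + r * integral {s..t} (\<lambda>\<tau>. g \<tau> (adj (T (t - \<tau>)) x'))"
      by (subst Henstock_Kurzweil_Integration.integral_add)
         (simp_all add: integrable_continuous_interval continuous_on_mult_const cont continuous_on_mult)
    then show "x' (?u t) = x' (T (t - s) (?u s)) + integral {s..t} (\<lambda>\<tau>. ?h \<tau> (adj (T (t - \<tau>)) x'))"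
      using pf(4)[unfolded f.solves_on_R_iff, rule_format, OF st x']
        pg(4)[unfolded g.solves_on_R_iff, rule_format, OF st x']
      by (simp add: blinfun.add_right blinfun.scaleR_right distrib_left)
  qed
qed

end

theorem proposition30:
  fixes T :: "real \<Rightarrow> 'a::banach \<Rightarrow>\<^sub>L 'a"
    and Xm X0 Xp :: "'a set"
    and Pm P0 Pp :: "'a \<Rightarrow> 'a"
    and K :: "(real \<Rightarrow> ('a \<Rightarrow>\<^sub>L real) \<Rightarrow> real) \<Rightarrow> real \<Rightarrow> 'a"
    and BCcross :: "(real \<Rightarrow> ('a \<Rightarrow>\<^sub>L real) \<Rightarrow> real) set"
    and BCX :: "(real \<Rightarrow> 'a) set"
    and a b eta l :: real
  assumes "C0_semigroup T"
    and "l \<in> resolvent_set (generator UNIV (\<lambda>t. blinfun_apply (T t)))"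
    and "trichotomy T Xm X0 Xp a b"
    and "Pm = projector Xm X0 Xp"
    and "P0 = projector X0 Xm Xp"
    and "Pp = projector Xp Xm X0"
    and "sun_cross_part T l P0 \<subseteq> range (sun_j T)"
    and "sun_cross_part T l Pp \<subseteq> range (sun_j T)"
    and "0 < eta" and "eta < min (- a) b"
    and "K = K_op T l Pm P0 Pp"
    and "BCcross = BC eta (sun_cross T l) (sun_star_norm T)"
    and "BCX = BC eta UNIV norm"
  shows "((\<forall>f\<in>BCcross. (\<forall>t. K_defined T l Pm P0 Pp f t) \<and> K f \<in> BCX)
        \<and> (\<forall>f\<in>BCcross. \<forall>g\<in>BCcross. K (\<lambda>\<tau> x. f \<tau> x + g \<tau> x) = (\<lambda>t. K f t + K g t))
        \<and> (\<forall>c. \<forall>f\<in>BCcross. K (\<lambda>\<tau> x. c * f \<tau> x) = (\<lambda>t. c *\<^sub>R K f t))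
        \<and> (\<exists>C. \<forall>f\<in>BCcross. BC_norm eta norm (K f) \<le> C * BC_norm eta (sun_star_norm T) f))
    \<and> (\<forall>f\<in>BCcross. \<forall>u. (u \<in> BCX \<and> solves_on_R T f u \<and> P0 (u 0) = 0) \<longleftrightarrow> u = K f)"
proof -
  note tri = \<open>trichotomy T Xm X0 Xp a b\<close>[unfolded trichotomy_def]
  interpret sun_resolvent T l
    by (intro sun_resolvent.intro sun_dual.intro sun_resolvent_axioms.intro assms(1,2))
  note tri_parts = tri[THEN conjunct2, THEN conjunct2, THEN conjunct1, rule_format]
    and tri_sum = tri[THEN conjunct2, THEN conjunct2, THEN conjunct2, THEN conjunct1, rule_format]
    and tri_groups = tri[THEN conjunct2, THEN conjunct2, THEN conjunct2, THEN conjunct2]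
  have parts: "subspace E \<and> closed E" and inv: "\<And>t x. 0 \<le> t \<Longrightarrow> x \<in> E \<Longrightarrow> T t x \<in> E"
    if "E \<in> {Xm, X0, Xp}" for E
    using tri_parts[OF that] by blast+
  have ex: "\<exists>!p. p \<in> Xm \<times> X0 \<times> Xp \<and> x = fst p + fst (snd p) + snd (snd p)" for x
    by (rule tri_sum)
  have groups: "extends_to_C0_group (\<lambda>t. blinfun_apply (T t)) X0"
    "extends_to_C0_group (\<lambda>t. blinfun_apply (T t)) Xp"
    using tri_groups[THEN conjunct1] tri_groups[THEN conjunct2, THEN conjunct1] .
  obtain M where M: "M > 0" and
    Mm: "\<And>t x. 0 \<le> t \<Longrightarrow> x \<in> Xm \<Longrightarrow> norm (T t x) \<le> M * exp (a * t) * norm x" and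
    M0: "\<And>t x. x \<in> X0 \<Longrightarrow> norm (group_ext (\<lambda>t. blinfun_apply (T t)) X0 t x) \<le> M * exp (eta / 2 * \<bar>t\<bar>) * norm x" and
    Mp: "\<And>t x. t \<le> 0 \<Longrightarrow> x \<in> Xp \<Longrightarrow> norm (group_ext (\<lambda>t. blinfun_apply (T t)) Xp t x) \<le> M * exp (b * t) * norm x"
  proof -
    have "0 < eta / 2" using \<open>0 < eta\<close> by simp
    from tri_groups[THEN conjunct2, THEN conjunct2, rule_format, OF this] show ?thesis
      by (elim exE conjE) (rule that; blast)
  qed
  have sub: "subspace Xm" "subspace X0" "subspace Xp" "closed Xm" "closed X0" "closed Xp"
    using parts by auto
  obtain Bm B0 Bp :: "'a \<Rightarrow>\<^sub>L 'a" where
    B: "projector Xm X0 Xp = Bm" "projector X0 Xm Xp = B0" "projector Xp Xm X0 = Bp"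
    and B_mem: "\<And>x. Bm x \<in> Xm" "\<And>x. B0 x \<in> X0" "\<And>x. Bp x \<in> Xp"
    and B_sum: "\<And>x. x = Bm x + B0 x + Bp x"
    and B_eq: "\<And>u v w x. u \<in> Xm \<Longrightarrow> v \<in> X0 \<Longrightarrow> w \<in> Xp \<Longrightarrow> x = u + v + w \<Longrightarrow> Bm x = u \<and> B0 x = v \<and> Bp x = w"
    by (rule projectors_bounded[OF sub ex]) (rule that)
  have P: "Pm = Bm" "P0 = B0" "Pp = Bp" using assms(4-6) B by simp_all
  have zero: "0 \<in> Xm" "0 \<in> X0" "0 \<in> Xp" using sub subspace_0 by auto
  \<comment> \<open>The semigroup preserves the summands, so it maps the components of a vector to those of its image.\<close>
  have comm: "Bm o\<^sub>L T t = T t o\<^sub>L Bm" "B0 o\<^sub>L T t = T t o\<^sub>L B0" "Bp o\<^sub>L T t = T t o\<^sub>L Bp" if t: "0 \<le> t" for t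
  proof -
    have "Bm (T t x) = T t (Bm x) \<and> B0 (T t x) = T t (B0 x) \<and> Bp (T t x) = T t (Bp x)" for x
    proof (rule B_eq)
      show "T t x = T t (Bm x) + T t (B0 x) + T t (Bp x)"
        using arg_cong[OF B_sum[of x], of "T t"] by (simp only: blinfun.add_right)
    qed (use inv[OF _ t] B_mem in auto)
    then show "Bm o\<^sub>L T t = T t o\<^sub>L Bm" "B0 o\<^sub>L T t = T t o\<^sub>L B0" "Bp o\<^sub>L T t = T t o\<^sub>L Bp"
      by (auto intro!: blinfun_eqI)
  qed
  have B0_id: "B0 x = x" if "x \<in> X0" for x using B_eq[OF zero(1) that zero(3)] by simp
  have Bp_id: "Bp x = x" if "x \<in> Xp" for x using B_eq[OF zero(1,2) that] by simp
  obtain Q0 :: "real \<Rightarrow> 'a \<Rightarrow>\<^sub>L 'a" where Q0: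
    "\<And>t x. x \<in> X0 \<Longrightarrow> Q0 t x = group_ext (\<lambda>t. blinfun_apply (T t)) X0 t x"
    "\<And>t x. Q0 t x \<in> X0" "\<And>s t x. Q0 (s + t) x = Q0 s (Q0 t x)" "Q0 0 = B0"
    "\<And>t x. 0 \<le> t \<Longrightarrow> Q0 t x = T t (B0 x)" "\<And>x. continuous_on UNIV (\<lambda>t. Q0 t x)"
    "\<And>r. \<exists>M. \<forall>t. \<bar>t\<bar> \<le> r \<longrightarrow> norm (Q0 t) \<le> M"
    by (rule group_through_projector[OF T groups(1) B_mem(2) B0_id]) (assumption, rule that)
  obtain Qp :: "real \<Rightarrow> 'a \<Rightarrow>\<^sub>L 'a" where Qp:
    "\<And>t x. x \<in> Xp \<Longrightarrow> Qp t x = group_ext (\<lambda>t. blinfun_apply (T t)) Xp t x"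
    "\<And>t x. Qp t x \<in> Xp" "\<And>s t x. Qp (s + t) x = Qp s (Qp t x)" "Qp 0 = Bp"
    "\<And>t x. 0 \<le> t \<Longrightarrow> Qp t x = T t (Bp x)" "\<And>x. continuous_on UNIV (\<lambda>t. Qp t x)"
    "\<And>r. \<exists>M. \<forall>t. \<bar>t\<bar> \<le> r \<longrightarrow> norm (Qp t) \<le> M"
    by (rule group_through_projector[OF T groups(2) B_mem(3) Bp_id]) (assumption, rule that)
  \<comment> \<open>The trichotomy bounds the decay only on its subspace, the setting bounds it after the projector.\<close>
  define C where "C = max M (M * norm Bm)"
  have C: "M \<le> C" "M * norm Bm \<le> C" by (simp_all add: C_def)
  interpret trichotomy_setting T l B0 X0 Q0 Bp Xp Qp Bm C a b eta
  proof (intro trichotomy_setting.intro trichotomy_setting_axioms.intro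
      projected_group.intro projected_group_axioms.intro)
    show "sun_resolvent T l" "sun_resolvent T l" "sun_resolvent T l" by unfold_locales
    show "norm (T t (Bm x)) \<le> C * exp (a * t) * norm x" if t: "0 \<le> t" for t x
    proof -
      have "norm (T t (Bm x)) \<le> M * exp (a * t) * norm (Bm x)" by (rule Mm[OF t B_mem(1)])
      also have "\<dots> \<le> M * exp (a * t) * (norm Bm * norm x)"
        using M by (intro mult_left_mono norm_blinfun) simp
      also have "\<dots> = (M * norm Bm) * (exp (a * t) * norm x)" by simp
      also have "\<dots> \<le> C * (exp (a * t) * norm x)" by (intro mult_right_mono C) simp
      finally show ?thesis by (simp add: mult.assoc)
    qed
    show "norm (Q0 t x) \<le> C * exp (eta / 2 * \<bar>t\<bar>) * norm x" if "x \<in> X0" for t x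
      using order_trans[OF M0[OF that, of t] mult_right_mono[OF mult_right_mono[OF C(1)]]]
      by (simp add: Q0(1)[OF that])
    show "norm (Qp t x) \<le> C * exp (b * t) * norm x" if "t \<le> 0" "x \<in> Xp" for t x
      using order_trans[OF Mp[OF that] mult_right_mono[OF mult_right_mono[OF C(1)]]]
      by (simp add: Qp(1)[OF that(2)])
    show "B0 (Bm x) = 0" for x using B_eq[OF B_mem(1)[of x] zero(2,3)] by simp
    show "B0 x = 0" if "x \<in> Xp" for x using B_eq[OF zero(1,2) that] by simp
    show "0 \<le> C" using C(1) M by simp
    show "sun_cross_part T l B0 \<subseteq> range (sun_j T)" "sun_cross_part T l Bp \<subseteq> range (sun_j T)"
      using assms(7,8) P by simp_all
  qed (use comm B_mem B_sum B0_id Bp_id Q0 Qp assms(9,10) in simp_all)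
  have K: "K = K_map" and BCs: "BCcross = BC eta (sun_cross T l) (sun_star_norm T)" "BCX = BC eta UNIV norm"
    using assms P by simp_all
  have defined: "K_defined T l Pm P0 Pp f t" and in_BC: "K f \<in> BCX" if "f \<in> BCcross" for f t
    using K_map_properties(1)[OF forcing_of_BC, of f t] K_map_in_BC[of f] that K BCs P by simp_all
  have add: "K (\<lambda>\<tau> x. f \<tau> x + g \<tau> x) = (\<lambda>t. K f t + K g t)" if "f \<in> BCcross" "g \<in> BCcross" for f g
    using K_map_linear[of f g 1 1] that K BCs by simp
  have scale: "K (\<lambda>\<tau> x. c * f \<tau> x) = (\<lambda>t. c *\<^sub>R K f t)" if "f \<in> BCcross" for f c
    using K_map_linear[of f f c 0] that K BCs by simp
  have bounded: "BC_norm eta norm (K f) \<le> K_bound * BC_norm eta (sun_star_norm T) f" if "f \<in> BCcross" for f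
    using K_map_properties(3)[OF forcing_of_BC, of f] that K BCs by (intro BC_norm_le) simp
  have unique: "(u \<in> BCX \<and> solves_on_R T f u \<and> P0 (u 0) = 0) \<longleftrightarrow> u = K f" if "f \<in> BCcross" for f u
    using K_map_properties(4,5)[OF forcing_of_BC, of f] K_map_unique[of f u] in_BC[OF that] that K BCs P by auto
  show ?thesis using defined in_BC add scale bounded unique by blast
qed

end
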